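(* Let $d\ge1$ be an integer, $0<s<2d$, and let $N$ be of the form $N=\binom{d+L}{d}$, $L\ge0$ an integer. Then (for fixed $d,s$, as $L\to\infty$) $$\mathbb{E}_{\omega_N\sim\mathfrak{X}_*^{(N)}}\left[\mathcal{E}_s(\omega_N)\right]\le V_s(\mathbb{S}^{2d})N^2-\frac{\mathrm{Vol}(\mathbb{S}^{2d-1})\left(\frac{(2d-s)\left(1-\frac1d\right)}{2e}\right)^{d-\frac s2}}{(2d-s)\,\mathrm{Vol}(\mathbb{S}^{2d})\,(d!)^{1-\frac{s}{2d}}}\left(1-\frac{e^{-1+\frac{1}{2d}}}{2\sqrt{1-\frac{1}{2d}}}\right)N^{1+\frac{s}{2d}}+o\left(N^{1+\frac{s}{2d}}\right).$$
   Context: Spheres $\mathbb{S}^m\subset\mathbb{R}^{m+1}$ carry their usual (unnormalized) surface measure, with total mass $\mathrm{Vol}(\mathbb{S}^m)$; $\mathbb{C}^d$ carries Lebesgue measure. For $\omega_N=\{x_1,\dots,x_N\}$ on a sphere, the Riesz $s$-energy is $\mathcal{E}_s(\omega_N)=\sum_{i\ne j}\|x_i-x_j\|^{-s}$, and $V_s(\mathbb{S}^m)=\frac{1}{\mathrm{Vol}(\mathbb{S}^m)^2}\int_{\mathbb{S}^m\times\mathbb{S}^m}\|p-q\|^{-s}\,dp\,dq$. A point process on a measure space $(\mathbb X,\mu)$ is determinantal (a DPP) with kernel $K$ if its joint intensities with respect to $\mu$ are $\rho_k(x_1,\dots,x_k)=\det(K(x_i,x_j))_{i,j=1}^k$ for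 all $k\ge1$. It is the projection DPP associated with an $N$-dimensional subspace of $L^2(\mathbb X,\mathbb C)$ if $K$ is the reproducing (projection) kernel of that subspace; it then has $N$ points almost surely. $\mathbb{C}^d\equiv\mathbb{R}^{2d}$ via $(z_1,\dots,z_d)\equiv(\mathrm{Re}\,z_1,\mathrm{Im}\,z_1,\dots,\mathrm{Re}\,z_d,\mathrm{Im}\,z_d)$. The stereographic projection is $\Pi_d(p)=\frac{1}{1-p_{2d+1}}(p_1,\dots,p_{2d})$ from $\mathbb{S}^{2d}\setminus\{(0,\dots,0,1)\}$ to $\mathbb{R}^{2d}$. Let $\mathrm{B}_x(a,b)=\int_0^x t^{a-1}(1-t)^{b-1}dt$ and $\mathrm{I}_x(a,b)=\mathrm{B}_x(a,b)/\mathrm{B}_1(a,b)$. The increasing function $g_d:(0,\infty)\to(0,\infty)$ is defined by $\mathrm{I}_{\frac{g_d(t)^2}{1+g_d(t)^2}}(d,d)=\left(\frac{t^2}{1+t^2}\right)^d$, and $\varphi_{g_d}(x)=g_d(\|x\|)\frac{x}{\|x\|}$ on $\mathbb{R}^{2d}\setminus\{0\}$. For $N=\binom{d+L}{d}$, let $\mathfrak{X}_{\mathcal H}$ be the projection DPP of $N$ points in $\mathbb{C}^d$ associated with the subspace of $L^2(\mathbb{C}^d,\mathbb{C})$ spanned by the functions $\frac{z_1^{\alpha_1}\cdots z_d^{\alpha_d}}{(1+\|z\|^2)^{(d+L+1)/2}}$, $\alpha_i\in\mathbb{Z}_{\ge0}$, $\alpha_1+\dots+\alpha_d\le L$. The process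 $\mathfrak{X}_*^{(N)}$ is the push-forward (image) of $\mathfrak{X}_{\mathcal H}$ under the map $\Pi_d^{-1}\circ\varphi_{g_d}$ into $\mathbb{S}^{2d}$. *)

theory Defs
  imports "Jordan_Normal_Form.Determinant" "HOL-Probability.Probability"
begin

no_notation Matrix.vec_index (infixl "$" 100)

section \<open>Spheres, surface measure and Riesz energy\<close>

text \<open>
  The unit sphere of a Euclidean space of dimension \<open>n\<close> is \<open>S^(n-1)\<close>.  Its surface measure is the
  one of polar coordinates: \<open>\<sigma>(A) = n * Leb {r x | x \<in> A, 0 < r \<le> 1}\<close>.

  Throughout, \<open>complex ^ 'd\<close> with \<open>d = CARD('d)\<close> is both \<open>C^d\<close> and \<open>R^(2d)\<close>: its norm and its Lebesgue
  measure are the Euclidean ones of the real and imaginary parts.  Likewise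
  \<open>(complex ^ 'd) \<times> real\<close>, with the Euclidean product norm, is \<open>R^(2d+1)\<close>, the second component being
  the last coordinate.  So \<open>S^(2d-1)\<close> and \<open>S^(2d)\<close> are the unit spheres of these two types.
\<close>

definition surface_measure :: "'a::euclidean_space measure" where
  "surface_measure = scale_measure (ennreal (real DIM('a)))
     (distr (restrict_space lborel (cball 0 1 - {0})) (restrict_space borel (sphere 0 1))
       (\<lambda>x. x /\<^sub>R norm x))"

definition sphere_vol :: "'a::euclidean_space itself \<Rightarrow> real" where
  "sphere_vol _ = measure (surface_measure :: 'a measure) (sphere 0 1)"

text \<open>
  On the diagonal \<open>norm 0 powr (- s) = 0\<close> instead of infinity; for spheres of positive dimension the
  diagonal is a null set.
\<close>

definition riesz_V :: "'a::euclidean_space itself \<Rightarrow> real \<Rightarrow> real" where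
  "riesz_V T s = 1 / (sphere_vol T)\<^sup>2 *
     (\<integral>(p, q). norm (p - q) powr (- s)
        \<partial>((surface_measure :: 'a measure) \<Otimes>\<^sub>M (surface_measure :: 'a measure)))"

text \<open>The sum runs over ordered pairs; it has the junk value 0 if \<open>\<omega>\<close> is infinite.\<close>

definition riesz_energy :: "real \<Rightarrow> 'a::real_normed_vector set \<Rightarrow> real" where
  "riesz_energy s \<omega> = (\<Sum>(x, y) \<in> {(x, y). x \<in> \<omega> \<and> y \<in> \<omega> \<and> x \<noteq> y}. norm (x - y) powr (- s))"


section \<open>Determinantal point processes\<close>

definition point_count :: "'a set \<Rightarrow> 'a set \<Rightarrow> ennreal" where
  "point_count \<omega> B = emeasure (count_space UNIV) (\<omega> \<inter> B)"

text \<open>A (simple) point process: a random locally finite subset of \<open>space \<mu>\<close>.\<close>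

definition point_process ::
    "'w measure \<Rightarrow> 'a::topological_space measure \<Rightarrow> ('w \<Rightarrow> 'a set) \<Rightarrow> bool" where
  "point_process P \<mu> X \<longleftrightarrow> prob_space P \<and>
     (\<forall>w \<in> space P. X w \<subseteq> space \<mu> \<and> (\<forall>C. compact C \<longrightarrow> finite (X w \<inter> C))) \<and>
     (\<forall>B \<in> sets \<mu>. (\<lambda>w. point_count (X w) B) \<in> borel_measurable P)"

text \<open>
  \<open>\<rho>\<close> is the \<open>k\<close>-point joint intensity: \<open>E [X(D_0) \<dots> X(D_(k-1))]\<close> is the integral of \<open>\<rho>\<close> over
  \<open>D_0 \<times> \<dots> \<times> D_(k-1)\<close> for all pairwise disjoint measurable \<open>D_i\<close>.
\<close>

definition joint_intensity ::
    "'w measure \<Rightarrow> 'a measure \<Rightarrow> ('w \<Rightarrow> 'a set) \<Rightarrow> nat \<Rightarrow> ((nat \<Rightarrow> 'a) \<Rightarrow> real) \<Rightarrow> bool" where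
  "joint_intensity P \<mu> X k \<rho> \<longleftrightarrow>
     \<rho> \<in> borel_measurable (\<Pi>\<^sub>M i\<in>{..<k}. \<mu>) \<and>
     (\<forall>x \<in> space (\<Pi>\<^sub>M i\<in>{..<k}. \<mu>). 0 \<le> \<rho> x) \<and>
     (\<forall>D. (\<forall>i<k. D i \<in> sets \<mu>) \<and> disjoint_family_on D {..<k} \<longrightarrow>
        (\<integral>\<^sup>+w. (\<Prod>i<k. point_count (X w) (D i)) \<partial>P) =
        (\<integral>\<^sup>+x \<in> Pi\<^sub>E {..<k} D. ennreal (\<rho> x) \<partial>(\<Pi>\<^sub>M i\<in>{..<k}. \<mu>)))"

definition determinantal_process ::
    "'w measure \<Rightarrow> 'a::topological_space measure \<Rightarrow> ('w \<Rightarrow> 'a set) \<Rightarrow> ('a \<Rightarrow> 'a \<Rightarrow> complex) \<Rightarrow> bool"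
  where
  "determinantal_process P \<mu> X K \<longleftrightarrow> point_process P \<mu> X \<and>
     (\<forall>k\<ge>1. \<exists>\<rho>. joint_intensity P \<mu> X k \<rho> \<and>
        (\<forall>x \<in> space (\<Pi>\<^sub>M i\<in>{..<k}. \<mu>).
           complex_of_real (\<rho> x) = Determinant.det (Matrix.mat k k (\<lambda>(i, j). K (x i) (x j)))))"

text \<open>
  Subspaces of \<open>L^2(\<mu>)\<close> are given by actual functions, so that point evaluations make sense.
\<close>

definition reproducing_kernel ::
    "'a measure \<Rightarrow> ('a \<Rightarrow> complex) set \<Rightarrow> ('a \<Rightarrow> 'a \<Rightarrow> complex) \<Rightarrow> bool" where
  "reproducing_kernel \<mu> H K \<longleftrightarrow>
     (\<forall>f \<in> H. f \<in> borel_measurable \<mu> \<and> integrable \<mu> (\<lambda>z. (cmod (f z))\<^sup>2)) \<and>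
     (\<forall>w \<in> space \<mu>. (\<lambda>z. K z w) \<in> H \<and> (\<forall>f \<in> H. f w = (\<integral>z. f z * cnj (K z w) \<partial>\<mu>)))"

definition projection_DPP ::
    "'w measure \<Rightarrow> 'a::topological_space measure \<Rightarrow> ('a \<Rightarrow> complex) set \<Rightarrow> ('w \<Rightarrow> 'a set) \<Rightarrow> bool"
  where
  "projection_DPP P \<mu> H X \<longleftrightarrow>
     (\<exists>K. reproducing_kernel \<mu> H K \<and> determinantal_process P \<mu> X K)"


section \<open>The processes on \<open>C^d\<close> and on the sphere\<close>

definition weighted_monomial :: "nat \<Rightarrow> ('d::finite \<Rightarrow> nat) \<Rightarrow> complex ^ 'd \<Rightarrow> complex" where
  "weighted_monomial L \<alpha> z = (\<Prod>i\<in>UNIV. (z $ i) ^ \<alpha> i) /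
     complex_of_real ((1 + (norm z)\<^sup>2) powr ((real CARD('d) + real L + 1) / 2))"

definition weighted_poly_space :: "nat \<Rightarrow> (complex ^ 'd::finite \<Rightarrow> complex) set" where
  "weighted_poly_space L =
     {f. \<exists>c :: ('d \<Rightarrow> nat) \<Rightarrow> complex.
           f = (\<lambda>z. \<Sum>\<alpha> | (\<Sum>i\<in>UNIV. \<alpha> i) \<le> L. c \<alpha> * weighted_monomial L \<alpha> z)}"

definition stereo :: "'a::real_normed_vector \<times> real \<Rightarrow> 'a" where
  "stereo p = (1 / (1 - snd p)) *\<^sub>R fst p"

definition stereo_inv :: "'a::real_normed_vector \<Rightarrow> 'a \<times> real" where
  "stereo_inv = inv_into (sphere 0 1 - {(0, 1)}) stereo"

definition inc_Beta :: "real \<Rightarrow> real \<Rightarrow> real \<Rightarrow> real" where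
  "inc_Beta x a b = (LBINT t:{0..x}. t powr (a - 1) * (1 - t) powr (b - 1))"

definition reg_inc_Beta :: "real \<Rightarrow> real \<Rightarrow> real \<Rightarrow> real" where
  "reg_inc_Beta x a b = inc_Beta x a b / inc_Beta 1 a b"

text \<open>The defining equation has exactly one positive solution for \<open>t > 0\<close> and \<open>d \<ge> 1\<close>.\<close>

definition radial_g :: "nat \<Rightarrow> real \<Rightarrow> real" where
  "radial_g d t = (THE r. r > 0 \<and>
     reg_inc_Beta (r\<^sup>2 / (1 + r\<^sup>2)) (real d) (real d) = (t\<^sup>2 / (1 + t\<^sup>2)) ^ d)"

definition radial_map :: "(real \<Rightarrow> real) \<Rightarrow> 'a::real_normed_vector \<Rightarrow> 'a" where
  "radial_map g x = g (norm x) *\<^sub>R (x /\<^sub>R norm x)"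

text \<open>
  The image configuration on \<open>S^(2d)\<close>.  The origin, at which \<open>\<phi>\<close> is undefined in the mathematical
  text (here it is mapped to itself), almost surely does not belong to the process.
\<close>

definition sphere_config :: "(complex ^ 'd::finite) set \<Rightarrow> ((complex ^ 'd) \<times> real) set" where
  "sphere_config \<omega> = (stereo_inv \<circ> radial_map (radial_g CARD('d))) ` \<omega>"

end

theory Submission
  imports Defs
begin

text \<open>The two-point intensity of a projection process with kernel K is
  \<open>K(z,z) K(w,w) - |K(z,w)|^2\<close>. The expected energy of the image process is therefore a
  product term minus the integral T of the Riesz kernel against \<open>|K|^2\<close>. Both become
  explicit. The weighted monomials are orthogonal, and summing them with the multinomial theorem
  gives \<open>K(z,z) = N * fs_density z\<close> and
  \<open>|K(z,w)|^2 = N^2 * fs_density z * fs_density w * Y^L\<close>, where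
  \<open>Y = |1 + <z,w>|^2 / ((1 + |z|^2) (1 + |w|^2))\<close> is the squared cosine of the
  Fubini-Study distance (\<open>proj_kernel_diag\<close>, \<open>cmod_proj_kernel_sq\<close>). The
  function g_d is made so that the ball of radius t goes to the spherical cap of the same mass.
  Hence the map to the sphere carries the probability density \<open>fs_density\<close> to the
  normalized surface measure (\<open>nn_integral_sphere_map\<close>), the product term is exactly
  \<open>V N^2\<close>, and the expectation equals \<open>V N^2 - T\<close> with T =
  \<open>kernel_energy\<close> (\<open>integral_riesz_energy\<close>). It remains to bound T from
  below.

  The geometric heart is \<open>1 - Y \<le> |p - q|^2 / (\<rho>(p) \<rho>(q))\<close> for the images
  p, q of z, w, where \<rho> is the distance to the axis through the poles
  (\<open>fubini_study_ge_chordal\<close>). Along a meridian this rests on the fact that the passage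
  from the polar angle on the sphere to the Fubini-Study angle \<open>arctan |z|\<close> is a
  contraction. The logarithm of its derivative is shown to be nonpositive by a maximum principle: it
  cannot have a positive interior maximum, and it is nonpositive near both poles
  (\<open>l_nonpos\<close>).

  The convex function \<open>Y^L\<close> lies above its tangent at \<open>1 - c / L\<close>
  (\<open>power_lower_bound\<close>), so \<open>Y^L\<close> is bounded below by an affine function
  of \<open>|p - q|^2 / (\<rho>(p) \<rho>(q))\<close>. This is integrated over
  \<open>|p - q| < \<delta>\<close>. By rotation invariance the Riesz mass M of such a cap does not
  depend on its centre, and the mean of \<open>1 / \<rho>^2\<close> over the sphere is
  \<open>(2d - 1) / (2d - 2)\<close> for d at least 2. The outcome is
  \<open>kernel_energy_ge\<close>. With \<open>c = d - s/2\<close> and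
  \<open>\<delta>^2 = c (1 - 1/d) / L\<close> the loss from the tangent is absorbed by c, and
  \<open>N ~ L^d / d!\<close> turns the bound into
  \<open>T \<ge> (c0 - o(1)) N^(1 + s/(2d))\<close>, where c0 is the constant of the theorem before
  its last factor. That factor is at most 1, so the claim follows. For d = 1 the constant is 0 and
  \<open>T \<ge> 0\<close> is enough.\<close>

section \<open>Uniqueness of Lebesgue measure and its invariance under isometries\<close>

text \<open>Integrating \<open>indicator A x * indicator B (x + y)\<close> against \<mu> in x and
  Lebesgue measure in y, in both orders, gives \<open>\<mu>(A) |B| = |A| \<mu>(B)\<close>. Agreement
  on one set B of positive finite measure then fixes the constant.\<close>

lemma lborel_translation_unique:
  fixes \<mu> :: "'a::euclidean_space measure"
  assumes sets: "sets \<mu> = sets borel" and sf: "sigma_finite_measure \<mu>"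
    and inv: "\<And>c. distr \<mu> borel ((+) c) = \<mu>"
    and B: "B \<in> sets borel" "emeasure lborel B \<noteq> 0" "emeasure lborel B \<noteq> \<infinity>"
      "emeasure \<mu> B = emeasure lborel B"
  shows "\<mu> = lborel"
proof (rule measure_eqI)
  interpret \<mu>: sigma_finite_measure \<mu> by (fact sf)
  interpret P: pair_sigma_finite lborel \<mu> ..
  note [measurable_cong] = sets
  fix A assume "A \<in> sets \<mu>"
  then have A[measurable]: "A \<in> sets borel" by (simp add: sets)
  note [measurable] = B(1)
  have sh: "(\<integral>\<^sup>+x. f (x + c) \<partial>\<mu>) = (\<integral>\<^sup>+x. f x \<partial>\<mu>)"
    if [measurable]: "f \<in> borel_measurable borel" for f :: "'a \<Rightarrow> ennreal" and c
    by (subst (2) inv[of c, symmetric]) (simp add: nn_integral_distr add.commute)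
  have shl: "(\<integral>\<^sup>+x. f (c + x) \<partial>lborel) = (\<integral>\<^sup>+x. f x \<partial>lborel)"
    if [measurable]: "f \<in> borel_measurable borel" for f :: "'a \<Rightarrow> ennreal" and c
    by (subst (2) lborel_distr_plus[of c, symmetric]) (simp add: nn_integral_distr)
  have refl: "(\<integral>\<^sup>+y. f (c - y) \<partial>lborel) = (\<integral>\<^sup>+y. f y \<partial>lborel)"
    if [measurable]: "f \<in> borel_measurable borel" for f :: "'a \<Rightarrow> ennreal" and c
    by (subst (2) lborel_affine[of "-1" c]) (simp_all add: nn_integral_density nn_integral_distr)
  have "emeasure \<mu> A * emeasure lborel B = (\<integral>\<^sup>+x. indicator A x * (\<integral>\<^sup>+y. indicator B y \<partial>lborel) \<partial>\<mu>)"
    by (simp add: nn_integral_multc)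
  also have "\<dots> = (\<integral>\<^sup>+x. indicator A x * (\<integral>\<^sup>+y. indicator B (x + y) \<partial>lborel) \<partial>\<mu>)"
    by (subst shl) simp_all
  also have "\<dots> = (\<integral>\<^sup>+x. (\<integral>\<^sup>+y. indicator A x * indicator B (x + y) \<partial>lborel) \<partial>\<mu>)"
    by (subst nn_integral_cmult) simp_all
  also have "\<dots> = (\<integral>\<^sup>+y. (\<integral>\<^sup>+x. indicator A x * indicator B (x + y) \<partial>\<mu>) \<partial>lborel)"
    by (rule P.Fubini') simp
  \<comment> \<open>Translation invariance of \<mu> moves y from the argument of B into that of A,
    so that the integral over y afterwards sees only a reflected translate of A.\<close>
  also have "\<dots> = (\<integral>\<^sup>+y. (\<integral>\<^sup>+x. indicator A (x - y) * indicator B x \<partial>\<mu>) \<partial>lborel)"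
    proof (rule nn_integral_cong)
    fix y
    show "(\<integral>\<^sup>+x. indicator A x * indicator B (x + y) \<partial>\<mu>) = (\<integral>\<^sup>+x. indicator A (x - y) * indicator B x \<partial>\<mu>)"
      using sh[of "\<lambda>x. indicator A (x - y) * indicator B x" y] by simp
  qed
  also have "\<dots> = (\<integral>\<^sup>+x. (\<integral>\<^sup>+y. indicator A (x - y) * indicator B x \<partial>lborel) \<partial>\<mu>)"
    by (rule P.Fubini'[symmetric]) simp
  also have "\<dots> = (\<integral>\<^sup>+x. (\<integral>\<^sup>+y. indicator A (x - y) \<partial>lborel) * indicator B x \<partial>\<mu>)"
    by (subst nn_integral_multc) simp_all
  also have "\<dots> = (\<integral>\<^sup>+x. emeasure lborel A * indicator B x \<partial>\<mu>)"
    by (subst refl) simp_all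
  also have "\<dots> = emeasure lborel A * emeasure lborel B"
    by (simp add: nn_integral_cmult B)
  finally show "emeasure \<mu> A = emeasure lborel A"
    using B(2,3) by (simp add: ennreal_mult_cancel_left mult.commute[of _ "emeasure lborel B"])
qed (simp add: sets)

text \<open>The image measure is translation invariant because T is linear and onto, and it gives
  the unit ball its own volume because T preserves norms. Uniqueness does the rest.\<close>

lemma lborel_isometry:
  fixes T :: "'a::euclidean_space \<Rightarrow> 'a"
  assumes lin: "linear T" and norm: "\<And>x. norm (T x) = norm x"
  shows "distr lborel borel T = lborel"
proof (rule lborel_translation_unique[where B = "cball 0 1"])
  have [measurable]: "T \<in> borel_measurable borel"
    using lin by (simp add: borel_measurable_continuous_onI linear_continuous_on linear_linear)
  have inj: "inj T"
    using norm lin by (metis linear_inj_iff_eq_0 norm_eq_zero)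
  then have surj: "surj T" using lin by (simp add: linear_injective_imp_surjective)
  have cb: "emeasure (distr lborel borel T) (cball 0 r) = emeasure lborel (cball 0 r :: 'a set)" for r
    by (simp add: emeasure_distr vimage_def norm cball_def dist_norm)
  show "sigma_finite_measure (distr lborel borel T)"
  proof
    show "\<exists>A. countable A \<and> A \<subseteq> sets (distr lborel borel T) \<and> \<Union> A = space (distr lborel borel T) \<and>
        (\<forall>a\<in>A. emeasure (distr lborel borel T) a \<noteq> \<infinity>)"
      by (rule exI[of _ "range (\<lambda>n::nat. cball 0 (real n))"])
         (auto simp: cb emeasure_cball real_arch_simple)
  qed
  show "distr (distr lborel borel T) borel ((+) c) = distr lborel borel T" for c
  proof -
    obtain b where b: "c = T b" using surj by blast
    have "distr (distr lborel borel T) borel ((+) c) = distr (distr lborel borel ((+) b)) borel T"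
      using lin by (simp add: distr_distr o_def b linear_add)
    then show ?thesis by (simp only: lborel_distr_plus)
  qed
  show "emeasure (distr lborel borel T) (cball 0 1) = emeasure lborel (cball 0 1 :: 'a set)" by (rule cb)
next
  have "unit_ball_vol (real DIM('a)) \<noteq> 0"
    by (metis less_irrefl of_nat_0_le_iff unit_ball_vol_pos)
  then show "emeasure lborel (cball 0 1 :: 'a set) \<noteq> 0" by (simp add: emeasure_cball)
qed (simp_all add: emeasure_cball)

lemma nn_integral_lborel_isometry:
  fixes T :: "'a::euclidean_space \<Rightarrow> 'a"
  assumes lin: "linear T" and norm: "\<And>x. norm (T x) = norm x" and [measurable]: "f \<in> borel_measurable borel"
  shows "(\<integral>\<^sup>+x. f (T x) \<partial>lborel) = (\<integral>\<^sup>+x. f x \<partial>lborel)"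
proof -
  have [measurable]: "T \<in> borel_measurable borel"
    using lin by (simp add: borel_measurable_continuous_onI linear_continuous_on linear_linear)
  show ?thesis
    by (subst (2) lborel_isometry[OF lin norm, symmetric]) (simp add: nn_integral_distr)
qed

lemma nn_integral_lborel_scaleR:
  fixes f :: "'a::euclidean_space \<Rightarrow> ennreal"
  assumes [measurable]: "f \<in> borel_measurable borel" and c: "c > 0"
  shows "(\<integral>\<^sup>+x. f x \<partial>lborel) = ennreal (c ^ DIM('a)) * (\<integral>\<^sup>+x. f (c *\<^sub>R x) \<partial>lborel)"
  using c by (subst lborel_affine[of c 0]) (simp_all add: nn_integral_density nn_integral_distr nn_integral_cmult)

section \<open>Surface measure, polar coordinates and slicing by height\<close>

lemma space_surface_measure [simp]: "space (surface_measure :: 'a::euclidean_space measure) = sphere 0 1"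
  and sets_surface_measure [measurable_cong]:
    "sets (surface_measure :: 'a measure) = sets (restrict_space borel (sphere 0 1))"
  by (simp_all add: surface_measure_def space_scale_measure space_restrict_space)

lemma borel_measurable_surface_measure:
  "f \<in> borel_measurable borel \<Longrightarrow> f \<in> borel_measurable (surface_measure :: 'a::euclidean_space measure)"
  by (simp add: measurable_cong_sets[OF sets_surface_measure refl] measurable_restrict_space1)

lemma nn_integral_surface_measure:
  fixes f :: "'a::euclidean_space \<Rightarrow> ennreal"
  assumes f[measurable]: "f \<in> borel_measurable borel"
  shows "(\<integral>\<^sup>+x. f x \<partial>surface_measure) =
    ennreal (real DIM('a)) * (\<integral>\<^sup>+x. indicator (cball 0 1 - {0}) x * f (x /\<^sub>R norm x) \<partial>lborel)"
proof -
  have m: "(\<lambda>x::'a. x /\<^sub>R norm x) \<in> restrict_space lborel (cball 0 1 - {0}) \<rightarrow>\<^sub>M restrict_space borel (sphere 0 1)"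
    by (rule measurable_restrict_space3) (auto)
  have "(\<integral>\<^sup>+x. f x \<partial>surface_measure) = ennreal (real DIM('a)) *
     (\<integral>\<^sup>+x. f (x /\<^sub>R norm x) \<partial>restrict_space lborel (cball 0 1 - {0}))"
    unfolding surface_measure_def
    by (subst nn_integral_scale_measure) (use m in \<open>auto simp: nn_integral_distr measurable_restrict_space1\<close>)
  also have "(\<integral>\<^sup>+x. f (x /\<^sub>R norm x) \<partial>restrict_space lborel (cball 0 1 - {0})) =
     (\<integral>\<^sup>+x. indicator (cball 0 1 - {0}) x * f (x /\<^sub>R norm x) \<partial>lborel)"
    by (subst nn_integral_restrict_space) (auto simp: mult.commute)
  finally show ?thesis .
qed

lemma emeasure_surface_measure_sphere:
  "emeasure (surface_measure :: 'a::euclidean_space measure) (sphere 0 1) =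
     ennreal (real DIM('a) * unit_ball_vol (real DIM('a)))"
proof -
  have "emeasure (surface_measure :: 'a::euclidean_space measure) (sphere 0 1) = (\<integral>\<^sup>+x. 1 \<partial>(surface_measure :: 'a measure))"
    by simp
  also have "\<dots> = ennreal (real DIM('a)) * emeasure lborel (cball (0::'a) 1 - {0})"
    by (subst nn_integral_surface_measure) simp_all
  also have "emeasure lborel (cball (0::'a) 1 - {0}) = emeasure lborel (cball (0::'a) 1)"
    by (rule emeasure_Diff_null_set) auto
  finally show ?thesis by (simp add: emeasure_cball ennreal_mult' unit_ball_vol_nonneg)
qed

lemma sphere_vol_eq: "sphere_vol TYPE('a::euclidean_space) = real DIM('a) * unit_ball_vol (real DIM('a))"
  unfolding sphere_vol_def measure_def by (simp add: emeasure_surface_measure_sphere unit_ball_vol_nonneg)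

lemma finite_measure_surface_measure: "finite_measure (surface_measure :: 'a::euclidean_space measure)"
  by (rule finite_measureI) (simp add: emeasure_surface_measure_sphere)

interpretation surface: finite_measure "surface_measure :: 'a::euclidean_space measure"
  by (rule finite_measure_surface_measure)

lemma sphere_vol_pos: "sphere_vol TYPE('a::euclidean_space) > 0"
  by (simp add: sphere_vol_eq unit_ball_vol_pos)

lemma emeasure_surface_space:
  "emeasure (surface_measure :: 'a::euclidean_space measure) (space surface_measure) = ennreal (sphere_vol TYPE('a))"
  by (simp add: emeasure_surface_measure_sphere sphere_vol_eq)

lemma nn_integral_power_tail:
  assumes "a > 0" "n > 0"
  shows "(\<integral>\<^sup>+r. ennreal (1 / r ^ (n+1)) * indicator {a..} r \<partial>lborel) = ennreal (1 / (real n * a ^ n))"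
proof -
  have "(\<integral>\<^sup>+r. ennreal (1 / r ^ (n+1)) * indicator {a..} r \<partial>lborel) = ennreal (0 - (- 1 / (real n * a ^ n)))"
  proof (rule nn_integral_FTC_atLeast)
    fix x assume x: "a \<le> x"
    with assms have "x > 0" by simp
    then show "((\<lambda>x. - 1 / (real n * x ^ n)) has_real_derivative 1 / x ^ (n+1)) (at x)"
      using assms by (auto intro!: derivative_eq_intros simp: power_add[symmetric] field_simps)
        (cases n; simp add: field_simps)
    show "0 \<le> 1 / x ^ (n + 1)" using \<open>x > 0\<close> by simp
  next
    have "filterlim (\<lambda>x::real. x ^ n) at_infinity at_top"
      using assms by (intro filterlim_at_top_imp_at_infinity filterlim_pow_at_top filterlim_ident) auto
    then have "((\<lambda>x::real. (- 1 / real n) / x ^ n) \<longlongrightarrow> 0) at_top"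
      by (intro tendsto_divide_0[OF tendsto_const])
    then show "((\<lambda>x::real. - 1 / (real n * x ^ n)) \<longlongrightarrow> 0) at_top" by simp
  qed simp
  then show ?thesis by simp
qed

text \<open>The surface measure is a cone measure, so the right side is an integral over the
  punctured unit ball of integrals along rays. Substituting \<open>r = norm y * \<rho>\<close>, and
  then \<open>x = \<rho> y\<close> for fixed \<rho>, yields the double integral of
  \<open>f x * norm x ^ n / \<rho> ^ (n + 1)\<close> over \<open>norm x \<le> \<rho>\<close>. The
  integral over \<rho> is \<open>1 / n\<close> by \<open>nn_integral_power_tail\<close> and cancels
  the factor n of the surface measure.\<close>

lemma nn_integral_polar:
  fixes f :: "'a::euclidean_space \<Rightarrow> ennreal"
  assumes [measurable]: "f \<in> borel_measurable borel"
  shows "(\<integral>\<^sup>+x. f x \<partial>lborel) = (\<integral>\<^sup>+\<theta>. (\<integral>\<^sup>+r. f (r *\<^sub>R \<theta>) * ennreal (r ^ (DIM('a) - 1)) * indicator {0<..} r \<partial>lborel)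
    \<partial>surface_measure)"
proof -
  let ?n = "DIM('a)"
  have n: "?n > 0" by simp
  then obtain m where m: "?n = Suc m" by (cases ?n) auto
  define B where "B = cball (0::'a) 1 - {0}"
  have [measurable]: "B \<in> sets borel" by (simp add: B_def)
  let ?H = "\<lambda>\<rho> x. f x * (indicator (-{0}) x * (ennreal (norm x ^ ?n) * (ennreal (1 / \<rho> ^ (?n + 1)) * (if norm x \<le> \<rho> then 1 else 0))))"
  have "(\<integral>\<^sup>+\<theta>. (\<integral>\<^sup>+r. f (r *\<^sub>R \<theta>) * ennreal (r ^ (?n - 1)) * indicator {0<..} r \<partial>lborel) \<partial>surface_measure)
     = ennreal (real ?n) * (\<integral>\<^sup>+y. indicator B y *
        (\<integral>\<^sup>+r. f (r *\<^sub>R (y /\<^sub>R norm y)) * ennreal (r ^ (?n - 1)) * indicator {0<..} r \<partial>lborel) \<partial>lborel)"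
    unfolding B_def by (subst nn_integral_surface_measure) simp_all
  also have "(\<integral>\<^sup>+y. indicator B y *
        (\<integral>\<^sup>+r. f (r *\<^sub>R (y /\<^sub>R norm y)) * ennreal (r ^ (?n - 1)) * indicator {0<..} r \<partial>lborel) \<partial>lborel)
     = (\<integral>\<^sup>+y. (\<integral>\<^sup>+\<rho>. indicator B y * (f (\<rho> *\<^sub>R y) * ennreal (\<rho> ^ m * norm y ^ ?n) * indicator {0<..} \<rho>) \<partial>lborel) \<partial>lborel)"
  proof (rule nn_integral_cong)
    fix y :: 'a
    show "indicator B y *
        (\<integral>\<^sup>+r. f (r *\<^sub>R (y /\<^sub>R norm y)) * ennreal (r ^ (?n - 1)) * indicator {0<..} r \<partial>lborel) =
      (\<integral>\<^sup>+\<rho>. indicator B y * (f (\<rho> *\<^sub>R y) * ennreal (\<rho> ^ m * norm y ^ ?n) * indicator {0<..} \<rho>) \<partial>lborel)"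
    proof (cases "y \<in> B")
      case True
      then have y: "norm y > 0" by (auto simp: B_def)
      have e: "f ((0 + norm y * \<rho>) *\<^sub>R (y /\<^sub>R norm y)) * ennreal ((0 + norm y * \<rho>) ^ (?n - 1)) * indicator {0<..} (0 + norm y * \<rho>)
          = f (\<rho> *\<^sub>R y) * ennreal ((norm y * \<rho>) ^ m) * indicator {0<..} \<rho>" for \<rho>
      proof -
        have "(0 + norm y * \<rho>) *\<^sub>R (y /\<^sub>R norm y) = \<rho> *\<^sub>R y" using y by (simp add: field_simps)
        then show ?thesis using y by (simp add: m indicator_def zero_less_mult_iff del: scaleR_scaleR)
      qed
      have "(\<integral>\<^sup>+r. f (r *\<^sub>R (y /\<^sub>R norm y)) * ennreal (r ^ (?n - 1)) * indicator {0<..} r \<partial>lborel) =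
        ennreal \<bar>norm y\<bar> * (\<integral>\<^sup>+\<rho>. f ((0 + norm y * \<rho>) *\<^sub>R (y /\<^sub>R norm y)) * ennreal ((0 + norm y * \<rho>) ^ (?n - 1)) *
          indicator {0<..} (0 + norm y * \<rho>) \<partial>lborel)"
        by (rule nn_integral_real_affine) (use y in simp_all)
      also have "\<dots> = (\<integral>\<^sup>+\<rho>. ennreal \<bar>norm y\<bar> * (f (\<rho> *\<^sub>R y) * ennreal ((norm y * \<rho>) ^ m) * indicator {0<..} \<rho>) \<partial>lborel)"
        unfolding e by (subst nn_integral_cmult) simp_all
      also have "\<dots> = (\<integral>\<^sup>+\<rho>. f (\<rho> *\<^sub>R y) * ennreal (\<rho> ^ m * norm y ^ ?n) * indicator {0<..} \<rho> \<partial>lborel)"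
      proof (rule nn_integral_cong)
        fix \<rho> :: real
        have "ennreal \<bar>norm y\<bar> * ennreal ((norm y * \<rho>) ^ m) = ennreal (\<rho> ^ m * norm y ^ ?n)" if "\<rho> > 0"
          using that by (simp add: m power_mult_distrib mult_ac flip: ennreal_mult)
        then show "ennreal \<bar>norm y\<bar> * (f (\<rho> *\<^sub>R y) * ennreal ((norm y * \<rho>) ^ m) * indicator {0<..} \<rho>) =
          f (\<rho> *\<^sub>R y) * ennreal (\<rho> ^ m * norm y ^ ?n) * indicator {0<..} \<rho>"
          by (cases "\<rho> > 0") (simp_all add: mult.left_commute[of _ "f _"])
      qed
      finally show ?thesis using True by simp
    qed simp
  qed
  also have "\<dots> = (\<integral>\<^sup>+\<rho>. (\<integral>\<^sup>+y. indicator B y * (f (\<rho> *\<^sub>R y) * ennreal (\<rho> ^ m * norm y ^ ?n) * indicator {0<..} \<rho>) \<partial>lborel) \<partial>lborel)"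
    by (rule lborel_pair.Fubini') simp
  also have "\<dots> = (\<integral>\<^sup>+\<rho>. (\<integral>\<^sup>+x. ?H \<rho> x \<partial>lborel) \<partial>lborel)"
  proof (rule nn_integral_cong)
    fix \<rho> :: real
    show "(\<integral>\<^sup>+y. indicator B y * (f (\<rho> *\<^sub>R y) * ennreal (\<rho> ^ m * norm y ^ ?n) * indicator {0<..} \<rho>) \<partial>lborel) =
       (\<integral>\<^sup>+x. ?H \<rho> x \<partial>lborel)"
    proof (cases "\<rho> > 0")
      case True
      have "(\<integral>\<^sup>+x. ?H \<rho> x \<partial>lborel) = ennreal (\<rho> ^ ?n) * (\<integral>\<^sup>+x. ?H \<rho> (\<rho> *\<^sub>R x) \<partial>lborel)"
        using True by (subst nn_integral_lborel_scaleR[where c = \<rho>]) simp_all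
      also have "\<dots> = (\<integral>\<^sup>+x. ennreal (\<rho> ^ ?n) * ?H \<rho> (\<rho> *\<^sub>R x) \<partial>lborel)"
        by (subst nn_integral_cmult) simp_all
      also have "\<dots> = (\<integral>\<^sup>+y. indicator B y * (f (\<rho> *\<^sub>R y) * ennreal (\<rho> ^ m * norm y ^ ?n) * indicator {0<..} \<rho>) \<partial>lborel)"
      proof (rule nn_integral_cong)
        fix x :: 'a
        have "\<rho> ^ ?n * ((\<rho> * norm x) ^ ?n * (1 / \<rho> ^ (?n + 1))) = \<rho> ^ m * norm x ^ ?n"
          using True by (simp add: m power_mult_distrib field_simps)
        then have e: "ennreal (\<rho> ^ ?n) * (ennreal ((\<rho> * norm x) ^ ?n) * ennreal (1 / \<rho> ^ (?n + 1))) = ennreal (\<rho> ^ m * norm x ^ ?n)"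
          using True by (simp flip: ennreal_mult)
        show "ennreal (\<rho> ^ ?n) * ?H \<rho> (\<rho> *\<^sub>R x) =
          indicator B x * (f (\<rho> *\<^sub>R x) * ennreal (\<rho> ^ m * norm x ^ ?n) * indicator {0<..} \<rho>)"
        proof (cases "x \<in> B")
          case T: True
          then show ?thesis using True e
            by (auto simp: B_def mult_ac indicator_def)
        next
          case False
          then show ?thesis using True by (auto simp: B_def indicator_def)
        qed
      qed
      finally show ?thesis ..
    next
      case False
      have "(\<integral>\<^sup>+x. ?H \<rho> x \<partial>lborel) = (\<integral>\<^sup>+(x::'a). 0 \<partial>lborel)"
        using False by (intro nn_integral_cong) (auto simp: indicator_def dest: order_trans[OF norm_ge_zero])
      moreover have "indicator {0<..} \<rho> = (0::ennreal)" using False by simp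
      ultimately show ?thesis by simp
    qed
  qed
  also have "\<dots> = (\<integral>\<^sup>+x. (\<integral>\<^sup>+\<rho>. ?H \<rho> x \<partial>lborel) \<partial>lborel)"
    by (rule lborel_pair.Fubini') simp
  also have "\<dots> = (\<integral>\<^sup>+x. f x * ennreal (1 / real ?n) \<partial>lborel)"
  proof (rule nn_integral_cong_AE)
    have "AE x in lborel. x \<noteq> (0::'a)" by (rule AE_lborel_singleton)
    then show "AE x in lborel. (\<integral>\<^sup>+\<rho>. ?H \<rho> x \<partial>lborel) = f x * ennreal (1 / real ?n)"
    proof (eventually_elim)
      fix x :: 'a assume x: "x \<noteq> 0"
      have "(\<integral>\<^sup>+\<rho>. ?H \<rho> x \<partial>lborel) =
        f x * (ennreal (norm x ^ ?n) * (\<integral>\<^sup>+\<rho>. ennreal (1 / \<rho> ^ (?n + 1)) * indicator {norm x..} \<rho> \<partial>lborel))"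
      proof -
        have "(\<integral>\<^sup>+\<rho>. ?H \<rho> x \<partial>lborel) = (\<integral>\<^sup>+\<rho>. f x * (ennreal (norm x ^ ?n) *
            (ennreal (1 / \<rho> ^ (?n + 1)) * indicator {norm x..} \<rho>)) \<partial>lborel)"
          using x by (intro nn_integral_cong) (simp add: indicator_def)
        then show ?thesis by (simp add: nn_integral_cmult)
      qed
      also have "(\<integral>\<^sup>+\<rho>. ennreal (1 / \<rho> ^ (?n + 1)) * indicator {norm x..} \<rho> \<partial>lborel) = ennreal (1 / (real ?n * norm x ^ ?n))"
        by (rule nn_integral_power_tail) (use x in auto)
      also have "ennreal (norm x ^ ?n) * ennreal (1 / (real ?n * norm x ^ ?n)) = ennreal (1 / real ?n)"
        using x by (simp flip: ennreal_mult)
      finally show "(\<integral>\<^sup>+\<rho>. ?H \<rho> x \<partial>lborel) = f x * ennreal (1 / real ?n)" .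
    qed
  qed
  also have "ennreal (real ?n) * (\<integral>\<^sup>+x. f x * ennreal (1 / real ?n) \<partial>lborel) = (\<integral>\<^sup>+x. f x \<partial>lborel)"
    by (subst nn_integral_multc)
       (simp_all add: mult.left_commute[of "ennreal _"] n flip: ennreal_mult)
  finally show ?thesis ..
qed

text \<open>Compact subintervals, on which the classical formula holds, exhaust the open interval,
  and monotone convergence passes to the limit. Thus g and g' may be unbounded at the end
  points.\<close>

lemma nn_integral_substitution_open_interval:
  fixes f :: "real \<Rightarrow> ennreal" and g g' :: "real \<Rightarrow> real"
  assumes [measurable]: "f \<in> borel_measurable borel" "g \<in> borel_measurable borel" "g' \<in> borel_measurable borel"
    and ab: "a < b"
    and der: "\<And>x. a < x \<Longrightarrow> x < b \<Longrightarrow> (g has_real_derivative g' x) (at x)"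
    and cont: "continuous_on {a<..<b} g'"
    and nonneg: "\<And>x. a < x \<Longrightarrow> x < b \<Longrightarrow> 0 \<le> g' x"
  shows "(\<integral>\<^sup>+y. f y * indicator (g ` {a<..<b}) y \<partial>lborel) =
    (\<integral>\<^sup>+x. f (g x) * ennreal (g' x) * indicator {a<..<b} x \<partial>lborel)"
proof -
  \<comment> \<open>The 3 keeps the cut at either end below half of the length, so that already the
    first interval is nondegenerate.\<close>
  define l where "l = (\<lambda>i::nat. a + (b - a) / (real i + 3))"
  define u where "u = (\<lambda>i::nat. b - (b - a) / (real i + 3))"
  have lu: "a < l i" "u i < b" "l i < u i" for i
  proof -
    have "(b - a) / (real i + 3) < (b - a) / 2"
      using ab by (intro divide_strict_left_mono) auto
    then show "l i < u i" unfolding l_def u_def by argo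
    show "a < l i" "u i < b" using ab by (auto simp: l_def u_def)
  qed
  have mono_frac: "(b - a) / (real j + 3) \<le> (b - a) / (real i + 3)" if "i \<le> j" for i j
    using ab that by (intro divide_left_mono) auto
  have decl: "l j \<le> l i" and incu: "u i \<le> u j" if "i \<le> j" for i j
    using mono_frac[OF that] by (auto simp: l_def u_def)
  have gmono: "g x \<le> g y" if "a < x" "x \<le> y" "y < b" for x y
    using that by (intro DERIV_nonneg_imp_nondecreasing[of x y g]) (auto intro!: der nonneg exI)
  have ex: "\<exists>i. l i \<le> x \<and> x \<le> u i" if "a < x" "x < b" for x
  proof -
    define m where "m = min (x - a) (b - x)"
    have m: "m > 0" using that by (simp add: m_def)
    obtain i :: nat where "real i > (b - a) / m" using reals_Archimedean2 by blast
    then have "(b - a) / (real i + 3) \<le> m" using m by (simp add: field_simps)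
    then have "l i \<le> x \<and> x \<le> u i" by (auto simp: l_def u_def m_def)
    then show ?thesis ..
  qed
  have U1: "(\<Union>i. {l i..u i}) = {a<..<b}"
  proof (intro equalityI subsetI)
    fix x assume "x \<in> (\<Union>i. {l i..u i})"
    then obtain i where "l i \<le> x" "x \<le> u i" by auto
    then show "x \<in> {a<..<b}" using lu[of i] by simp
  next
    fix x assume "x \<in> {a<..<b}"
    then show "x \<in> (\<Union>i. {l i..u i})" using ex[of x] by simp
  qed
  have img: "{g (l i)..g (u i)} = g ` {l i..u i}" for i
  proof -
    have c: "continuous_on {l i..u i} g"
      using lu[of i] by (intro DERIV_continuous_on[where D = g'])
        (meson atLeastAtMost_iff der has_field_derivative_at_within le_less_trans less_le_trans)
    show ?thesis
    proof (intro equalityI subsetI)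
      fix y assume "y \<in> {g (l i)..g (u i)}"
      then show "y \<in> g ` {l i..u i}" using IVT'[of g "l i" y "u i"] c lu[of i] by force
    next
      fix y assume "y \<in> g ` {l i..u i}"
      then obtain x where "x \<in> {l i..u i}" "y = g x" by auto
      then show "y \<in> {g (l i)..g (u i)}" using gmono[of "l i" x] gmono[of x "u i"] lu[of i] by auto
    qed
  qed
  have U2: "(\<Union>i. {g (l i)..g (u i)}) = g ` {a<..<b}"
    unfolding img U1[symmetric] by blast
  have gm[measurable]: "g ` {a<..<b} \<in> sets borel"
    unfolding U2[symmetric] by measurable
  let ?M = "density lborel f" and ?N = "density lborel (\<lambda>x. f (g x) * ennreal (g' x))"
  have "(\<integral>\<^sup>+y. f y * indicator (g ` {a<..<b}) y \<partial>lborel) = emeasure ?M (\<Union>i. {g (l i)..g (u i)})"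
    unfolding U2 by (simp add: emeasure_density)
  also have "\<dots> = (SUP i. emeasure ?M {g (l i)..g (u i)})"
  proof (rule SUP_emeasure_incseq[symmetric])
    show "incseq (\<lambda>i. {g (l i)..g (u i)})"
      unfolding img incseq_def using decl incu by (intro allI impI image_mono) auto
  qed auto
  also have "\<dots> = (SUP i. emeasure ?N {l i..u i})"
  proof (rule SUP_cong)
    fix i
    have "emeasure ?M {g (l i)..g (u i)} = (\<integral>\<^sup>+x. f x * indicator {g (l i)..g (u i)} x \<partial>lborel)"
      by (simp add: emeasure_density)
    also have "\<dots> = (\<integral>\<^sup>+x. f (g x) * g' x * indicator {l i..u i} x \<partial>lborel)"
      using lu[of i] by (intro nn_integral_substitution_aux)
        (auto intro!: der nonneg continuous_on_subset[OF cont])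
    finally show "emeasure ?M {g (l i)..g (u i)} = emeasure ?N {l i..u i}"
      by (simp add: emeasure_density)
  qed simp
  also have "\<dots> = emeasure ?N (\<Union>i. {l i..u i})"
    using decl incu by (intro SUP_emeasure_incseq) (auto simp: incseq_def)
  also have "\<dots> = (\<integral>\<^sup>+x. f (g x) * ennreal (g' x) * indicator {a<..<b} x \<partial>lborel)"
    unfolding U1 by (simp add: emeasure_density)
  finally show ?thesis .
qed

lemma nn_integral_power_Icc:
  assumes "a \<ge> 0"
  shows "(\<integral>\<^sup>+r. ennreal (r ^ n) * indicator {0..a} r \<partial>lborel) = ennreal (a ^ (n + 1) / real (n + 1))"
proof -
  have "(\<integral>\<^sup>+r. ennreal (r ^ n) * indicator {0..a} r \<partial>lborel) = ennreal (a ^ (n + 1) / real (n + 1) - 0 ^ (n + 1) / real (n + 1))"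
  proof (rule nn_integral_FTC_Icc)
    show "((\<lambda>x. x ^ (n + 1) / real (n + 1)) has_real_derivative x ^ n) (at x)" for x :: real
      by (rule derivative_eq_intros refl | simp)+
  qed (use assms in auto)
  then show ?thesis by simp
qed

lemma borel_measurable_radial_projection:
  fixes f :: "'a::euclidean_space \<Rightarrow> ennreal"
  assumes [measurable]: "f \<in> borel_measurable borel"
  shows "(\<lambda>x. indicator (cball 0 1 - {0}) x * f (x /\<^sub>R norm x)) \<in> borel_measurable borel"
proof -
  have [measurable]: "cball (0::'a) 1 - {0} \<in> sets borel" by auto
  show ?thesis by measurable
qed

text \<open>The sphere is parametrized from the cylinder by a horizontal direction and the slope k
  of the ray. In the cone over the sphere, horizontal polar coordinates
  \<open>r *\<^sub>R \<theta>\<close> and the vertical coordinate \<open>y = r * k\<close> describe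
  the unit ball by \<open>r * sqrt (1 + k^2) \<le> 1\<close>. Integrating \<open>r ^ n\<close> over
  this range produces the density and cancels the dimension factor.\<close>

lemma nn_integral_surface_measure_slope:
  fixes f :: "'a::euclidean_space \<times> real \<Rightarrow> ennreal"
  assumes [measurable]: "f \<in> borel_measurable borel"
  shows "(\<integral>\<^sup>+p. f p \<partial>surface_measure) =
    (\<integral>\<^sup>+\<theta>. (\<integral>\<^sup>+k. f ((\<theta>, k) /\<^sub>R sqrt (1 + k\<^sup>2)) * ennreal (1 / sqrt (1 + k\<^sup>2) ^ (DIM('a) + 1)) \<partial>lborel) \<partial>surface_measure)"
proof -
  let ?n = "DIM('a)"
  have n: "?n > 0" by simp
  then obtain m where m: "?n = Suc m" by (cases ?n) auto
  let ?q = "\<lambda>k::real. sqrt (1 + k\<^sup>2)"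
  have q: "?q k > 0" for k by (simp add: add_pos_nonneg)
  let ?B = "cball (0::'a \<times> real) 1 - {0}"
  let ?G = "\<lambda>X. indicator ?B X * f (X /\<^sub>R norm X)"
  have G: "?G \<in> borel_measurable borel" by (rule borel_measurable_radial_projection[OF assms])
  then have G2: "?G \<in> borel_measurable (borel \<Otimes>\<^sub>M borel)" unfolding borel_prod .
  have [measurable]: "f \<in> borel_measurable (borel \<Otimes>\<^sub>M borel)" by (simp add: borel_prod)
  have "(\<integral>\<^sup>+p. f p \<partial>surface_measure) = ennreal (real (?n + 1)) * (\<integral>\<^sup>+X. ?G X \<partial>lborel)"
    by (subst nn_integral_surface_measure) (simp_all add: assms)
  also have "(\<integral>\<^sup>+X. ?G X \<partial>lborel) = (\<integral>\<^sup>+x. (\<integral>\<^sup>+y. ?G (x, y) \<partial>lborel) \<partial>lborel)"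
    unfolding lborel_prod[symmetric] by (rule lborel.nn_integral_fst[symmetric]) (use G2 in \<open>simp cong: measurable_cong_sets\<close>)
  also have "\<dots> = (\<integral>\<^sup>+\<theta>. (\<integral>\<^sup>+r. (\<integral>\<^sup>+y. ?G (r *\<^sub>R \<theta>, y) \<partial>lborel) * ennreal (r ^ (?n - 1)) * indicator {0<..} r \<partial>lborel)
    \<partial>surface_measure)"
  proof (rule nn_integral_polar)
    show "(\<lambda>x. \<integral>\<^sup>+y. ?G (x, y) \<partial>lborel) \<in> borel_measurable borel"
      by (rule lborel.borel_measurable_nn_integral_fst) (use G2 in \<open>simp cong: measurable_cong_sets\<close>)
  qed
  also have "\<dots> = (\<integral>\<^sup>+\<theta>. (\<integral>\<^sup>+k. f ((\<theta>, k) /\<^sub>R ?q k) * ennreal (1 / real (?n + 1)) * ennreal (1 / ?q k ^ (?n + 1)) \<partial>lborel) \<partial>surface_measure)"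
  proof (rule nn_integral_cong)
    fix \<theta> :: 'a assume "\<theta> \<in> space surface_measure"
    then have \<theta>: "norm \<theta> = 1" by simp
    let ?I = "\<lambda>r k. if 0 < r \<and> r * ?q k \<le> 1 then 1 else (0::ennreal)"
    have "(\<integral>\<^sup>+r. (\<integral>\<^sup>+y. ?G (r *\<^sub>R \<theta>, y) \<partial>lborel) * ennreal (r ^ (?n - 1)) * indicator {0<..} r \<partial>lborel) =
      (\<integral>\<^sup>+r. (\<integral>\<^sup>+k. f ((\<theta>, k) /\<^sub>R ?q k) * (ennreal (r ^ ?n) * ?I r k) \<partial>lborel) \<partial>lborel)"
    proof (rule nn_integral_cong)
      fix r :: real
      show "(\<integral>\<^sup>+y. ?G (r *\<^sub>R \<theta>, y) \<partial>lborel) * ennreal (r ^ (?n - 1)) * indicator {0<..} r =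
        (\<integral>\<^sup>+k. f ((\<theta>, k) /\<^sub>R ?q k) * (ennreal (r ^ ?n) * ?I r k) \<partial>lborel)"
      proof (cases "r > 0")
        case True
        have e: "?G (r *\<^sub>R \<theta>, 0 + r * k) = f ((\<theta>, k) /\<^sub>R ?q k) * ?I r k" for k
        proof -
          have eq: "(r *\<^sub>R \<theta>, 0 + r * k) = r *\<^sub>R (\<theta>, k)" by simp
          have nk: "norm (\<theta>, k) = ?q k" by (simp add: norm_Pair \<theta>)
          have "(r *\<^sub>R (\<theta>, k)) /\<^sub>R norm (r *\<^sub>R (\<theta>, k)) = (\<theta>, k) /\<^sub>R ?q k"
            using True by (simp only: norm_scaleR nk) (simp add: field_simps)
          moreover have "r *\<^sub>R (\<theta>, k) \<in> ?B \<longleftrightarrow> r * ?q k \<le> 1"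
          proof -
            have "r *\<^sub>R (\<theta>, k) \<noteq> 0" using True \<theta> by (auto simp: zero_prod_def)
            moreover have "norm (r *\<^sub>R (\<theta>, k)) = r * ?q k" using True by (simp only: norm_scaleR nk)
            ultimately show ?thesis by (simp only: Diff_iff mem_cball dist_0_norm singleton_iff) simp
          qed
          ultimately show ?thesis unfolding eq using True by (simp only: indicator_def) (simp add: mult.commute)
        qed
        have Gr: "(\<lambda>y. ?G (r *\<^sub>R \<theta>, y)) \<in> borel_measurable borel"
          by (rule measurable_Pair2[OF G2]) simp
        have aff: "(\<integral>\<^sup>+y. ?G (r *\<^sub>R \<theta>, y) \<partial>lborel) = ennreal \<bar>r\<bar> * (\<integral>\<^sup>+k. ?G (r *\<^sub>R \<theta>, 0 + r * k) \<partial>lborel)"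
          by (rule nn_integral_real_affine[OF Gr]) (use True in simp)
        have "ennreal \<bar>r\<bar> * ennreal (r ^ (?n - 1)) = ennreal (r ^ ?n)"
          using True by (simp add: m flip: ennreal_mult)
        then have "ennreal \<bar>r\<bar> * I * ennreal (r ^ (?n - 1)) = ennreal (r ^ ?n) * I" for I
          by (simp only: mult.commute[of _ I] mult.assoc)
        then have "(\<integral>\<^sup>+y. ?G (r *\<^sub>R \<theta>, y) \<partial>lborel) * ennreal (r ^ (?n - 1)) =
            ennreal (r ^ ?n) * (\<integral>\<^sup>+k. ?G (r *\<^sub>R \<theta>, 0 + r * k) \<partial>lborel)"
          unfolding aff .
        also have "\<dots> = (\<integral>\<^sup>+k. ennreal (r ^ ?n) * (f ((\<theta>, k) /\<^sub>R ?q k) * ?I r k) \<partial>lborel)"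
          unfolding e by (subst nn_integral_cmult) simp_all
        also have "\<dots> = (\<integral>\<^sup>+k. f ((\<theta>, k) /\<^sub>R ?q k) * (ennreal (r ^ ?n) * ?I r k) \<partial>lborel)"
          by (simp only: mult.left_commute)
        finally show ?thesis
          using True by (simp only: indicator_simps greaterThan_iff mult_1_right)
      qed simp
    qed
    also have "\<dots> = (\<integral>\<^sup>+k. (\<integral>\<^sup>+r. f ((\<theta>, k) /\<^sub>R ?q k) * (ennreal (r ^ ?n) * ?I r k) \<partial>lborel) \<partial>lborel)"
    proof (rule lborel_pair.Fubini')
      have [measurable]: "(\<lambda>k. f ((\<theta>, k) /\<^sub>R ?q k)) \<in> borel_measurable borel"
        by (simp add: scaleR_Pair)
      show "(\<lambda>(k, r). f ((\<theta>, k) /\<^sub>R ?q k) * (ennreal (r ^ ?n) * ?I r k)) \<in> borel_measurable (lborel \<Otimes>\<^sub>M lborel)"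
        by measurable
    qed
    also have "\<dots> = (\<integral>\<^sup>+k. f ((\<theta>, k) /\<^sub>R ?q k) * ennreal (1 / real (?n + 1)) * ennreal (1 / ?q k ^ (?n + 1)) \<partial>lborel)"
    proof (rule nn_integral_cong)
      fix k :: real
      have "(\<integral>\<^sup>+r. ennreal (r ^ ?n) * ?I r k \<partial>lborel) = (\<integral>\<^sup>+r. ennreal (r ^ ?n) * indicator {0..1 / ?q k} r \<partial>lborel)"
      proof (rule nn_integral_cong)
        fix r :: real
        have "r * ?q k \<le> 1 \<longleftrightarrow> r \<le> 1 / ?q k"
          using q[of k] by (simp only: pos_le_divide_eq)
        moreover have "ennreal (r ^ ?n) * (if 0 < r \<and> A then 1 else 0) = ennreal (r ^ ?n) * (if 0 \<le> r \<and> A then 1 else 0)" for A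
          by (cases "r = 0") (auto simp: m)
        ultimately show "ennreal (r ^ ?n) * ?I r k = ennreal (r ^ ?n) * indicator {0..1 / ?q k} r"
          by (simp only: indicator_def of_bool_def atLeastAtMost_iff)
      qed
      also have "\<dots> = ennreal ((1 / ?q k) ^ (?n + 1) / real (?n + 1))"
        using q[of k] by (intro nn_integral_power_Icc) simp
      also have "\<dots> = ennreal (1 / real (?n + 1)) * ennreal (1 / ?q k ^ (?n + 1))"
        using q[of k] by (simp add: power_divide mult.commute flip: ennreal_mult)
      finally show "(\<integral>\<^sup>+r. f ((\<theta>, k) /\<^sub>R ?q k) * (ennreal (r ^ ?n) * ?I r k) \<partial>lborel) =
         f ((\<theta>, k) /\<^sub>R ?q k) * ennreal (1 / real (?n + 1)) * ennreal (1 / ?q k ^ (?n + 1))"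
        by (subst nn_integral_cmult) (simp_all add: mult.assoc)
    qed
    finally show "(\<integral>\<^sup>+r. (\<integral>\<^sup>+y. ?G (r *\<^sub>R \<theta>, y) \<partial>lborel) * ennreal (r ^ (?n - 1)) * indicator {0<..} r \<partial>lborel) =
      (\<integral>\<^sup>+k. f ((\<theta>, k) /\<^sub>R ?q k) * ennreal (1 / real (?n + 1)) * ennreal (1 / ?q k ^ (?n + 1)) \<partial>lborel)" .
  qed
  also have "ennreal (real (?n + 1)) * \<dots> = (\<integral>\<^sup>+\<theta>. (\<integral>\<^sup>+k. f ((\<theta>, k) /\<^sub>R ?q k) * ennreal (1 / ?q k ^ (?n + 1)) \<partial>lborel) \<partial>surface_measure)"
  proof -
    define Z where "Z \<theta> = (\<integral>\<^sup>+k. f ((\<theta>, k) /\<^sub>R ?q k) * ennreal (1 / ?q k ^ (?n + 1)) \<partial>lborel)" for \<theta>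
    have Z: "Z \<in> borel_measurable surface_measure"
      unfolding Z_def by (intro borel_measurable_surface_measure) (simp add: scaleR_Pair)
    have one: "ennreal (real (?n + 1)) * ennreal (1 / real (?n + 1)) = 1"
      by (subst ennreal_mult[symmetric]) simp_all
    have "(\<integral>\<^sup>+k. f ((\<theta>, k) /\<^sub>R ?q k) * ennreal (1 / real (?n + 1)) * ennreal (1 / ?q k ^ (?n + 1)) \<partial>lborel) =
       ennreal (1 / real (?n + 1)) * Z \<theta>" for \<theta>
      unfolding Z_def by (subst nn_integral_cmult[symmetric]) (simp_all add: mult_ac)
    then have "ennreal (real (?n + 1)) * (\<integral>\<^sup>+\<theta>. (\<integral>\<^sup>+k. f ((\<theta>, k) /\<^sub>R ?q k) * ennreal (1 / real (?n + 1)) * ennreal (1 / ?q k ^ (?n + 1)) \<partial>lborel) \<partial>surface_measure)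
      = ennreal (real (?n + 1)) * (ennreal (1 / real (?n + 1)) * (\<integral>\<^sup>+\<theta>. Z \<theta> \<partial>surface_measure))"
      by (simp only: nn_integral_cmult[OF Z])
    also have "\<dots> = (\<integral>\<^sup>+\<theta>. Z \<theta> \<partial>surface_measure)"
      unfolding mult.assoc[symmetric] one by simp
    finally show ?thesis unfolding Z_def .
  qed
  finally show ?thesis .
qed

lemma range_slope: "(\<lambda>h. h / sqrt (1 - h\<^sup>2)) ` {-1<..<1} = (UNIV :: real set)"
proof (intro equalityI subsetI)
  fix k :: real
  let ?q = "sqrt (1 + k\<^sup>2)"
  have q: "?q > 0" "?q\<^sup>2 = 1 + k\<^sup>2" by (simp_all add: add_pos_nonneg)
  have "\<bar>k\<bar> < ?q" by (rule real_less_rsqrt) simp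
  then have "k / ?q \<in> {-1<..<1}" using q by (simp add: field_simps abs_less_iff)
  moreover have "1 - (k / ?q)\<^sup>2 = (1 / ?q)\<^sup>2" using q by (simp add: power_divide field_simps)
  then have "sqrt (1 - (k / ?q)\<^sup>2) = 1 / ?q" using q by simp
  then have "k = (k / ?q) / sqrt (1 - (k / ?q)\<^sup>2)" using q by simp
  ultimately show "k \<in> (\<lambda>h. h / sqrt (1 - h\<^sup>2)) ` {-1<..<1}" by blast
qed simp

text \<open>The substitution \<open>k = h / sqrt (1 - h^2)\<close> passes from slope to height. The
  exponent of \<open>1 - h^2\<close> is half of the horizontal dimension minus one, an integer
  because that dimension is even. For d = 1 this is Archimedes' theorem that height is uniformly
  distributed on the sphere.\<close>

lemma nn_integral_surface_measure_height:
  fixes f :: "'a::euclidean_space \<times> real \<Rightarrow> ennreal"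
  assumes [measurable]: "f \<in> borel_measurable borel" and dim: "DIM('a) = 2 * d"
  shows "(\<integral>\<^sup>+p. f p \<partial>surface_measure) =
    (\<integral>\<^sup>+\<theta>. (\<integral>\<^sup>+h. f (sqrt (1 - h\<^sup>2) *\<^sub>R \<theta>, h) * ennreal ((1 - h\<^sup>2) ^ (d - 1)) * indicator {-1<..<1} h \<partial>lborel)
      \<partial>surface_measure)"
  unfolding nn_integral_surface_measure_slope[OF assms(1)]
proof (rule nn_integral_cong)
  fix \<theta> :: 'a assume "\<theta> \<in> space surface_measure"
  have "d > 0" using dim DIM_positive[where 'a='a] by simp
  then obtain m where m: "d = Suc m" by (cases d) auto
  let ?F = "\<lambda>k. f ((\<theta>, k) /\<^sub>R sqrt (1 + k\<^sup>2)) * ennreal (1 / sqrt (1 + k\<^sup>2) ^ (DIM('a) + 1))"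
  have [measurable]: "f \<in> borel_measurable (borel \<Otimes>\<^sub>M borel)" by (simp add: borel_prod)
  let ?g = "\<lambda>h::real. h / sqrt (1 - h\<^sup>2)"
  let ?g' = "\<lambda>h::real. 1 / sqrt (1 - h\<^sup>2) ^ 3"
  have pos: "1 - h\<^sup>2 > 0" if "-1 < h" "h < 1" for h :: real
    using that by (simp add: abs_square_less_1 abs_less_iff)
  have "(\<integral>\<^sup>+k. ?F k \<partial>lborel) = (\<integral>\<^sup>+k. ?F k * indicator (?g ` {-1<..<1}) k \<partial>lborel)"
    unfolding range_slope by simp
  also have "\<dots> = (\<integral>\<^sup>+h. ?F (?g h) * ennreal (?g' h) * indicator {-1<..<1} h \<partial>lborel)"
  proof (rule nn_integral_substitution_open_interval)
    show "?F \<in> borel_measurable borel" by (simp add: scaleR_Pair)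
    fix h :: real assume h: "-1 < h" "h < 1"
    define w where "w = sqrt (1 - h\<^sup>2)"
    have w: "w > 0" "w\<^sup>2 = 1 - h\<^sup>2" using pos[OF h] by (simp_all add: w_def)
    have "((\<lambda>h. sqrt (1 - h\<^sup>2)) has_real_derivative - h / w) (at h)"
      using pos[OF h] by (auto intro!: derivative_eq_intros simp: w_def field_simps)
    then have "(?g has_real_derivative (1 * w - h * (- h / w)) / (w * w)) (at h)"
      using w unfolding w_def by (intro DERIV_divide) (auto intro!: derivative_eq_intros)
    moreover have "(1 * w - h * (- h / w)) / (w * w) = ?g' h"
      using w unfolding w_def[symmetric] by (simp add: divide_simps power2_eq_square power3_eq_cube) 
    ultimately show "(?g has_real_derivative ?g' h) (at h)" by simp
  next
    show "continuous_on {-1<..<1} ?g'"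
      using pos by (intro continuous_intros) force+
  next
    fix h :: real assume "-1 < h" "h < 1"
    then show "0 \<le> ?g' h" using pos[of h] by simp
  qed simp_all
  also have "\<dots> = (\<integral>\<^sup>+h. f (sqrt (1 - h\<^sup>2) *\<^sub>R \<theta>, h) * ennreal ((1 - h\<^sup>2) ^ (d - 1)) * indicator {-1<..<1} h \<partial>lborel)"
  proof (rule nn_integral_cong)
    fix h :: real
    show "?F (?g h) * ennreal (?g' h) * indicator {-1<..<1} h =
        f (sqrt (1 - h\<^sup>2) *\<^sub>R \<theta>, h) * ennreal ((1 - h\<^sup>2) ^ (d - 1)) * indicator {-1<..<1} h"
    proof (cases "h \<in> {-1<..<1}")
      case True
      then have h: "-1 < h" "h < 1" by auto
      define w where "w = sqrt (1 - h\<^sup>2)"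
      have w: "w > 0" "w\<^sup>2 = 1 - h\<^sup>2" using pos[OF h] by (simp_all add: w_def)
      have "1 + (h / w)\<^sup>2 = (1 / w)\<^sup>2" using w by (simp add: field_simps)
      then have s: "sqrt (1 + (h / w)\<^sup>2) = 1 / w" using w by simp
      have v: "(\<theta>, h / w) /\<^sub>R (1 / w) = (w *\<^sub>R \<theta>, h)" using w by (simp add: scaleR_Pair)
      have "1 / (1 / w) ^ (DIM('a) + 1) * (1 / w ^ 3) = (w\<^sup>2) ^ m"
        using w(1) unfolding dim m by (simp add: power_mult[symmetric] power_divide field_simps power_add power3_eq_cube)
      then have "ennreal (1 / (1 / w) ^ (DIM('a) + 1)) * ennreal (1 / w ^ 3) = ennreal ((1 - h\<^sup>2) ^ (d - 1))"
        using w by (simp add: m flip: ennreal_mult)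
      then show ?thesis using True
        unfolding w_def[symmetric] s v by (simp only: mult.assoc)
    qed simp
  qed
  finally show "(\<integral>\<^sup>+k. ?F k \<partial>lborel) =
    (\<integral>\<^sup>+h. f (sqrt (1 - h\<^sup>2) *\<^sub>R \<theta>, h) * ennreal ((1 - h\<^sup>2) ^ (d - 1)) * indicator {-1<..<1} h \<partial>lborel)" .
qed

section \<open>Cap areas and heights\<close>

text \<open>Up to the volume of the equator this is the area of the part of \<open>S^(2d)\<close>
  below height h, so that \<open>cap_frac\<close> is the corresponding probability.\<close>

definition cap_integral :: "nat \<Rightarrow> real \<Rightarrow> real" where
  "cap_integral d h = integral {-1..h} (\<lambda>x. (1 - x\<^sup>2) ^ (d - 1))"

definition cap_frac :: "nat \<Rightarrow> real \<Rightarrow> real" where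
  "cap_frac d h = cap_integral d h / cap_integral d 1"

lemma cap_density_pos: "-1 < h \<Longrightarrow> h < 1 \<Longrightarrow> 0 < (1 - h\<^sup>2) ^ n" for h :: real
  by (simp add: abs_square_less_1 abs_less_iff)

lemma cap_integral_deriv_within:
  "-1 \<le> h \<Longrightarrow> h \<le> 1 \<Longrightarrow> (cap_integral d has_real_derivative (1 - h\<^sup>2) ^ (d - 1)) (at h within {-1..1})"
  unfolding cap_integral_def[abs_def]
  by (intro integral_has_real_derivative) (auto intro!: continuous_intros)

lemma cap_integral_deriv:
  "-1 < h \<Longrightarrow> h < 1 \<Longrightarrow> (cap_integral d has_real_derivative (1 - h\<^sup>2) ^ (d - 1)) (at h)"
  using cap_integral_deriv_within[of h d] at_within_Icc_at[of "-1" h 1] by simp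

lemma cap_integral_bot [simp]: "cap_integral d (-1) = 0"
  by (simp add: cap_integral_def)

lemma cap_integral_continuous: "continuous_on {-1..1} (cap_integral d)"
  by (rule DERIV_continuous_on) (auto intro: cap_integral_deriv_within)

lemma cap_integral_less:
  assumes ab: "-1 \<le> a" "a < b" "b \<le> 1"
  shows "cap_integral d a < cap_integral d b"
proof -
  have "continuous_on {a..b} (cap_integral d)"
    using cap_integral_continuous by (rule continuous_on_subset) (use ab in auto)
  moreover have "\<exists>y. (cap_integral d has_real_derivative y) (at x) \<and> 0 < y" if x: "a < x" "x < b" for x
  proof (intro exI conjI)
    have "-1 < x" "x < 1" using x ab by linarith+
    then show "(cap_integral d has_real_derivative (1 - x\<^sup>2) ^ (d - 1)) (at x)" "0 < (1 - x\<^sup>2) ^ (d - 1)"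
      by (rule cap_integral_deriv, rule cap_density_pos)
  qed
  ultimately show ?thesis
    using DERIV_pos_imp_increasing_open[OF ab(2), of "cap_integral d"] by blast
qed

lemma cap_total_pos: "0 < cap_integral d 1"
  using cap_integral_less[of "-1" 1 d] by simp

lemma cap_frac_bot [simp]: "cap_frac d (-1) = 0"
  and cap_frac_top [simp]: "cap_frac d 1 = 1"
  using cap_total_pos[of d] by (simp_all add: cap_frac_def)

lemma cap_frac_less: "-1 \<le> a \<Longrightarrow> a < b \<Longrightarrow> b \<le> 1 \<Longrightarrow> cap_frac d a < cap_frac d b"
  using cap_integral_less[of a b d] cap_total_pos[of d] by (simp add: cap_frac_def divide_strict_right_mono)

lemma cap_frac_continuous: "continuous_on {-1..1} (cap_frac d)"
  unfolding cap_frac_def[abs_def] using cap_total_pos[of d]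
  by (intro continuous_on_divide cap_integral_continuous continuous_on_const) auto

lemma cap_frac_deriv:
  "-1 < h \<Longrightarrow> h < 1 \<Longrightarrow> (cap_frac d has_real_derivative (1 - h\<^sup>2) ^ (d - 1) / cap_integral d 1) (at h)"
  unfolding cap_frac_def[abs_def] by (intro DERIV_cdivide cap_integral_deriv)

lemma cap_frac_bounds: "-1 < h \<Longrightarrow> h < 1 \<Longrightarrow> 0 < cap_frac d h \<and> cap_frac d h < 1"
  using cap_frac_less[of "-1" h d] cap_frac_less[of h 1 d] by simp

lemma cap_frac_eq_iff: "-1 \<le> a \<Longrightarrow> a \<le> 1 \<Longrightarrow> -1 \<le> b \<Longrightarrow> b \<le> 1 \<Longrightarrow> cap_frac d a = cap_frac d b \<longleftrightarrow> a = b"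
  using cap_frac_less[of a b d] cap_frac_less[of b a d] by (cases a b rule: linorder_cases) auto

lemma cap_frac_onto:
  assumes "0 \<le> y" "y < 1" shows "\<exists>h. -1 \<le> h \<and> h < 1 \<and> cap_frac d h = y"
proof -
  have "\<exists>h\<ge>-1. h \<le> 1 \<and> cap_frac d h = y"
    using assms by (intro IVT' cap_frac_continuous) auto
  then obtain h where h: "-1 \<le> h" "h \<le> 1" "cap_frac d h = y" by blast
  with assms have "h \<noteq> 1" by auto
  with h show ?thesis by force
qed

text \<open>With \<open>t = (1 + h) / 2\<close> one has \<open>1 - h^2 = 4 t (1 - t)\<close>, which
  explains the powers of 4 and the factor 2.\<close>

lemma inc_Beta_eq_cap:
  assumes "d > 0" "0 \<le> x" "x \<le> 1"
  shows "inc_Beta x (real d) (real d) = cap_integral d (2 * x - 1) / (2 * 4 ^ (d - 1))"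
proof -
  have dd: "real d - 1 = real (d - 1)" using assms by (simp add: of_nat_diff)
  let ?p = "\<lambda>t. indicator {0..x} t *\<^sub>R (t powr (real d - 1) * (1 - t) powr (real d - 1))"
  let ?q = "\<lambda>t. indicator {0..x} t *\<^sub>R ((t * (1 - t)) ^ (d - 1))"
  \<comment> \<open>The end points are left out because \<open>0 powr 0 = 0\<close> whereas
    \<open>0 ^ 0 = 1\<close>, which matters for d = 1. They form a null set.\<close>
  have pq: "?p t = ?q t" if t: "t \<noteq> 0" "t \<noteq> 1" for t
  proof (cases "t \<in> {0..x}")
    case True
    then have "0 < t" "0 < 1 - t" using t assms by auto
    then have "t powr (real d - 1) = t ^ (d - 1)" "(1 - t) powr (real d - 1) = (1 - t) ^ (d - 1)"
      unfolding dd by (simp_all only: powr_realpow)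
    then show ?thesis by (simp add: power_mult_distrib)
  qed simp
  have ae: "AE t in lborel. t \<noteq> 0 \<and> t \<noteq> (1::real)"
    by (intro AE_conjI AE_lborel_singleton)
  have "inc_Beta x (real d) (real d) = (\<integral>t. ?p t \<partial>lborel)"
    unfolding inc_Beta_def set_lebesgue_integral_def by (rule refl)
  also have "\<dots> = (\<integral>t. ?q t \<partial>lborel)"
  proof (rule integral_cong_AE)
    show "AE t in lborel. ?p t = ?q t"
      using ae by (rule eventually_mono) (use pq in blast)
  qed simp_all
  also have "\<dots> = cap_integral d (2 * x - 1) / (2 * 4 ^ (d - 1)) - cap_integral d (2 * 0 - 1) / (2 * 4 ^ (d - 1))"
  proof (rule integral_FTC_Icc)
    fix t assume t: "0 \<le> t" "t \<le> x"
    have 1: "((\<lambda>t. 2 * t - 1) has_real_derivative 2) (at t within {0..x})"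
      by (auto intro!: derivative_eq_intros)
    have 2: "(cap_integral d has_real_derivative (1 - (2 * t - 1)\<^sup>2) ^ (d - 1)) (at (2 * t - 1) within (\<lambda>t. 2 * t - 1) ` {0..x})"
      by (rule DERIV_subset[OF cap_integral_deriv_within]) (use t assms in auto)
    from DERIV_image_chain[OF 2 1]
    have "((\<lambda>t. cap_integral d (2 * t - 1)) has_real_derivative (1 - (2 * t - 1)\<^sup>2) ^ (d - 1) * 2) (at t within {0..x})"
      by (simp only: o_def)
    then have "((\<lambda>t. cap_integral d (2 * t - 1) / (2 * 4 ^ (d - 1))) has_real_derivative
        ((1 - (2 * t - 1)\<^sup>2) ^ (d - 1) * 2) / (2 * 4 ^ (d - 1))) (at t within {0..x})"
      by (rule DERIV_cdivide)
    also have "1 - (2 * t - 1)\<^sup>2 = 4 * (t * (1 - t))" by (simp add: power2_eq_square algebra_simps)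
    finally show "((\<lambda>t. cap_integral d (2 * t - 1) / (2 * 4 ^ (d - 1))) has_vector_derivative (t * (1 - t)) ^ (d - 1)) (at t within {0..x})"
      by (simp add: has_real_derivative_iff_has_vector_derivative power_mult_distrib)
  qed (use assms in \<open>auto intro!: continuous_intros\<close>)
  finally show ?thesis by simp
qed

lemma reg_inc_Beta_eq_cap:
  assumes "d > 0" "0 \<le> x" "x \<le> 1"
  shows "reg_inc_Beta x (real d) (real d) = cap_frac d (2 * x - 1)"
  using assms by (simp add: reg_inc_Beta_def inc_Beta_eq_cap cap_frac_def)

definition height :: "nat \<Rightarrow> real \<Rightarrow> real" where
  "height d t = (THE h. -1 \<le> h \<and> h < 1 \<and> cap_frac d h = (t\<^sup>2 / (1 + t\<^sup>2)) ^ d)"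

lemma height_eqI:
  assumes "-1 \<le> h" "h < 1" "cap_frac d h = (t\<^sup>2 / (1 + t\<^sup>2)) ^ d"
  shows "height d t = h"
  unfolding height_def
proof (rule the_equality)
  fix h' assume "-1 \<le> h' \<and> h' < 1 \<and> cap_frac d h' = (t\<^sup>2 / (1 + t\<^sup>2)) ^ d"
  then show "h' = h" using assms cap_frac_eq_iff[of h' h d] by simp
qed (use assms in auto)

lemma sq_frac_less_one: "t\<^sup>2 / (1 + t\<^sup>2) < 1" "0 \<le> t\<^sup>2 / (1 + t\<^sup>2)" for t :: real
  by (simp_all add: add_pos_nonneg divide_less_eq)

lemma height:
  assumes "d > 0"
  shows "-1 \<le> height d t" "height d t < 1" "cap_frac d (height d t) = (t\<^sup>2 / (1 + t\<^sup>2)) ^ d"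
proof -
  have "(t\<^sup>2 / (1 + t\<^sup>2)) ^ d < 1"
    using sq_frac_less_one[of t] assms by (simp only: power_less_one_iff)
  then obtain h where h: "-1 \<le> h" "h < 1" "cap_frac d h = (t\<^sup>2 / (1 + t\<^sup>2)) ^ d"
    using cap_frac_onto[of "(t\<^sup>2 / (1 + t\<^sup>2)) ^ d" d] sq_frac_less_one[of t] by auto
  with height_eqI[OF h] show "-1 \<le> height d t" "height d t < 1" "cap_frac d (height d t) = (t\<^sup>2 / (1 + t\<^sup>2)) ^ d"
    by auto
qed

lemma height_0: "d > 0 \<Longrightarrow> height d 0 = -1"
  by (rule height_eqI) (auto simp: power_0_left)

lemma height_gt: "d > 0 \<Longrightarrow> t \<noteq> 0 \<Longrightarrow> -1 < height d t"
proof -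
  assume d: "d > 0" "t \<noteq> 0"
  then have "0 < (t\<^sup>2 / (1 + t\<^sup>2)) ^ d" by (simp add: add_pos_nonneg)
  then have "height d t \<noteq> -1" using height(3)[OF d(1), of t] by (metis cap_frac_bot less_irrefl)
  then show ?thesis using height(1)[OF d(1), of t] by simp
qed

text \<open>A sphere point of height h has a stereographic image of norm
  \<open>r = sqrt ((1 + h) / (1 - h))\<close>, equivalently
  \<open>r^2 / (1 + r^2) = (1 + h) / 2\<close>. The defining equation of \<open>radial_g\<close>
  therefore prescribes the cap fraction at h.\<close>

lemma radial_g_eq_height:
  assumes d: "d > 0" and t: "t > 0"
  shows "radial_g d t = sqrt ((1 + height d t) / (1 - height d t))"
  unfolding radial_g_def
proof (rule the_equality)
  define h where "h = height d t"
  have h: "-1 < h" "h < 1" "cap_frac d h = (t\<^sup>2 / (1 + t\<^sup>2)) ^ d"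
    using height[OF d, of t] height_gt[OF d, of t] t by (auto simp: h_def)
  let ?r = "sqrt ((1 + h) / (1 - h))"
  have r2: "?r\<^sup>2 = (1 + h) / (1 - h)" using h by simp
  have "?r\<^sup>2 / (1 + ?r\<^sup>2) = (1 + h) / 2" unfolding r2 using h by (simp add: field_simps)
  moreover have "reg_inc_Beta ((1 + h) / 2) (real d) (real d) = cap_frac d h"
  proof -
    have "2 * ((1 + h) / 2) - 1 = h" by argo
    then show ?thesis using h(1,2) d reg_inc_Beta_eq_cap[of d "(1 + h) / 2"] by simp
  qed
  ultimately have "reg_inc_Beta (?r\<^sup>2 / (1 + ?r\<^sup>2)) (real d) (real d) = (t\<^sup>2 / (1 + t\<^sup>2)) ^ d"
    using h(3) by (simp only:)
  then show "?r > 0 \<and> reg_inc_Beta (?r\<^sup>2 / (1 + ?r\<^sup>2)) (real d) (real d) = (t\<^sup>2 / (1 + t\<^sup>2)) ^ d"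
    using h(1,2) by simp
  fix r assume r: "r > 0 \<and> reg_inc_Beta (r\<^sup>2 / (1 + r\<^sup>2)) (real d) (real d) = (t\<^sup>2 / (1 + t\<^sup>2)) ^ d"
  define k where "k = 2 * (r\<^sup>2 / (1 + r\<^sup>2)) - 1"
  have "cap_frac d k = cap_frac d h"
    using r h d sq_frac_less_one[of r] by (simp add: reg_inc_Beta_eq_cap k_def)
  then have "k = h" using cap_frac_eq_iff[of k h d] h sq_frac_less_one[of r] by (simp add: k_def)
  then have "r\<^sup>2 / (1 + r\<^sup>2) = (1 + h) / 2" unfolding k_def by argo
  moreover have "1 + r\<^sup>2 > 0" by (simp add: add_pos_nonneg)
  ultimately have "r\<^sup>2 * 2 = (1 + h) * (1 + r\<^sup>2)" by (simp add: field_simps)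
  then have "r\<^sup>2 = (1 + h) / (1 - h)" using h by (simp add: field_simps)
  then show "r = ?r" using r by (metis abs_of_pos real_sqrt_abs)
qed

section \<open>Explicit form of the map to the sphere\<close>

lemma stereo_inv_eq:
  fixes y :: "'a::real_inner"
  shows "stereo_inv y = ((2 / (1 + (norm y)\<^sup>2)) *\<^sub>R y, ((norm y)\<^sup>2 - 1) / ((norm y)\<^sup>2 + 1))" (is "_ = ?p")
proof -
  define u where "u = (norm y)\<^sup>2"
  have u: "u \<ge> 0" "1 + u > 0" by (simp_all add: u_def add_pos_nonneg)
  \<comment> \<open>The squared norm of the stereographic image is \<open>(1 + h) / (1 - h)\<close>
    and determines the height h; the horizontal part then follows by scaling.\<close>
  have inj: "inj_on (stereo :: 'a \<times> real \<Rightarrow> 'a) (sphere 0 1 - {(0, 1)})"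
  proof (rule inj_onI)
    fix p q :: "'a \<times> real" assume p: "p \<in> sphere 0 1 - {(0, 1)}" and q: "q \<in> sphere 0 1 - {(0, 1)}"
      and eq: "stereo p = stereo q"
    have key: "(norm (fst p))\<^sup>2 = (1 - snd p) * (1 + snd p) \<and> snd p < 1" if "p \<in> sphere 0 1 - {(0, 1)}" for p :: "'a \<times> real"
    proof -
      have n: "(norm (fst p))\<^sup>2 + (snd p)\<^sup>2 = 1"
        using that by (cases p) (auto simp: norm_Pair)
      have "(snd p)\<^sup>2 \<le> 1" using n zero_le_power2[of "norm (fst p)"] by linarith
      then have "snd p \<le> 1" by (simp add: abs_square_le_1)
      moreover have "snd p \<noteq> 1" using n that by (cases p) auto
      moreover have "(1 - snd p) * (1 + snd p) = 1 - (snd p)\<^sup>2"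
        by (simp add: power2_eq_square algebra_simps)
      ultimately show ?thesis using n by linarith
    qed
    have val: "(norm (stereo p))\<^sup>2 = (1 + snd p) / (1 - snd p)" if "p \<in> sphere 0 1 - {(0, 1)}" for p :: "'a \<times> real"
    proof -
      have "(norm (stereo p))\<^sup>2 = (norm (fst p))\<^sup>2 / (1 - snd p)\<^sup>2"
        by (simp add: stereo_def power_mult_distrib power_divide)
      also have "\<dots> = (1 + snd p) / (1 - snd p)"
        using key[OF that] by (simp only: power2_eq_square) simp
      finally show ?thesis .
    qed
    have "(1 + snd p) / (1 - snd p) = (1 + snd q) / (1 - snd q)"
      using val[OF p] val[OF q] eq by (simp only:)
    moreover have lt: "snd p < 1" "snd q < 1" using key[OF p] key[OF q] by blast+
    ultimately have "(1 + snd p) * (1 - snd q) = (1 + snd q) * (1 - snd p)"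
      by (simp add: frac_eq_eq)
    then have s: "snd p = snd q" by (simp only: ring_distribs mult.commute[of "snd q" "snd p"])
    moreover have "fst p = fst q" using eq s lt by (simp add: stereo_def)
    ultimately show "p = q" by (simp add: prod_eq_iff)
  qed
  have "(2 / (1 + u) * norm y)\<^sup>2 + ((u - 1) / (u + 1))\<^sup>2 = 1"
  proof -
    have "(2 / (1 + u) * norm y)\<^sup>2 = 4 * u / (1 + u)\<^sup>2" by (simp add: power_mult_distrib power_divide u_def)
    moreover have "4 * u / (1 + u)\<^sup>2 + ((u - 1) / (u + 1))\<^sup>2 = (4 * u + (u - 1)\<^sup>2) / (1 + u)\<^sup>2"
      by (simp add: power_divide add_divide_distrib add.commute)
    moreover have "4 * u + (u - 1)\<^sup>2 = (1 + u)\<^sup>2" by (simp add: power2_eq_square algebra_simps)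
    ultimately show ?thesis using u by (simp only:) simp
  qed
  moreover have n1: "norm ((2 / (1 + u)) *\<^sub>R y) = 2 / (1 + u) * norm y" using u by simp
  have "norm ?p = sqrt ((2 / (1 + u) * norm y)\<^sup>2 + ((u - 1) / (u + 1))\<^sup>2)"
    by (simp only: norm_Pair n1 real_norm_def power2_abs u_def[symmetric])
  ultimately have "norm ?p = 1" by (simp only: real_sqrt_one)
  moreover have "((u - 1) / (u + 1)) \<noteq> 1" using u by (simp add: field_simps)
  ultimately have mem: "?p \<in> sphere 0 1 - {(0, 1)}" by (simp flip: u_def)
  have "1 - (u - 1) / (u + 1) = 2 / (1 + u)" using u by (simp add: field_simps)
  then have "stereo ?p = (1 / (2 / (1 + u))) *\<^sub>R ((2 / (1 + u)) *\<^sub>R y)"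
    by (simp only: stereo_def fst_conv snd_conv u_def[symmetric])
  moreover have "1 / (2 / (1 + u)) * (2 / (1 + u)) = 1" using u by simp
  ultimately have "stereo ?p = y" by (simp only: scaleR_scaleR scaleR_one)
  then show ?thesis unfolding stereo_inv_def using inv_into_f_f[OF inj mem] by simp
qed

definition sphere_map :: "complex ^ 'd::finite \<Rightarrow> (complex ^ 'd) \<times> real" where
  "sphere_map = stereo_inv \<circ> radial_map (radial_g CARD('d))"

text \<open>The composite keeps the direction of z and only assigns a height. The formula also
  covers z = 0: the height is -1, the horizontal factor vanishes, and the value is the south
  pole.\<close>

lemma sphere_map_eq:
  fixes z :: "complex ^ 'd::finite"
  shows "sphere_map z = (let h = height CARD('d) (norm z) in (sqrt (1 - h\<^sup>2) *\<^sub>R (z /\<^sub>R norm z), h))"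
proof (cases "z = 0")
  case True
  then show ?thesis by (simp add: sphere_map_def radial_map_def stereo_inv_eq height_0 Let_def)
next
  case False
  define t where "t = norm z"
  have t: "t > 0" using False by (simp add: t_def)
  define h where "h = height CARD('d) t"
  have h: "-1 < h" "h < 1" using height(2)[of "CARD('d)" t] height_gt[of "CARD('d)" t] t by (simp_all add: h_def)
  define g where "g = sqrt ((1 + h) / (1 - h))"
  have g: "g > 0" "g\<^sup>2 = (1 + h) / (1 - h)" using h by (simp_all add: g_def)
  have n: "norm (g *\<^sub>R (z /\<^sub>R t)) = g" using t g by (simp add: t_def)
  have "radial_map (radial_g CARD('d)) z = g *\<^sub>R (z /\<^sub>R t)"
    using t by (simp add: radial_map_def radial_g_eq_height g_def h_def t_def)
  then have "sphere_map z = ((2 / (1 + g\<^sup>2)) *\<^sub>R (g *\<^sub>R (z /\<^sub>R t)), (g\<^sup>2 - 1) / (g\<^sup>2 + 1))"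
    unfolding sphere_map_def o_def stereo_inv_eq by (simp only: n)
  then have "sphere_map z = ((2 / (1 + g\<^sup>2) * g) *\<^sub>R (z /\<^sub>R t), (g\<^sup>2 - 1) / (g\<^sup>2 + 1))"
    by (simp only: scaleR_scaleR[of _ g])
  moreover have "(g\<^sup>2 - 1) / (g\<^sup>2 + 1) = h" unfolding g(2) using h by (simp add: field_simps)
  moreover have "2 / (1 + g\<^sup>2) * g = sqrt (1 - h\<^sup>2)"
  proof (rule real_sqrt_unique[symmetric])
    have "2 / (1 + g\<^sup>2) = 1 - h" unfolding g(2) using h by (simp add: field_simps)
    then have "(2 / (1 + g\<^sup>2) * g)\<^sup>2 = (1 - h)\<^sup>2 * ((1 + h) / (1 - h))" by (simp add: power_mult_distrib g(2))
    also have "\<dots> = 1 - h\<^sup>2" using h by (simp add: power2_eq_square field_simps)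
    finally show "(2 / (1 + g\<^sup>2) * g)\<^sup>2 = 1 - h\<^sup>2" .
    show "0 \<le> 2 / (1 + g\<^sup>2) * g" using g(1) by (simp add: add_pos_nonneg)
  qed
  ultimately show ?thesis by (simp only: Let_def h_def[symmetric] t_def[symmetric])
qed

section \<open>The inverse profile and transport of the Fubini-Study measure\<close>

text \<open>The solution t of \<open>(t^2 / (1 + t^2)) ^ d = cap_frac d h\<close>, hence the inverse
  of \<open>height d\<close>.\<close>

definition inv_height :: "nat \<Rightarrow> real \<Rightarrow> real" where
  "inv_height d h = sqrt (root d (cap_frac d h) / (1 - root d (cap_frac d h)))"

lemma root_less_one: "d > 0 \<Longrightarrow> v < 1 \<Longrightarrow> root d v < 1" for v :: real
  using real_root_less_mono[of d v 1] by simp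

lemma sq_frac_sqrt:
  fixes u :: real assumes "0 \<le> u" "u < 1"
  shows "(sqrt (u / (1 - u)))\<^sup>2 / (1 + (sqrt (u / (1 - u)))\<^sup>2) = u"
proof -
  have "(sqrt (u / (1 - u)))\<^sup>2 = u / (1 - u)" using assms by simp
  moreover have "1 + u / (1 - u) = 1 / (1 - u)" using assms by (simp add: field_simps)
  ultimately show ?thesis using assms by simp
qed

lemma cap_frac_range: "-1 \<le> h \<Longrightarrow> h < 1 \<Longrightarrow> 0 \<le> cap_frac d h \<and> cap_frac d h < 1"
  using cap_frac_bounds[of h d] by (cases "h = -1") auto

lemma inv_height:
  assumes "d > 0" "-1 \<le> h" "h < 1"
  shows "((inv_height d h)\<^sup>2 / (1 + (inv_height d h)\<^sup>2)) ^ d = cap_frac d h" "inv_height d h \<ge> 0"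
proof -
  note v = cap_frac_range[OF assms(2,3), of d]
  have u: "0 \<le> root d (cap_frac d h)" "root d (cap_frac d h) < 1"
    using v assms(1) by (auto intro: root_less_one)
  show "((inv_height d h)\<^sup>2 / (1 + (inv_height d h)\<^sup>2)) ^ d = cap_frac d h"
    unfolding inv_height_def sq_frac_sqrt[OF u] using v assms(1) by simp
  show "inv_height d h \<ge> 0" unfolding inv_height_def using u by simp
qed

lemma inv_height_pos:
  assumes "d > 0" "-1 < h" "h < 1"
  shows "inv_height d h > 0"
proof -
  have "inv_height d h \<noteq> 0"
    using inv_height(1)[of d h] cap_frac_bounds[of h d] assms by (auto simp: power_0_left)
  then show ?thesis using inv_height(2)[of d h] assms by simp
qed

lemma height_inv_height: "d > 0 \<Longrightarrow> -1 \<le> h \<Longrightarrow> h < 1 \<Longrightarrow> height d (inv_height d h) = h"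
  using inv_height(1)[of d h] by (intro height_eqI) auto

lemma inv_height_height:
  assumes "d > 0" "t \<ge> 0" shows "inv_height d (height d t) = t"
proof -
  define u where "u = t\<^sup>2 / (1 + t\<^sup>2)"
  have u: "0 \<le> u" "u < 1" using sq_frac_less_one[of t] by (simp_all add: u_def)
  have "1 + t\<^sup>2 > 0" by (simp add: add_pos_nonneg)
  then have "1 - u = 1 / (1 + t\<^sup>2)" by (simp add: u_def field_simps)
  then have "u / (1 - u) = t\<^sup>2" using \<open>1 + t\<^sup>2 > 0\<close> by (simp add: u_def)
  moreover have "root d (cap_frac d (height d t)) = u"
    using height(3)[OF assms(1), of t] assms(1) u by (simp add: u_def[symmetric] real_root_power_cancel)
  ultimately show ?thesis using assms(2) by (simp add: inv_height_def)
qed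

lemma inv_height_image:
  assumes "d > 0" shows "inv_height d ` {-1<..<1} = {0<..}"
proof (intro equalityI subsetI)
  fix t :: real assume "t \<in> {0<..}"
  then have "t = inv_height d (height d t)" "height d t \<in> {-1<..<1}"
    using assms inv_height_height[of d t] height(2)[of d t] height_gt[of d t] by auto
  then show "t \<in> inv_height d ` {-1<..<1}" by blast
qed (use assms in \<open>auto intro: inv_height_pos\<close>)

text \<open>Up to a constant this derivative is the Fubini-Study density in polar coordinates, which
  is why the change of variables in \<open>nn_integral_sphere_map\<close> collapses to a
  constant.\<close>

lemma sq_frac_power_deriv:
  fixes t :: real assumes "d > 0"
  shows "((\<lambda>t. (t\<^sup>2 / (1 + t\<^sup>2)) ^ d) has_real_derivative 2 * real d * t ^ (2 * d - 1) / (1 + t\<^sup>2) ^ (d + 1)) (at t)"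
proof -
  obtain m where m: "d = Suc m" using assms by (cases d) auto
  have "1 + t\<^sup>2 > 0" by (simp add: add_pos_nonneg)
  then have p: "1 + t\<^sup>2 \<noteq> 0" by simp
  have "((\<lambda>t. t\<^sup>2 / (1 + t\<^sup>2)) has_real_derivative 2 * t / (1 + t\<^sup>2)\<^sup>2) (at t)"
    using p by (auto intro!: derivative_eq_intros simp: field_simps power2_eq_square)
  then have "((\<lambda>t. (t\<^sup>2 / (1 + t\<^sup>2)) ^ d) has_real_derivative
      real d * (2 * t / (1 + t\<^sup>2)\<^sup>2 * (t\<^sup>2 / (1 + t\<^sup>2)) ^ (d - Suc 0))) (at t)"
    by (rule DERIV_power)
  also have "real d * (2 * t / (1 + t\<^sup>2)\<^sup>2 * (t\<^sup>2 / (1 + t\<^sup>2)) ^ (d - Suc 0)) =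
     2 * real d * t ^ (2 * d - 1) / (1 + t\<^sup>2) ^ (d + 1)"
  proof -
    have "t ^ (2 * d - 1) = t * (t\<^sup>2) ^ m" by (simp add: m power_mult[symmetric])
    moreover have "(1 + t\<^sup>2) ^ (d + 1) = (1 + t\<^sup>2)\<^sup>2 * (1 + t\<^sup>2) ^ m" by (simp add: m power2_eq_square mult.assoc)
    ultimately show ?thesis by (simp only: m power_divide diff_Suc_Suc diff_zero) simp
  qed
  finally show ?thesis .
qed

lemma continuous_on_inv_height:
  assumes "d > 0" shows "continuous_on {-1..<1} (inv_height d)"
proof -
  have "continuous_on {-1..<1} (\<lambda>h. root d (cap_frac d h))"
    by (intro continuous_on_real_root continuous_on_subset[OF cap_frac_continuous]) auto
  moreover have "\<forall>h\<in>{-1..<1}. 1 - root d (cap_frac d h) \<noteq> 0"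
    using cap_frac_range[of _ d] root_less_one[OF assms] by fastforce
  ultimately show ?thesis unfolding inv_height_def[abs_def]
    by (intro continuous_on_real_sqrt continuous_on_divide continuous_on_diff continuous_on_const) auto
qed

text \<open>The inverse function rule applied to \<open>sq_frac_power_deriv\<close>, composed with
  the derivative of \<open>cap_frac\<close>.\<close>

lemma inv_height_deriv:
  assumes d: "d > 0" and h: "-1 < h" "h < 1"
  shows "(inv_height d has_real_derivative
     ((1 - h\<^sup>2) ^ (d - 1) / cap_integral d 1) *
     ((1 + (inv_height d h)\<^sup>2) ^ (d + 1) / (2 * real d * inv_height d h ^ (2 * d - 1)))) (at h)"
proof -
  define psi where "psi = (\<lambda>v. sqrt (root d v / (1 - root d v)))"
  let ?v = "cap_frac d h" and ?k = "inv_height d h"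
  have k: "?k > 0" using inv_height_pos[OF d h] .
  have pk: "psi ?v = ?k" by (simp add: psi_def inv_height_def)
  have v: "0 < ?v" "?v < 1" using cap_frac_bounds[OF h] by auto
  have "(psi has_real_derivative inverse (2 * real d * ?k ^ (2 * d - 1) / (1 + ?k\<^sup>2) ^ (d + 1))) (at ?v)"
  proof (rule DERIV_inverse_function[where f = "\<lambda>t. (t\<^sup>2 / (1 + t\<^sup>2)) ^ d" and a = 0 and b = 1])
    show "((\<lambda>t. (t\<^sup>2 / (1 + t\<^sup>2)) ^ d) has_real_derivative 2 * real d * ?k ^ (2 * d - 1) / (1 + ?k\<^sup>2) ^ (d + 1)) (at (psi ?v))"
      unfolding pk by (rule sq_frac_power_deriv[OF d])
    show "2 * real d * ?k ^ (2 * d - 1) / (1 + ?k\<^sup>2) ^ (d + 1) \<noteq> 0"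
      using k d by (simp add: add_pos_nonneg less_imp_neq[symmetric])
    show "0 < ?v" "?v < 1" by (fact v)+
    fix y :: real assume y: "0 < y" "y < 1"
    have "0 \<le> root d y" "root d y < 1" using y d by (auto intro: root_less_one)
    then have "(psi y)\<^sup>2 / (1 + (psi y)\<^sup>2) = root d y" unfolding psi_def by (rule sq_frac_sqrt)
    then show "((psi y)\<^sup>2 / (1 + (psi y)\<^sup>2)) ^ d = y" using y d by simp
  next
    have "root d ?v < 1" using v d by (auto intro: root_less_one)
    then show "isCont psi ?v" unfolding psi_def by (intro continuous_intros) simp
  qed
  from DERIV_chain2[OF this cap_frac_deriv[OF h]]
  have "((\<lambda>x. psi (cap_frac d x)) has_real_derivative
     inverse (2 * real d * ?k ^ (2 * d - 1) / (1 + ?k\<^sup>2) ^ (d + 1)) * ((1 - h\<^sup>2) ^ (d - 1) / cap_integral d 1)) (at h)" .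
  moreover have "(\<lambda>x. psi (cap_frac d x)) = inv_height d" by (simp add: psi_def inv_height_def fun_eq_iff)
  ultimately show ?thesis by (simp add: mult.commute)
qed

lemma nn_integral_cap_density:
  "(\<integral>\<^sup>+h. ennreal ((1 - h\<^sup>2) ^ (d - 1)) * indicator {-1<..<1} h \<partial>lborel) = ennreal (cap_integral d 1)"
proof -
  have "has_bochner_integral lborel (\<lambda>x. indicator {-1..1} x *\<^sub>R (1 - x\<^sup>2) ^ (d - 1)) (cap_integral d 1 - cap_integral d (-1))"
  proof (rule has_bochner_integral_FTC_Icc)
    show "(cap_integral d has_vector_derivative (1 - x\<^sup>2) ^ (d - 1)) (at x within {-1..1})" if "-1 \<le> x" "x \<le> 1" for x
      unfolding has_real_derivative_iff_has_vector_derivative[symmetric] using that by (rule cap_integral_deriv_within)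
  qed (auto intro!: continuous_intros)
  then have "ennreal (cap_integral d 1) = (\<integral>\<^sup>+x. ennreal (indicator {-1..1} x *\<^sub>R (1 - x\<^sup>2) ^ (d - 1)) \<partial>lborel)"
    by (subst nn_integral_eq_integral)
       (auto simp: has_bochner_integral_iff indicator_def abs_square_le_1 abs_le_iff)
  also have "\<dots> = (\<integral>\<^sup>+h. ennreal ((1 - h\<^sup>2) ^ (d - 1)) * indicator {-1<..<1} h \<partial>lborel)"
  proof (rule nn_integral_cong_AE)
    have "AE x in lborel. x \<noteq> -1 \<and> x \<noteq> (1::real)" by (intro AE_conjI AE_lborel_singleton)
    then show "AE x in lborel. ennreal (indicator {-1..1} x *\<^sub>R (1 - x\<^sup>2) ^ (d - 1)) =
        ennreal ((1 - x\<^sup>2) ^ (d - 1)) * indicator {-1<..<1} x"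
      by (rule eventually_mono) (auto simp: indicator_def)
  qed
  finally show ?thesis ..
qed

lemma sphere_vol_height:
  assumes "DIM('a::euclidean_space) = 2 * d"
  shows "sphere_vol TYPE('a \<times> real) = sphere_vol TYPE('a) * cap_integral d 1"
proof -
  have "ennreal (sphere_vol TYPE('a \<times> real)) = (\<integral>\<^sup>+p. 1 \<partial>(surface_measure :: ('a \<times> real) measure))"
    by (simp only: nn_integral_const emeasure_surface_space mult_1)
  also have "\<dots> = ennreal (cap_integral d 1) * ennreal (sphere_vol TYPE('a))"
    by (subst nn_integral_surface_measure_height[OF _ assms])
       (simp_all only: borel_measurable_const mult_1 nn_integral_cap_density nn_integral_const emeasure_surface_space)
  also have "\<dots> = ennreal (sphere_vol TYPE('a) * cap_integral d 1)"
    using cap_total_pos[of d] sphere_vol_pos[where 'a='a] by (simp add: mult.commute flip: ennreal_mult)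
  finally show ?thesis
    using cap_total_pos[of d] sphere_vol_pos[where 'a='a] sphere_vol_pos[where 'a="'a \<times> real"] by simp
qed

text \<open>Monotonicity suffices for measurability; \<open>max 0\<close> makes the function
  monotone on the whole line.\<close>

lemma borel_measurable_height: 
  assumes d: "d > 0" shows "(\<lambda>t. height d (max 0 t)) \<in> borel_measurable borel"
proof (rule borel_measurable_mono, rule monoI)
  fix s t :: real assume "s \<le> t"
  then have "max 0 s \<le> max 0 t" by simp
  then have st: "(max 0 s)\<^sup>2 \<le> (max 0 t)\<^sup>2" by (intro power_mono) auto
  define a b where "a = (max 0 s)\<^sup>2" and "b = (max 0 t)\<^sup>2"
  have ab: "0 \<le> a" "a \<le> b" using st by (auto simp: a_def b_def)
  then have "a * (1 + b) \<le> b * (1 + a)" by (simp add: algebra_simps)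
  then have "a / (1 + a) \<le> b / (1 + b)" using ab by (simp add: frac_le_eq divide_le_0_iff field_simps)
  then have "(a / (1 + a)) ^ d \<le> (b / (1 + b)) ^ d" using ab by (intro power_mono) auto
  then have "cap_frac d (height d (max 0 s)) \<le> cap_frac d (height d (max 0 t))"
    unfolding height(3)[OF d] a_def b_def .
  then show "height d (max 0 s) \<le> height d (max 0 t)"
    using cap_frac_less[of "height d (max 0 t)" "height d (max 0 s)" d] height[OF d, of "max 0 s"] height[OF d, of "max 0 t"]
    by (meson less_imp_le not_le)
qed

lemma borel_measurable_sphere_map: "(sphere_map :: complex ^ 'd::finite \<Rightarrow> _) \<in> borel_measurable borel"
proof -
  have [measurable]: "(\<lambda>t. height CARD('d) (max 0 t)) \<in> borel_measurable borel"
    by (rule borel_measurable_height) simp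
  have "(\<lambda>z::complex^'d. height CARD('d) (max 0 (norm z))) \<in> borel_measurable borel" by measurable
  then have [measurable]: "(\<lambda>z::complex^'d. height CARD('d) (norm z)) \<in> borel_measurable borel" by simp
  show ?thesis
    unfolding sphere_map_eq[abs_def] Let_def by measurable
qed

text \<open>Cutting g and g' off outside the interval makes them Borel on the whole line and changes
  neither integral.\<close>

lemma nn_integral_substitution_open_interval':
  fixes f :: "real \<Rightarrow> ennreal" and g g' :: "real \<Rightarrow> real"
  assumes f: "f \<in> borel_measurable borel"
    and ab: "a < b"
    and der: "\<And>x. a < x \<Longrightarrow> x < b \<Longrightarrow> (g has_real_derivative g' x) (at x)"
    and cont: "continuous_on {a<..<b} g'"
    and nonneg: "\<And>x. a < x \<Longrightarrow> x < b \<Longrightarrow> 0 \<le> g' x"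
  shows "(\<integral>\<^sup>+y. f y * indicator (g ` {a<..<b}) y \<partial>lborel) =
    (\<integral>\<^sup>+x. f (g x) * ennreal (g' x) * indicator {a<..<b} x \<partial>lborel)"
proof -
  let ?A = "{a<..<b}"
  let ?g = "\<lambda>x. indicator ?A x *\<^sub>R g x" and ?h = "\<lambda>x. indicator ?A x *\<^sub>R g' x"
  have cg: "continuous_on ?A g"
    by (rule DERIV_continuous_on[where D = g']) (auto intro: der has_field_derivative_at_within)
  have "(\<integral>\<^sup>+y. f y * indicator (?g ` ?A) y \<partial>lborel) = (\<integral>\<^sup>+x. f (?g x) * ennreal (?h x) * indicator ?A x \<partial>lborel)"
  proof (rule nn_integral_substitution_open_interval[OF f _ _ ab])
    show "?g \<in> borel_measurable borel" "?h \<in> borel_measurable borel"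
      by (rule borel_measurable_continuous_on_indicator[OF _ cg], simp)
        (rule borel_measurable_continuous_on_indicator[OF _ cont], simp)
    show "continuous_on ?A ?h" using cont by (rule continuous_on_eq) simp
    fix x assume x: "a < x" "x < b"
    show "0 \<le> ?h x" using nonneg x by simp
    have "(?g has_real_derivative g' x) (at x)"
      by (rule has_field_derivative_transform_within_open[OF der[OF x] open_greaterThanLessThan[of a b]]) (use x in auto)
    then show "(?g has_real_derivative ?h x) (at x)" using x by simp
  qed
  moreover have "?g ` ?A = g ` ?A" by (intro image_cong) auto
  moreover have "f (?g x) * ennreal (?h x) * indicator ?A x = f (g x) * ennreal (g' x) * indicator ?A x" for x
    by (cases "x \<in> ?A") auto
  ultimately show ?thesis by simp
qed

text \<open>The volume density of the Fubini-Study metric in affine coordinates, normalized to a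
  probability.\<close>

definition fs_density :: "complex ^ 'd::finite \<Rightarrow> real" where
  "fs_density z = fact CARD('d) / pi ^ CARD('d) / (1 + (norm z)\<^sup>2) ^ (CARD('d) + 1)"

lemma DIM_complex_vec: "DIM(complex ^ 'd::finite) = 2 * CARD('d)"
  by simp

lemma sphere_vol_complex_vec: "sphere_vol TYPE(complex ^ 'd::finite) = 2 * real CARD('d) * (pi ^ CARD('d) / fact CARD('d))"
  unfolding sphere_vol_eq DIM_complex_vec unit_ball_vol_even by simp

lemma fs_density_measurable [measurable]: "(fs_density :: complex ^ 'd::finite \<Rightarrow> real) \<in> borel_measurable borel"
  unfolding fs_density_def[abs_def] by measurable

lemma fs_density_nonneg: "fs_density z \<ge> 0"
  by (simp add: fs_density_def)

text \<open>Both sides are written with a common direction \<theta>, on the left in polar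
  coordinates and on the right by height. Along a fixed direction \<open>r = inv_height d h\<close>
  turns the radial density into a constant multiple of \<open>(1 - h^2) ^ (d - 1)\<close>, because
  balls and caps have matching masses. The constant comes out as one over the area of the
  sphere.\<close>

lemma nn_integral_sphere_map:
  fixes f :: "(complex ^ 'd::finite) \<times> real \<Rightarrow> ennreal"
  assumes f[measurable]: "f \<in> borel_measurable borel"
  shows "(\<integral>\<^sup>+z. f (sphere_map z) * ennreal (fs_density z) \<partial>lborel) =
    ennreal (1 / sphere_vol TYPE((complex ^ 'd) \<times> real)) * (\<integral>\<^sup>+p. f p \<partial>surface_measure)"
proof -
  define d where "d = CARD('d)"
  have d: "d > 0" by (simp add: d_def)
  have dim: "DIM(complex ^ 'd) = 2 * d" by (simp add: d_def)
  define A where "A = cap_integral d 1"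
  have A: "A > 0" by (simp add: A_def cap_total_pos)
  define c where "c = (fact d :: real) / pi ^ d"
  have c: "c > 0" by (simp add: c_def)
  note [measurable] = borel_measurable_sphere_map
  have fm: "f \<in> borel_measurable (borel \<Otimes>\<^sub>M borel)" by (simp add: borel_prod)
  let ?Q = "\<lambda>\<theta> h. f (sqrt (1 - h\<^sup>2) *\<^sub>R \<theta>, h)"
  let ?w = "\<lambda>r::real. c / (1 + r\<^sup>2) ^ (d + 1) * r ^ (2 * d - 1)"
  have hm[measurable]: "(\<lambda>t. height d (max 0 t)) \<in> borel_measurable borel"
    by (rule borel_measurable_height[OF d])
  have "(\<integral>\<^sup>+z. f (sphere_map z) * ennreal (fs_density z) \<partial>lborel) =
     (\<integral>\<^sup>+\<theta>. (\<integral>\<^sup>+r. f (sphere_map (r *\<^sub>R \<theta>)) * ennreal (fs_density (r *\<^sub>R \<theta>)) * ennreal (r ^ (DIM(complex ^ 'd) - 1)) * indicator {0<..} r \<partial>lborel)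
       \<partial>(surface_measure :: (complex ^ 'd) measure))"
    by (rule nn_integral_polar) measurable
  also have "\<dots> = (\<integral>\<^sup>+\<theta>. ennreal (c / (2 * d * A)) * (\<integral>\<^sup>+h. ?Q \<theta> h * ennreal ((1 - h\<^sup>2) ^ (d - 1)) * indicator {-1<..<1} h \<partial>lborel)
     \<partial>(surface_measure :: (complex ^ 'd) measure))"
  proof (rule nn_integral_cong)
    fix \<theta> :: "complex ^ 'd" assume "\<theta> \<in> space surface_measure"
    then have \<theta>: "norm \<theta> = 1" by simp
    have Qm[measurable]: "?Q \<theta> \<in> borel_measurable borel" using fm by measurable
    let ?F = "\<lambda>r. ?Q \<theta> (height d (max 0 r)) * ennreal (?w r)"
    let ?k = "inv_height d"
    let ?k' = "\<lambda>h. ((1 - h\<^sup>2) ^ (d - 1) / A) * ((1 + (?k h)\<^sup>2) ^ (d + 1) / (2 * real d * ?k h ^ (2 * d - 1)))"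
    have kpos: "?k h > 0" if "-1 < h" "h < 1" for h using inv_height_pos[OF d that] .
    have "(\<integral>\<^sup>+r. f (sphere_map (r *\<^sub>R \<theta>)) * ennreal (fs_density (r *\<^sub>R \<theta>)) * ennreal (r ^ (DIM(complex ^ 'd) - 1)) * indicator {0<..} r \<partial>lborel)
      = (\<integral>\<^sup>+r. ?F r * indicator {0<..} r \<partial>lborel)"
    proof (rule nn_integral_cong)
      fix r :: real
      show "f (sphere_map (r *\<^sub>R \<theta>)) * ennreal (fs_density (r *\<^sub>R \<theta>)) * ennreal (r ^ (DIM(complex ^ 'd) - 1)) * indicator {0<..} r
        = ?F r * indicator {0<..} r"
      proof (cases "r > 0")
        case True
        have n: "norm (r *\<^sub>R \<theta>) = r" using True \<theta> by simp
        have u: "(r *\<^sub>R \<theta>) /\<^sub>R r = \<theta>" using True by simp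
        have e: "sphere_map (r *\<^sub>R \<theta>) = (sqrt (1 - (height d r)\<^sup>2) *\<^sub>R \<theta>, height d r)"
          unfolding sphere_map_eq n u Let_def d_def by (rule refl)
        have "ennreal (fs_density (r *\<^sub>R \<theta>)) * ennreal (r ^ (DIM(complex ^ 'd) - 1)) = ennreal (?w r)"
          unfolding fs_density_def n d_def[symmetric] c_def[symmetric] dim
          using True c by (subst ennreal_mult[symmetric]) auto
        then show ?thesis unfolding e using True by (simp only: mult.assoc max_absorb2 less_imp_le)
      qed simp
    qed
    also have "\<dots> = (\<integral>\<^sup>+r. ?F r * indicator (?k ` {-1<..<1}) r \<partial>lborel)"
      unfolding inv_height_image[OF d] by (rule refl)
    also have "\<dots> = (\<integral>\<^sup>+h. ?F (?k h) * ennreal (?k' h) * indicator {-1<..<1} h \<partial>lborel)"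
    proof (rule nn_integral_substitution_open_interval')
      show "?F \<in> borel_measurable borel" by measurable
      show "(?k has_real_derivative ?k' h) (at h)" if "-1 < h" "h < 1" for h
        unfolding A_def by (rule inv_height_deriv[OF d that])
      have ck: "continuous_on {-1<..<1} ?k"
        by (rule continuous_on_subset[OF continuous_on_inv_height[OF d]]) auto
      have "\<forall>h\<in>{-1<..<1}. 2 * real d * ?k h ^ (2 * d - 1) \<noteq> 0" using kpos d by fastforce
      then show "continuous_on {-1<..<1} ?k'"
        using A by (intro continuous_on_mult continuous_on_divide continuous_on_power continuous_on_add continuous_on_diff
          continuous_on_const continuous_on_id ck) auto
      show "0 \<le> ?k' h" if "-1 < h" "h < 1" for h
        using kpos[OF that] A cap_density_pos[OF that, of "d - 1"] by (simp add: add_nonneg_nonneg)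
    qed simp
    also have "\<dots> = (\<integral>\<^sup>+h. ennreal (c / (2 * d * A)) * (?Q \<theta> h * ennreal ((1 - h\<^sup>2) ^ (d - 1)) * indicator {-1<..<1} h) \<partial>lborel)"
    proof (rule nn_integral_cong)
      fix h :: real
      show "?F (?k h) * ennreal (?k' h) * indicator {-1<..<1} h =
         ennreal (c / (2 * d * A)) * (?Q \<theta> h * ennreal ((1 - h\<^sup>2) ^ (d - 1)) * indicator {-1<..<1} h)"
      proof (cases "h \<in> {-1<..<1}")
        case True
        then have h: "-1 < h" "h < 1" by auto
        note k = kpos[OF h]
        have hk: "height d (max 0 (?k h)) = h" using height_inv_height[OF d, of h] h k by simp
        define B where "B = (1 + (?k h)\<^sup>2) ^ (d + 1)"
        define C where "C = ?k h ^ (2 * d - 1)"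
        have BC: "B > 0" "C > 0" using k by (simp_all add: B_def C_def add_pos_nonneg)
        have "?w (?k h) * ?k' h = c / (2 * d * A) * (1 - h\<^sup>2) ^ (d - 1)"
          unfolding B_def[symmetric] C_def[symmetric] using BC A d by (simp add: field_simps)
        moreover have "0 \<le> ?w (?k h)" "0 \<le> ?k' h" "0 \<le> c / (2 * d * A)" "0 \<le> (1 - h\<^sup>2) ^ (d - 1)"
          unfolding B_def[symmetric] C_def[symmetric] using BC A d c cap_density_pos[OF h, of "d - 1"] by auto
        ultimately have "ennreal (?w (?k h)) * ennreal (?k' h) = ennreal (c / (2 * d * A)) * ennreal ((1 - h\<^sup>2) ^ (d - 1))"
          by (metis ennreal_mult)
        then show ?thesis unfolding hk using True by (simp only: mult.assoc indicator_simps mult_1_right mult.left_commute)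
      qed simp
    qed
    also have "\<dots> = ennreal (c / (2 * d * A)) * (\<integral>\<^sup>+h. ?Q \<theta> h * ennreal ((1 - h\<^sup>2) ^ (d - 1)) * indicator {-1<..<1} h \<partial>lborel)"
      by (rule nn_integral_cmult) measurable
    finally show "(\<integral>\<^sup>+r. f (sphere_map (r *\<^sub>R \<theta>)) * ennreal (fs_density (r *\<^sub>R \<theta>)) * ennreal (r ^ (DIM(complex ^ 'd) - 1)) * indicator {0<..} r \<partial>lborel)
      = ennreal (c / (2 * d * A)) * (\<integral>\<^sup>+h. ?Q \<theta> h * ennreal ((1 - h\<^sup>2) ^ (d - 1)) * indicator {-1<..<1} h \<partial>lborel)" .
  qed
  also have "\<dots> = ennreal (c / (2 * d * A)) * (\<integral>\<^sup>+p. f p \<partial>surface_measure)"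
  proof -
    have Qm: "(\<lambda>(\<theta>, h). ?Q \<theta> h * ennreal ((1 - h\<^sup>2) ^ (d - 1)) * indicator {-1<..<1} h) \<in> borel_measurable (borel \<Otimes>\<^sub>M lborel)"
      using fm by measurable
    have "(\<lambda>\<theta>. \<integral>\<^sup>+h. ?Q \<theta> h * ennreal ((1 - h\<^sup>2) ^ (d - 1)) * indicator {-1<..<1} h \<partial>lborel) \<in> borel_measurable (surface_measure :: (complex ^ 'd) measure)"
      by (intro borel_measurable_surface_measure lborel.borel_measurable_nn_integral Qm)
    then show ?thesis
      unfolding nn_integral_surface_measure_height[OF f dim] by (rule nn_integral_cmult)
  qed
  also have "c / (2 * d * A) = 1 / sphere_vol TYPE((complex ^ 'd) \<times> real)"
    unfolding sphere_vol_height[OF dim] sphere_vol_complex_vec d_def[symmetric] A_def[symmetric] c_def by simp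
  finally show ?thesis .
qed

section \<open>The angular profile is a contraction\<close>

lemma DERIV_cap_power:
  fixes h :: real assumes "d > 0"
  shows "((\<lambda>h. (1 - h\<^sup>2) ^ d / (2 * real d)) has_real_derivative - h * (1 - h\<^sup>2) ^ (d - 1)) (at h)"
  using assms by (auto intro!: derivative_eq_intros)

text \<open>Both sides vanish at the south pole, and the derivative
  \<open>- h * (1 - h^2) ^ (d - 1)\<close> of the left side is dominated by the cap density. The
  bound is asymptotically sharp at the pole, which is what the analysis of \<open>l\<close> near its
  end points requires.\<close>

lemma cap_integral_ge:
  assumes d: "d > 0" and h: "-1 \<le> h" "h \<le> 1"
  shows "(1 - h\<^sup>2) ^ d / (2 * real d) \<le> cap_integral d h"
proof -
  let ?G = "\<lambda>h. cap_integral d h - (1 - h\<^sup>2) ^ d / (2 * real d)"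
  have "?G (-1) \<le> ?G h"
  proof (rule DERIV_nonneg_imp_increasing_open[OF h(1)])
    fix x assume "-1 < x" "x < h"
    then have x: "-1 < x" "x < 1" using h by auto
    have "(?G has_real_derivative (1 - x\<^sup>2) ^ (d - 1) - (- x * (1 - x\<^sup>2) ^ (d - 1))) (at x)"
      by (intro DERIV_diff cap_integral_deriv[OF x] DERIV_cap_power[OF d])
    moreover have "(1 - x\<^sup>2) ^ (d - 1) - (- x * (1 - x\<^sup>2) ^ (d - 1)) = (1 + x) * (1 - x\<^sup>2) ^ (d - 1)"
      by (simp add: algebra_simps)
    ultimately show "\<exists>y. (?G has_real_derivative y) (at x) \<and> 0 \<le> y"
      using x cap_density_pos[OF x, of "d - 1"] by (intro exI[of _ "(1 + x) * (1 - x\<^sup>2) ^ (d - 1)"]) simp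
  next
    have "continuous_on {-1..h} (cap_integral d)"
      using cap_integral_continuous by (rule continuous_on_subset) (use h in auto)
    then show "continuous_on {-1..h} ?G" using d by (intro continuous_intros) auto
  qed
  then show ?thesis using d by (simp add: power_0_left)
qed

lemma cap_integral_compl_ge:
  assumes d: "d > 0" and h: "-1 \<le> h" "h \<le> 1"
  shows "(1 - h\<^sup>2) ^ d / (2 * real d) \<le> cap_integral d 1 - cap_integral d h"
proof -
  let ?G = "\<lambda>h. cap_integral d h + (1 - h\<^sup>2) ^ d / (2 * real d)"
  have "?G h \<le> ?G 1"
  proof (rule DERIV_nonneg_imp_increasing_open[OF h(2)])
    fix x assume "h < x" "x < 1"
    then have x: "-1 < x" "x < 1" using h by auto
    have "(?G has_real_derivative (1 - x\<^sup>2) ^ (d - 1) + (- x * (1 - x\<^sup>2) ^ (d - 1))) (at x)"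
      by (intro DERIV_add cap_integral_deriv[OF x] DERIV_cap_power[OF d])
    moreover have "(1 - x\<^sup>2) ^ (d - 1) + (- x * (1 - x\<^sup>2) ^ (d - 1)) = (1 - x) * (1 - x\<^sup>2) ^ (d - 1)"
      by (simp add: algebra_simps)
    ultimately show "\<exists>y. (?G has_real_derivative y) (at x) \<and> 0 \<le> y"
      using x cap_density_pos[OF x, of "d - 1"] by (intro exI[of _ "(1 - x) * (1 - x\<^sup>2) ^ (d - 1)"]) simp
  next
    have "continuous_on {h..1} (cap_integral d)"
      using cap_integral_continuous by (rule continuous_on_subset) (use h in auto)
    then show "continuous_on {h..1} ?G" using d by (intro continuous_intros) auto
  qed
  then show ?thesis using d by (simp add: power_0_left)
qed

lemma cap_total_ge: "d > 0 \<Longrightarrow> 2 * real d * cap_integral d 1 \<ge> 2"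
  using cap_integral_ge[of d 0] cap_integral_compl_ge[of d 0] by (simp add: field_simps)

lemma polar_range: "0 < x \<Longrightarrow> x < pi \<Longrightarrow> -1 < - cos x \<and> - cos x < 1 \<and> 0 < sin x \<and> 1 - (- cos x)\<^sup>2 = (sin x)\<^sup>2" for x
  using sin_gt_zero[of x] cos_monotone_0_pi[of 0 x] cos_monotone_0_pi[of x pi] by (simp add: sin_squared_eq)

text \<open>The variable x is the polar angle measured from the south pole: the height is
  \<open>- cos x\<close>, and \<open>K x\<close> is the norm of the corresponding points of
  \<open>C^d\<close>. The aim is that \<open>arctan (K x)\<close>, their Fubini-Study distance from
  the origin, is a 1-Lipschitz function of x. The condition that d is at least 2 forces the
  derivative to be small at the north pole.\<close>

locale radial_profile =
  fixes d :: nat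
  assumes d2: "d \<ge> 2"
begin

abbreviation "A \<equiv> cap_integral d 1"
definition m :: real where "m = 2 * real d - 1"

lemma m3: "m \<ge> 3" and dm: "real d = (m + 1) / 2"
  using d2 by (simp_all add: m_def)

definition K :: "real \<Rightarrow> real" where "K x = inv_height d (- cos x)"

text \<open>The logarithm of the derivative of \<open>arctan (K x)\<close>, as
  \<open>K_deriv\<close> shows. The Lipschitz bound amounts to \<open>l x \<le> 0\<close>.\<close>

definition l :: "real \<Rightarrow> real" where
  "l x = m * ln (sin x) + real d * ln (1 + (K x)\<^sup>2) - m * ln (K x) - ln (2 * real d * A)"

lemma d0: "d > 0" using d2 by simp

lemma A0: "A > 0" by (rule cap_total_pos)

lemma K_pos: "0 < x \<Longrightarrow> x < pi \<Longrightarrow> K x > 0"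
  unfolding K_def using polar_range[of x] by (intro inv_height_pos d0) auto

lemma exp_l:
  assumes x: "0 < x" "x < pi"
  shows "exp (l x) = sin x ^ (2 * d - 1) * (1 + (K x)\<^sup>2) ^ d / (2 * real d * A * K x ^ (2 * d - 1))"
proof -
  have m: "m = real (2 * d - 1)" using d0 by (simp add: of_nat_diff m_def)
  have p: "sin x > 0" "K x > 0" "1 + (K x)\<^sup>2 > 0" "2 * real d * A > 0"
    using polar_range[OF x] K_pos[OF x] A0 d0 by (auto simp: add_pos_nonneg)
  have "l x = ln (sin x ^ (2 * d - 1)) + ln ((1 + (K x)\<^sup>2) ^ d) - ln (K x ^ (2 * d - 1)) - ln (2 * real d * A)"
    unfolding l_def m using p by (simp only: ln_realpow)
  then have "exp (l x) = sin x ^ (2 * d - 1) * (1 + (K x)\<^sup>2) ^ d / K x ^ (2 * d - 1) / (2 * real d * A)"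
    using p by (simp add: exp_diff exp_add)
  then show ?thesis by (simp add: mult.commute)
qed

lemma K_deriv:
  assumes x: "0 < x" "x < pi"
  shows "(K has_real_derivative exp (l x) * (1 + (K x)\<^sup>2)) (at x)"
proof -
  note r = polar_range[OF x]
  obtain e where e: "d = Suc e" using d0 by (cases d) auto
  have "((\<lambda>x. inv_height d (- cos x)) has_real_derivative
    ((1 - (- cos x)\<^sup>2) ^ (d - 1) / A) * ((1 + (inv_height d (- cos x))\<^sup>2) ^ (d + 1) / (2 * real d * inv_height d (- cos x) ^ (2 * d - 1))) * sin x) (at x)"
    by (rule DERIV_chain2[OF inv_height_deriv[OF d0]]) (use r in \<open>auto intro!: derivative_eq_intros\<close>)
  moreover have "((1 - (- cos x)\<^sup>2) ^ (d - 1) / A) * ((1 + (K x)\<^sup>2) ^ (d + 1) / (2 * real d * K x ^ (2 * d - 1))) * sin x =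
     exp (l x) * (1 + (K x)\<^sup>2)"
  proof -
    have "((sin x)\<^sup>2) ^ (d - 1) * sin x = sin x ^ (2 * d - 1)" by (simp add: e power_mult[symmetric])
    then show ?thesis
      unfolding exp_l[OF x] using r by (simp add: mult_ac)
  qed
  ultimately show ?thesis unfolding K_def[symmetric] by (simp add: K_def[abs_def, symmetric])
qed

definition E :: "real \<Rightarrow> real" where
  "E x = m * (cos x / sin x) - exp (l x) * (m / K x - K x)"

lemma l_deriv:
  assumes x: "0 < x" "x < pi"
  shows "(l has_real_derivative E x) (at x)"
proof -
  have p: "sin x > 0" "K x > 0" "1 + (K x)\<^sup>2 > 0"
    using polar_range[OF x] K_pos[OF x] by (auto simp: add_pos_nonneg)
  let ?K' = "exp (l x) * (1 + (K x)\<^sup>2)"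
  have a: "((\<lambda>x. m * ln (sin x)) has_real_derivative m * (cos x / sin x)) (at x)"
    using p by (auto intro!: derivative_eq_intros)
  have b: "((\<lambda>x. real d * ln (1 + (K x)\<^sup>2)) has_real_derivative real d * (2 * K x * ?K' / (1 + (K x)\<^sup>2))) (at x)"
    using p by (auto intro!: derivative_eq_intros K_deriv[OF x] simp del: times_divide_eq_right simp: power2_eq_square)
  have c: "((\<lambda>x. m * ln (K x)) has_real_derivative m * (?K' / K x)) (at x)"
    using p by (auto intro!: derivative_eq_intros K_deriv[OF x])
  have L: "(\<lambda>x. m * ln (sin x) + real d * ln (1 + (K x)\<^sup>2) - m * ln (K x) - ln (2 * real d * A)) = l"
    by (rule ext) (rule l_def[symmetric])
  have "((\<lambda>x. m * ln (sin x) + real d * ln (1 + (K x)\<^sup>2) - m * ln (K x) - ln (2 * real d * A)) has_real_derivative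
      m * (cos x / sin x) + real d * (2 * K x * ?K' / (1 + (K x)\<^sup>2)) - m * (?K' / K x) - 0) (at x)"
    by (intro DERIV_diff DERIV_add a b c DERIV_const)
  then have "(l has_real_derivative m * (cos x / sin x) + real d * (2 * K x * ?K' / (1 + (K x)\<^sup>2)) - m * (?K' / K x) - 0) (at x)"
    unfolding L .
  moreover have "real d * (2 * K x * ?K' / (1 + (K x)\<^sup>2)) = exp (l x) * ((m + 1) * K x)" using p by (simp add: dm)
  moreover have "m * (?K' / K x) = exp (l x) * (m / K x + m * K x)" using p by (simp add: field_simps power2_eq_square)
  ultimately show ?thesis by (simp add: E_def algebra_simps)
qed

lemma E_deriv:
  assumes x: "0 < x" "x < pi"
  shows "(E has_real_derivative - m / (sin x)\<^sup>2 - (exp (l x) * E x * (m / K x - K x)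
    + exp (l x) * ((- m / (K x)\<^sup>2 - 1) * (exp (l x) * (1 + (K x)\<^sup>2))))) (at x)"
proof -
  have p: "sin x > 0" "K x > 0" using polar_range[OF x] K_pos[OF x] by auto
  let ?K' = "exp (l x) * (1 + (K x)\<^sup>2)"
  have 1: "((\<lambda>x. cos x / sin x) has_real_derivative - 1 / (sin x)\<^sup>2) (at x)"
  proof -
    have "((\<lambda>x. cos x / sin x) has_real_derivative (- sin x * sin x - cos x * cos x) / (sin x * sin x)) (at x)"
      using p by (intro DERIV_divide) (auto intro!: derivative_eq_intros)
    moreover have "- sin x * sin x - cos x * cos x = - 1" using sin_cos_squared_add[of x] by (simp add: power2_eq_square)
    ultimately show ?thesis by (simp add: power2_eq_square)
  qed
  have 2: "((\<lambda>x. m / K x - K x) has_real_derivative (- m / (K x)\<^sup>2 - 1) * ?K') (at x)"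
    using p by (auto intro!: derivative_eq_intros K_deriv[OF x] simp: field_simps power2_eq_square)
  have 3: "((\<lambda>x. exp (l x)) has_real_derivative exp (l x) * E x) (at x)"
    by (rule DERIV_fun_exp[OF l_deriv[OF x]])
  have "((\<lambda>x. m * (cos x / sin x) - exp (l x) * (m / K x - K x)) has_real_derivative
    m * (- 1 / (sin x)\<^sup>2) - (exp (l x) * E x * (m / K x - K x) + (- m / (K x)\<^sup>2 - 1) * ?K' * exp (l x))) (at x)"
    by (intro DERIV_diff DERIV_cmult DERIV_mult 1 2 3)
  then show ?thesis unfolding E_def[abs_def] by (simp add: mult_ac)
qed

text \<open>At a critical point \<open>E x = 0\<close> expresses \<open>m * cot x\<close> through
  \<open>k = K x\<close>, so that \<open>m / (sin x)^2 = m + D^2 * (m / k - k)^2 / m\<close> with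
  \<open>D = exp (l x)\<close>. The second derivative of \<open>l\<close> then equals
  \<open>D^2 * (m + 3 + k^2 - k^2 / m) - m\<close>, which is positive because D is at least
  1.\<close>

lemma E_deriv_pos:
  assumes x: "0 < x" "x < pi" and E0: "E x = 0" and l0: "l x \<ge> 0"
  shows "- m / (sin x)\<^sup>2 - (exp (l x) * E x * (m / K x - K x)
    + exp (l x) * ((- m / (K x)\<^sup>2 - 1) * (exp (l x) * (1 + (K x)\<^sup>2)))) > 0"
proof -
  have p: "sin x > 0" "K x > 0" using polar_range[OF x] K_pos[OF x] by auto
  define D where "D = exp (l x)"
  define k where "k = K x"
  have k: "k > 0" using p by (simp add: k_def)
  have D: "D \<ge> 1" using l0 by (simp add: D_def)
  have c: "m * (cos x / sin x) = D * (m / k - k)" using E0 by (simp add: E_def D_def k_def)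
  have "m / (sin x)\<^sup>2 = m + m * (cos x / sin x)\<^sup>2"
  proof -
    have "m / (sin x)\<^sup>2 = m * ((sin x)\<^sup>2 + (cos x)\<^sup>2) / (sin x)\<^sup>2" by simp
    also have "\<dots> = m + m * (cos x / sin x)\<^sup>2"
      using p by (simp only: ring_distribs add_divide_distrib power_divide) simp
    finally show ?thesis .
  qed
  also have "m * (cos x / sin x)\<^sup>2 = (m * (cos x / sin x))\<^sup>2 / m"
    using m3 by (simp add: power2_eq_square)
  also have "\<dots> = D\<^sup>2 * (m / k\<^sup>2 - 2 + k\<^sup>2 / m)"
    unfolding c using m3 k by (simp add: power2_eq_square field_simps)
  finally have s: "m / (sin x)\<^sup>2 = m + D\<^sup>2 * (m / k\<^sup>2 - 2 + k\<^sup>2 / m)" .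
  have t: "exp (l x) * ((- m / (K x)\<^sup>2 - 1) * (exp (l x) * (1 + (K x)\<^sup>2))) = - (D\<^sup>2 * (m / k\<^sup>2 + m + 1 + k\<^sup>2))"
    unfolding D_def[symmetric] k_def[symmetric] using k by (simp add: power2_eq_square field_simps)
  have "k\<^sup>2 / m \<le> k\<^sup>2" using m3 by (simp add: divide_le_eq mult_le_cancel_left1)
  then have "D\<^sup>2 * (m + 3 + k\<^sup>2 - k\<^sup>2 / m) \<ge> 1 * (m + 3)"
    using D m3 by (intro mult_mono) auto
  moreover have "m < 1 * (m + 3)" by simp
  ultimately have "D\<^sup>2 * (m + 3 + k\<^sup>2 - k\<^sup>2 / m) > m" by (rule less_le_trans[rotated])
  moreover have "D\<^sup>2 * (m / k\<^sup>2 + m + 1 + k\<^sup>2) - D\<^sup>2 * (m / k\<^sup>2 - 2 + k\<^sup>2 / m) = D\<^sup>2 * (m + 3 + k\<^sup>2 - k\<^sup>2 / m)"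
    by (simp add: algebra_simps)
  moreover have "- m / (sin x)\<^sup>2 = - (m / (sin x)\<^sup>2)" by simp
  ultimately show ?thesis using E0 s t by simp
qed

text \<open>At such a maximum \<open>E\<close> vanishes and, by \<open>E_deriv_pos\<close>, is
  positive just to the right, so \<open>l\<close> would strictly increase there.\<close>

lemma no_positive_local_max:
  assumes x: "0 < x" "x < pi" and l0: "l x > 0" and e: "e > 0"
    and max: "\<And>y. \<bar>x - y\<bar> < e \<Longrightarrow> l y \<le> l x"
  shows False
proof -
  have E0: "E x = 0"
    using DERIV_local_max[OF l_deriv[OF x] e] max by blast
  obtain r where r: "r > 0" "\<And>h. 0 < h \<Longrightarrow> h < r \<Longrightarrow> E x < E (x + h)"
    using DERIV_pos_inc_right[OF E_deriv[OF x] E_deriv_pos[OF x E0]] l0 by auto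
  define h where "h = min (r / 2) (min (e / 2) ((pi - x) / 2))"
  have h: "0 < h" "h < r" "h < e" "x + h < pi" using r e x by (auto simp: h_def min_def field_simps)
  have "l x < l (x + h)"
  proof (rule DERIV_pos_imp_increasing_open[where f = l and a = x and b = "x + h"])
    show "x < x + h" using h by simp
    fix y assume y: "x < y" "y < x + h"
    then have "0 < y" "y < pi" using x h by auto
    moreover have "E y > 0" using r(2)[of "y - x"] y h E0 by simp
    ultimately show "\<exists>z. (l has_real_derivative z) (at y) \<and> 0 < z" using l_deriv by blast
  next
    show "continuous_on {x..x + h} l"
      by (rule DERIV_continuous_on[where D = E])
        (use x h in \<open>auto intro!: has_field_derivative_at_within[OF l_deriv]\<close>)
  qed
  moreover have "l (x + h) \<le> l x" using h by (intro max) auto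
  ultimately show False by simp
qed

lemma cap_frac_K: "0 < x \<Longrightarrow> x < pi \<Longrightarrow> ((K x)\<^sup>2 / (1 + (K x)\<^sup>2)) ^ d = cap_frac d (- cos x)"
  unfolding K_def using polar_range[of x] by (intro inv_height d0) auto

text \<open>The bound \<open>sin x ^ (2d) / (2d) \<le> A * (K^2 / (1 + K^2)) ^ d\<close> from the
  cap below compares \<open>ln (sin x)\<close> with \<open>ln (K x)\<close>. Multiplied by m and
  inserted into \<open>2 * d * l x\<close>, it cancels these logarithms and leaves
  \<open>- ln (2 * d * A) + d * ln (1 + K^2)\<close>, where \<open>2 * d * A\<close> is at least
  2.\<close>

lemma l_le_near_0:
  assumes x: "0 < x" "x < pi" and K: "real d * ln (1 + (K x)\<^sup>2) \<le> ln 2"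
  shows "l x \<le> 0"
proof -
  have p: "sin x > 0" "K x > 0" "1 + (K x)\<^sup>2 > 0" "2 * real d * A > 0"
    using polar_range[OF x] K_pos[OF x] A0 d0 by (auto simp: add_pos_nonneg)
  have "((sin x)\<^sup>2) ^ d / (2 * real d) \<le> cap_integral d (- cos x)"
    using cap_integral_ge[OF d0, of "- cos x"] polar_range[OF x] by simp
  also have "\<dots> = A * ((K x)\<^sup>2 / (1 + (K x)\<^sup>2)) ^ d"
    unfolding cap_frac_K[OF x] cap_frac_def using A0 by simp
  finally have "((sin x)\<^sup>2) ^ d \<le> (2 * real d * A) * ((K x)\<^sup>2 / (1 + (K x)\<^sup>2)) ^ d"
    using d0 by (simp add: field_simps)
  then have "ln (((sin x)\<^sup>2) ^ d) \<le> ln ((2 * real d * A) * ((K x)\<^sup>2 / (1 + (K x)\<^sup>2)) ^ d)"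
    using p by (subst ln_le_cancel_iff) (auto intro!: mult_pos_pos)
  also have "ln (((sin x)\<^sup>2) ^ d) = real d * (2 * ln (sin x))" using p by (simp add: ln_realpow)
  also have "ln ((2 * real d * A) * ((K x)\<^sup>2 / (1 + (K x)\<^sup>2)) ^ d) =
      ln (2 * real d * A) + real d * (2 * ln (K x) - ln (1 + (K x)\<^sup>2))"
    using p by (subst ln_mult) (auto simp: ln_realpow ln_div)
  finally have "m * (real d * (2 * ln (sin x))) \<le> m * (ln (2 * real d * A) + real d * (2 * ln (K x) - ln (1 + (K x)\<^sup>2)))"
    using m3 by (intro mult_left_mono) auto
  then have "2 * real d * l x \<le> - ln (2 * real d * A) + real d * ln (1 + (K x)\<^sup>2)"
    unfolding l_def dm by (simp add: field_simps)
  also have "\<dots> \<le> 0"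
  proof -
    have "ln 2 \<le> ln (2 * real d * A)" using cap_total_ge[OF d0] p by (subst ln_le_cancel_iff) auto
    then show ?thesis using K by simp
  qed
  finally show ?thesis using d0 by (simp add: mult_le_0_iff)
qed

definition end_const :: real where
  "end_const = (1/2) * ln (2 * (real d)\<^sup>2 * A) + (m / 2) * ln 2 - ln (2 * real d * A)"

text \<open>The bound for the cap above, together with Bernoulli's inequality, gives
  \<open>1 + K^2 \<le> 2 * d^2 * A / sin x ^ (2d)\<close>, and past the equator
  \<open>1 + K^2 \<le> 2 * K^2\<close>. Together they yield
  \<open>l x \<le> (d - 1) * ln (sin x) + end_const\<close>, which is nonpositive for small
  \<open>sin x\<close> since d is at least 2.\<close>

lemma l_le_near_pi:
  assumes x: "pi / 2 \<le> x" "x < pi" and s: "sin x \<le> exp (- \<bar>end_const\<bar>)"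
  shows "l x \<le> 0"
proof -
  have x0: "0 < x" "x < pi" using x pi_gt_zero by linarith+
  have p: "sin x > 0" "K x > 0" "1 + (K x)\<^sup>2 > 0" "2 * real d * A > 0"
    using polar_range[OF x0] K_pos[OF x0] A0 d0 by (auto simp: add_pos_nonneg)
  define v where "v = cap_frac d (- cos x)"
  define u where "u = (K x)\<^sup>2 / (1 + (K x)\<^sup>2)"
  have u: "0 \<le> u" "u < 1" unfolding u_def using sq_frac_less_one[of "K x"] by auto
  have ud: "u ^ d = v" unfolding u_def v_def by (rule cap_frac_K[OF x0])
  have u1: "1 - u = 1 / (1 + (K x)\<^sup>2)" using p by (simp add: u_def field_simps)
  have "((sin x)\<^sup>2) ^ d / (2 * real d) \<le> A - cap_integral d (- cos x)"
    using cap_integral_compl_ge[OF d0, of "- cos x"] polar_range[OF x0] by simp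
  also have "\<dots> = A * (1 - v)" using A0 by (simp add: v_def cap_frac_def field_simps)
  also have "1 - v \<le> real d * (1 - u)"
    using Bernoulli_inequality[of "u - 1" d] u ud by (simp add: algebra_simps)
  finally have "((sin x)\<^sup>2) ^ d \<le> 2 * (real d)\<^sup>2 * A / (1 + (K x)\<^sup>2)"
    using d0 A0 by (simp add: u1 field_simps power2_eq_square)
  then have "ln (((sin x)\<^sup>2) ^ d) \<le> ln (2 * (real d)\<^sup>2 * A / (1 + (K x)\<^sup>2))"
    using p A0 d0 by (subst ln_le_cancel_iff) (auto intro!: divide_pos_pos mult_pos_pos)
  also have "ln (((sin x)\<^sup>2) ^ d) = real d * (2 * ln (sin x))" using p by (simp add: ln_realpow)
  also have "ln (2 * (real d)\<^sup>2 * A / (1 + (K x)\<^sup>2)) = ln (2 * (real d)\<^sup>2 * A) - ln (1 + (K x)\<^sup>2)"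
    using p A0 d0 by (subst ln_div) auto
  finally have 1: "ln (1 + (K x)\<^sup>2) \<le> ln (2 * (real d)\<^sup>2 * A) - real d * (2 * ln (sin x))" by simp
  \<comment> \<open>By symmetry the equator halves the area, so v is at least 1/2 in the northern
    hemisphere; u is the d-th root of v and hence no smaller.\<close>
  have "1 / 2 \<le> u"
  proof -
    have c: "0 \<le> - cos x" using cos_monotone_0_pi_le[of "pi/2" x] x pi_gt_zero by simp
    have "cap_integral d 1 + cap_integral d (- 1) = cap_integral d 0 + cap_integral d (- 0)"
    proof (rule DERIV_isconst_end[where f = "\<lambda>h. cap_integral d h + cap_integral d (- h)" and a = 0 and b = 1])
      show "continuous_on {0..1} (\<lambda>h. cap_integral d h + cap_integral d (- h))"
        by (intro continuous_on_add continuous_on_compose2[OF cap_integral_continuous] continuous_intros) auto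
      fix h :: real assume h: "0 < h" "h < 1"
      have "((\<lambda>h. cap_integral d h + cap_integral d (- h)) has_real_derivative (1 - h\<^sup>2) ^ (d - 1) + (1 - (- h)\<^sup>2) ^ (d - 1) * (- 1)) (at h)"
        by (intro DERIV_add DERIV_chain2[OF cap_integral_deriv] cap_integral_deriv) (use h in \<open>auto intro!: derivative_eq_intros\<close>)
      then show "((\<lambda>h. cap_integral d h + cap_integral d (- h)) has_real_derivative 0) (at h)" by simp
    qed simp
    then have cA: "A / 2 \<le> cap_integral d 0" by simp
    have "cap_integral d 0 \<le> cap_integral d (- cos x)"
      using cap_integral_less[of 0 "- cos x" d] polar_range[OF x0] c by (cases "cos x = 0") auto
    then have "1 / 2 \<le> v" using cA A0 by (simp add: v_def cap_frac_def field_simps)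
    also have "v \<le> u" unfolding ud[symmetric] using u d0 power_decreasing[of 1 d u] by simp
    finally show ?thesis .
  qed
  then have "1 + (K x)\<^sup>2 \<le> 2 * (K x)\<^sup>2" using p by (simp add: u_def field_simps)
  then have "ln (1 + (K x)\<^sup>2) \<le> ln (2 * (K x)\<^sup>2)" using p by (subst ln_le_cancel_iff) auto
  also have "\<dots> = ln 2 + 2 * ln (K x)" using p by (simp add: ln_mult ln_realpow)
  finally have "(m / 2) * ln (1 + (K x)\<^sup>2) \<le> (m / 2) * (ln 2 + 2 * ln (K x))"
    using m3 by (intro mult_left_mono) auto
  then have "l x \<le> (real d - 1) * ln (sin x) + end_const"
  proof -
    assume h: "(m / 2) * ln (1 + (K x)\<^sup>2) \<le> (m / 2) * (ln 2 + 2 * ln (K x))"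
    have e1: "real d * ln (1 + (K x)\<^sup>2) = (m / 2) * ln (1 + (K x)\<^sup>2) + ln (1 + (K x)\<^sup>2) / 2"
      by (simp add: dm field_simps)
    have e2: "(m / 2) * (ln 2 + 2 * ln (K x)) = (m / 2) * ln 2 + m * ln (K x)" by (simp add: field_simps)
    have e3: "(real d - 1) * ln (sin x) + real d * ln (sin x) = m * ln (sin x)" by (simp add: m_def algebra_simps)
    have e4: "real d * (2 * ln (sin x)) = 2 * (real d * ln (sin x))" by simp
    show ?thesis unfolding l_def end_const_def using h 1 unfolding e1 e2 e4 e3[symmetric] by linarith
  qed
  also have "\<dots> \<le> 0"
  proof -
    have ls: "ln (sin x) \<le> - \<bar>end_const\<bar>"
      using s p by (subst ln_exp[of "- \<bar>end_const\<bar>", symmetric], subst ln_le_cancel_iff) auto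
    then have "(real d - 1) * ln (sin x) \<le> 1 * ln (sin x)"
      using d2 by (intro mult_right_mono_neg) linarith+
    then show ?thesis using ls by linarith
  qed
  finally show ?thesis .
qed

text \<open>A positive value would make the maximum of \<open>l\<close> over a compact middle
  interval positive. The estimates near the poles keep that maximum off the end points, so it would
  be a forbidden positive local maximum.\<close>

lemma l_nonpos:
  assumes x: "0 < x" "x < pi"
  shows "l x \<le> 0"
proof (rule ccontr)
  assume "\<not> l x \<le> 0"
  then have lx: "l x > 0" by simp
  have "continuous_on {0..<pi} (\<lambda>x. inv_height d (- cos x))"
  proof (rule continuous_on_compose2[OF continuous_on_inv_height[OF d0]])
    show "(\<lambda>x. - cos x) ` {0..<pi} \<subseteq> {-1..<1}"
    proof
      fix y assume "y \<in> (\<lambda>x. - cos x) ` {0..<pi}"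
      then obtain t where "0 \<le> t" "t < pi" "y = - cos t" by auto
      then show "y \<in> {-1..<1}" using polar_range[of t] by (cases "t = 0") auto
    qed
  qed (intro continuous_intros)
  then have cK: "continuous_on {0..<pi} K" by (simp add: K_def[abs_def])
  have K0: "K 0 = 0" using d0 by (simp add: K_def inv_height_def)
  \<comment> \<open>Chosen so that \<open>K y < e\<close> gives
    \<open>d * ln (1 + (K y)^2) \<le> d * e^2 = ln 2\<close>, the condition of
    \<open>l_le_near_0\<close>.\<close>
  define e where "e = sqrt (ln 2 / real d)"
  have e: "e > 0" "e\<^sup>2 = ln 2 / real d" using d0 by (simp_all add: e_def)
  obtain \<delta> where \<delta>: "\<delta> > 0" "\<And>y. y \<in> {0..<pi} \<Longrightarrow> dist y 0 < \<delta> \<Longrightarrow> dist (K y) (K 0) < e"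
    using cK[unfolded continuous_on_iff, rule_format, of 0 e] e pi_gt_zero by auto
  have near0: "l y \<le> 0" if y: "0 < y" "y < pi" "y < \<delta>" for y
  proof (rule l_le_near_0[OF y(1,2)])
    have "0 < K y" "K y < e" using \<delta>(2)[of y] y K_pos[of y] by (auto simp: K0 dist_real_def)
    then have "(K y)\<^sup>2 \<le> e\<^sup>2" by (intro power_mono) auto
    moreover have "ln (1 + (K y)\<^sup>2) \<le> (K y)\<^sup>2" by (rule ln_add_one_self_le_self) simp
    ultimately have "ln (1 + (K y)\<^sup>2) \<le> ln 2 / real d" using e by linarith
    then show "real d * ln (1 + (K y)\<^sup>2) \<le> ln 2" using d0 by (simp add: field_simps)
  qed
  \<comment> \<open>Since \<open>sin y = sin (pi - y) \<le> pi - y\<close>, being within r of pi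
    supplies the smallness of the sine required by \<open>l_le_near_pi\<close>.\<close>
  define r where "r = min (pi / 2) (exp (- \<bar>end_const\<bar>))"
  have r: "r > 0" "r \<le> pi / 2" "r \<le> exp (- \<bar>end_const\<bar>)" by (auto simp: r_def)
  have nearpi: "l y \<le> 0" if y: "pi - r \<le> y" "y < pi" for y
  proof (rule l_le_near_pi)
    have "sin y = sin (pi - y)" by (rule sin_pi_minus[symmetric])
    also have "\<dots> \<le> pi - y" using y by (intro sin_x_le_x) simp
    finally show "sin y \<le> exp (- \<bar>end_const\<bar>)" using y r by linarith
  qed (use y r in linarith)+
  define a where "a = min (\<delta> / 2) (pi / 4)"
  have a: "0 < a" "a < \<delta>" "a < pi / 2" using \<delta> pi_gt_zero by (auto simp: a_def min_def)
  have mem: "x \<in> {a..pi - r}"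
    using near0[of x] nearpi[of x] x lx a by force
  have cl: "continuous_on {a..pi - r} l"
    by (rule DERIV_continuous_on[where D = E]) (use a r in \<open>auto intro!: has_field_derivative_at_within[OF l_deriv]\<close>)
  obtain y where y: "y \<in> {a..pi - r}" "\<And>z. z \<in> {a..pi - r} \<Longrightarrow> l z \<le> l y"
    using continuous_attains_sup[OF compact_Icc _ cl] mem by blast
  have ly: "l y > 0" using y(2)[OF mem] lx by linarith
  have y0: "0 < y" "y < pi" using y(1) a r by auto
  have "y \<noteq> a" using near0[of y] y0 a ly by auto
  moreover have "y \<noteq> pi - r" using nearpi[of y] y0 ly by auto
  ultimately have yi: "a < y" "y < pi - r" using y(1) by auto
  show False
  proof (rule no_positive_local_max[OF y0 ly])
    show "0 < min (y - a) (pi - r - y)" using yi by simp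
    show "l z \<le> l y" if "\<bar>y - z\<bar> < min (y - a) (pi - r - y)" for z
      using that by (intro y(2)) auto
  qed
qed

lemma arctan_K_lipschitz:
  assumes "0 < x" "x \<le> y" "y < pi"
  shows "\<bar>arctan (K y) - arctan (K x)\<bar> \<le> y - x"
proof (cases "x = y")
  case False
  then have xy: "x < y" using assms by simp
  have der: "((\<lambda>x. arctan (K x)) has_real_derivative exp (l z)) (at z)" if "x \<le> z" "z \<le> y" for z
  proof -
    have z: "0 < z" "z < pi" using that assms by auto
    have "1 + (K z)\<^sup>2 > 0" by (simp add: add_pos_nonneg)
    then have "inverse (1 + (K z)\<^sup>2) * (exp (l z) * (1 + (K z)\<^sup>2)) = exp (l z)" by simp
    moreover have "((\<lambda>x. arctan (K x)) has_real_derivative inverse (1 + (K z)\<^sup>2) * (exp (l z) * (1 + (K z)\<^sup>2))) (at z)"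
      by (rule DERIV_chain2[OF DERIV_arctan K_deriv[OF z]])
    ultimately show ?thesis by (simp only:)
  qed
  obtain z where z: "x < z" "z < y" "arctan (K y) - arctan (K x) = (y - x) * exp (l z)"
    using MVT2[OF xy der] by blast
  have "exp (l z) \<le> 1" using l_nonpos[of z] z assms by simp
  then have "(y - x) * exp (l z) \<le> (y - x) * 1" using xy by (intro mult_left_mono) auto
  then show ?thesis using z xy by (simp add: abs_mult)
qed simp

end

section \<open>Fubini-Study distance against chordal distance\<close>

definition herm :: "complex ^ 'd::finite \<Rightarrow> complex ^ 'd \<Rightarrow> complex" where
  "herm z w = (\<Sum>i\<in>UNIV. z $ i * cnj (w $ i))"

lemma Re_herm: "Re (herm z w) = inner z w"
  by (simp add: herm_def inner_vec_def inner_complex_def)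

text \<open>Since \<open>s * s' \<le> 1\<close>, the left side is at most
  \<open>2 * C - 1 - D\<close>. Since \<open>k^2 \<ge> 2 * k - 1\<close> and
  \<open>k * (a * b * D) \<le> D\<close>, the right side is at least \<open>2 * k - 1 - D\<close>.
  The hypothesis \<open>C \<le> k\<close> closes the gap.\<close>

lemma cos_compare_ineq:
  fixes s s' k C D a b :: real
  assumes s: "0 < s" "s \<le> 1" "0 < s'" "s' \<le> 1" and k: "0 \<le> k" "k \<le> 1" "C \<le> k" "C \<le> 1"
    and D: "0 \<le> D" and ab: "0 \<le> a" "a \<le> 1" "0 \<le> b" "b \<le> 1"
  shows "1 - (2 - 2 * C + s * s' * D) / (s * s') \<le> (k - a * b * D / 2)\<^sup>2"
proof -
  have ss: "0 < s * s'" "s * s' \<le> 1" using s by (auto intro: mult_le_one)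
  have "(2 - 2 * C) / 1 \<le> (2 - 2 * C) / (s * s')"
    using ss k by (intro divide_left_mono) auto
  then have 1: "2 - 2 * C + D \<le> (2 - 2 * C + s * s' * D) / (s * s')"
    using s by (simp add: add_divide_distrib)
  have "a * b \<le> 1" "0 \<le> a * b" using ab by (auto intro: mult_le_one)
  then have abD: "a * b * D \<le> D" "0 \<le> a * b * D" using D by (auto intro: mult_left_le_one_le)
  have "k * (a * b * D) \<le> 1 * (a * b * D)" using k abD by (intro mult_right_mono) auto
  moreover have "(k - a * b * D / 2)\<^sup>2 = k\<^sup>2 - k * (a * b * D) + (a * b * D / 2)\<^sup>2"
    by (simp add: power2_eq_square algebra_simps)
  moreover have "0 \<le> (a * b * D / 2)\<^sup>2" by simp
  moreover have "0 \<le> (k - 1)\<^sup>2" by simp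
  then have "2 * k - 1 \<le> k\<^sup>2" by (simp add: power2_eq_square algebra_simps)
  ultimately have "2 * k - 1 - D \<le> (k - a * b * D / 2)\<^sup>2" using abD by linarith
  then show ?thesis using 1 k by linarith
qed

lemma (in radial_profile) arctan_K_lipschitz':
  assumes "0 < x" "x < pi" "0 < y" "y < pi"
  shows "\<bar>arctan (K x) - arctan (K y)\<bar> \<le> \<bar>x - y\<bar>"
  using arctan_K_lipschitz[of x y] arctan_K_lipschitz[of y x] assms by (cases "x \<le> y") (auto simp: abs_minus_commute)

lemma norm_fst_sphere_map:
  fixes z :: "complex ^ 'd::finite"
  assumes z: "z \<noteq> 0"
  shows "norm (fst (sphere_map z)) = sqrt (1 - (height CARD('d) (norm z))\<^sup>2)"
proof -
  have "(height CARD('d) (norm z))\<^sup>2 \<le> 1"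
    using height(1,2)[of "CARD('d)" "norm z"] by (simp add: abs_square_le_1 abs_le_iff)
  then show ?thesis using z by (simp add: sphere_map_eq Let_def)
qed

text \<open>Both points are described by an angle and a unit direction, with D the squared distance
  of the directions. On the sphere the squared chord is
  \<open>2 - 2 * cos (g - h) + sin g * sin h * D\<close>. In \<open>C^d\<close>, with
  \<open>a = arctan (norm z)\<close> and \<open>b = arctan (norm w)\<close>, the normalized
  \<open>1 + inner z w\<close> is \<open>cos (a - b) - sin a * sin b * D / 2\<close>. The
  contraction property gives \<open>cos (g - h) \<le> cos (a - b)\<close>, and
  \<open>cos_compare_ineq\<close> combines the two.\<close>

lemma fubini_study_ge_chordal:
  fixes z w :: "complex ^ 'd::finite"
  assumes d2: "CARD('d) \<ge> 2" and z: "z \<noteq> 0" and w: "w \<noteq> 0"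
  shows "1 - (norm (sphere_map z - sphere_map w))\<^sup>2 / (norm (fst (sphere_map z)) * norm (fst (sphere_map w)))
    \<le> (cmod (1 + herm z w))\<^sup>2 / ((1 + (norm z)\<^sup>2) * (1 + (norm w)\<^sup>2))"
proof -
  interpret radial_profile "CARD('d)" by standard (rule d2)
  let ?d = "CARD('d)"
  define t r where "t = norm z" and "r = norm w"
  have tr: "t > 0" "r > 0" using z w by (simp_all add: t_def r_def)
  define \<theta> \<phi> where "\<theta> = z /\<^sub>R t" and "\<phi> = w /\<^sub>R r"
  have n: "norm \<theta> = 1" "norm \<phi> = 1" using tr by (simp_all add: \<theta>_def \<phi>_def t_def r_def)
  have zw: "z = t *\<^sub>R \<theta>" "w = r *\<^sub>R \<phi>" using tr by (simp_all add: \<theta>_def \<phi>_def)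
  define D where "D = (norm (\<theta> - \<phi>))\<^sup>2"
  have ip: "inner \<theta> \<phi> = 1 - D / 2"
    unfolding dot_norm_neg n D_def by simp
  have n2: "inner \<theta> \<theta> = 1" "inner \<phi> \<phi> = 1" using n by (simp_all add: dot_square_norm)
  \<comment> \<open>Polar angles are counted from the south pole, the image of the origin; hence the
    sign.\<close>
  define g h where "g = arccos (- height ?d t)" and "h = arccos (- height ?d r)"
  have ht: "-1 < height ?d t" "height ?d t < 1" "-1 < height ?d r" "height ?d r < 1"
    using height(2)[of ?d t] height_gt[of ?d t] height(2)[of ?d r] height_gt[of ?d r] tr by auto
  have cg: "- cos g = height ?d t" "- cos h = height ?d r" using ht by (simp_all add: g_def h_def)
  have gr: "0 < g" "g < pi" "0 < h" "h < pi"
    using arccos_lt_bounded[of "- height ?d t"] arccos_lt_bounded[of "- height ?d r"] ht by (simp_all add: g_def h_def)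
  have sg: "sqrt (1 - (height ?d t)\<^sup>2) = sin g" "sqrt (1 - (height ?d r)\<^sup>2) = sin h"
    unfolding cg[symmetric] using polar_range[OF gr(1,2)] polar_range[OF gr(3,4)] by simp_all
  have sp: "0 < sin g" "0 < sin h" using polar_range[OF gr(1,2)] polar_range[OF gr(3,4)] by simp_all
  have K: "K g = t" "K h = r"
    unfolding K_def cg using tr by (simp_all add: inv_height_height)
  define a b where "a = arctan t" and "b = arctan r"
  have ab: "0 < a" "a < pi / 2" "0 < b" "b < pi / 2"
    using arctan_bounded[of t] arctan_bounded[of r] tr by (simp_all add: a_def b_def)
  have lip: "\<bar>a - b\<bar> \<le> \<bar>g - h\<bar>" using arctan_K_lipschitz'[OF gr] by (simp add: K a_def b_def)
  have pz: "sphere_map z = (sin g *\<^sub>R \<theta>, - cos g)" "sphere_map w = (sin h *\<^sub>R \<phi>, - cos h)"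
    unfolding sphere_map_eq Let_def t_def[symmetric] r_def[symmetric] sg cg \<theta>_def[symmetric] \<phi>_def[symmetric] by simp_all
  have nf: "norm (fst (sphere_map z)) = sin g" "norm (fst (sphere_map w)) = sin h"
    unfolding pz using n sp by simp_all
  have "(norm (sphere_map z - sphere_map w))\<^sup>2 = (norm (sin g *\<^sub>R \<theta> - sin h *\<^sub>R \<phi>))\<^sup>2 + (cos h - cos g)\<^sup>2"
    unfolding pz by (simp add: norm_Pair)
  also have "(norm (sin g *\<^sub>R \<theta> - sin h *\<^sub>R \<phi>))\<^sup>2 = (sin g)\<^sup>2 + (sin h)\<^sup>2 - 2 * (sin g * sin h) * inner \<theta> \<phi>"
    using n2 by (simp only: power2_norm_eq_inner inner_diff_left inner_diff_right inner_scaleR_left inner_scaleR_right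
      inner_commute[of \<phi> \<theta>]) (simp add: power2_eq_square algebra_simps)
  also have "\<dots> + (cos h - cos g)\<^sup>2 = ((sin g)\<^sup>2 + (cos g)\<^sup>2) + ((sin h)\<^sup>2 + (cos h)\<^sup>2) - 2 * cos (g - h) + sin g * sin h * D"
  proof -
    have "A\<^sup>2 + B\<^sup>2 - 2 * (A * B) * (1 - D / 2) + (F - C)\<^sup>2 = (A\<^sup>2 + C\<^sup>2) + (B\<^sup>2 + F\<^sup>2) - 2 * (C * F + A * B) + A * B * D" for A B C F :: real
      by (simp add: power2_eq_square algebra_simps)
    then show ?thesis unfolding ip cos_diff by blast
  qed
  finally have X: "(norm (sphere_map z - sphere_map w))\<^sup>2 = 2 - 2 * cos (g - h) + sin g * sin h * D"
    by simp
  have q: "sqrt (1 + t\<^sup>2) > 0" "sqrt (1 + r\<^sup>2) > 0" by (simp_all add: add_pos_nonneg)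
  have sc: "sin a = t / sqrt (1 + t\<^sup>2)" "cos a = 1 / sqrt (1 + t\<^sup>2)" "sin b = r / sqrt (1 + r\<^sup>2)" "cos b = 1 / sqrt (1 + r\<^sup>2)"
    by (simp_all add: a_def b_def sin_arctan cos_arctan)
  have "1 + inner z w = (cos a * cos b + sin a * sin b * inner \<theta> \<phi>) * (sqrt (1 + t\<^sup>2) * sqrt (1 + r\<^sup>2))"
    unfolding zw sc using q by (simp add: field_simps)
  also have "cos a * cos b + sin a * sin b * inner \<theta> \<phi> = cos (a - b) - sin a * sin b * D / 2"
    unfolding cos_diff ip by (simp add: algebra_simps)
  finally have "(1 + inner z w)\<^sup>2 = (cos (a - b) - sin a * sin b * D / 2)\<^sup>2 * ((1 + t\<^sup>2) * (1 + r\<^sup>2))"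
    by (simp add: power_mult_distrib add_nonneg_nonneg)
  moreover have pos: "(1 + t\<^sup>2) * (1 + r\<^sup>2) > 0" by (simp add: add_pos_nonneg)
  ultimately have Y: "(1 + inner z w)\<^sup>2 / ((1 + t\<^sup>2) * (1 + r\<^sup>2)) = (cos (a - b) - sin a * sin b * D / 2)\<^sup>2"
    by (metis less_irrefl nonzero_mult_div_cancel_right)
  have "cos (g - h) \<le> cos (a - b)"
  proof -
    have "cos \<bar>g - h\<bar> \<le> cos \<bar>a - b\<bar>" using lip gr by (intro cos_monotone_0_pi_le) auto
    then show ?thesis by simp
  qed
  moreover have "0 \<le> cos (a - b)" using ab by (intro cos_ge_zero) auto
  ultimately have "1 - (2 - 2 * cos (g - h) + sin g * sin h * D) / (sin g * sin h) \<le> (cos (a - b) - sin a * sin b * D / 2)\<^sup>2"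
    using sp ab by (intro cos_compare_ineq) (auto simp: D_def intro!: sin_ge_zero)
  \<comment> \<open>Only the real part of \<open>1 + herm z w\<close> is kept; it is given by the
    Euclidean inner product.\<close>
  also have "\<dots> \<le> (cmod (1 + herm z w))\<^sup>2 / ((1 + t\<^sup>2) * (1 + r\<^sup>2))"
  proof -
    have "\<bar>1 + inner z w\<bar> \<le> cmod (1 + herm z w)"
      using abs_Re_le_cmod[of "1 + herm z w"] by (simp add: Re_herm)
    then have "(1 + inner z w)\<^sup>2 \<le> (cmod (1 + herm z w))\<^sup>2" by (metis abs_ge_zero power2_abs power_mono)
    then show ?thesis unfolding Y[symmetric] using pos by (intro divide_right_mono) auto
  qed
  finally show ?thesis unfolding X nf t_def r_def .
qed

section \<open>Multinomial expansion and norms of the weighted monomials\<close>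

text \<open>Pinning the entries outside S to 0 keeps the set finite and lets an induction on S add
  one entry at a time.\<close>

definition multi_index :: "'d set \<Rightarrow> nat \<Rightarrow> ('d \<Rightarrow> nat) set" where
  "multi_index S n = {\<alpha>. (\<forall>i. i \<notin> S \<longrightarrow> \<alpha> i = 0) \<and> sum \<alpha> S \<le> n}"

lemma finite_multi_index: "finite S \<Longrightarrow> finite (multi_index S n)"
proof -
  assume S: "finite S"
  have "multi_index S n \<subseteq> {f. \<forall>x. (x \<in> S \<longrightarrow> f x \<in> {..n}) \<and> (x \<notin> S \<longrightarrow> f x = 0)}"
  proof (intro subsetI CollectI allI conjI impI)
    fix \<alpha> i assume \<alpha>: "\<alpha> \<in> multi_index S n"
    show "\<alpha> i = 0" if "i \<notin> S" using \<alpha> that by (simp add: multi_index_def)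
    have "\<alpha> i \<le> sum \<alpha> S" if "i \<in> S" using that S by (intro member_le_sum) auto
    then show "\<alpha> i \<in> {..n}" if "i \<in> S" using \<alpha> that by (simp add: multi_index_def)
  qed
  then show ?thesis by (rule finite_subset) (rule finite_set_of_finite_funs[OF S finite_atMost])
qed

text \<open>The slack variable y absorbs the missing degree, so that all multi-indices of degree at
  most n occur. In the induction the new summand \<open>x a\<close> is first added to y, and then
  \<open>(y + x a) ^ m\<close> is expanded by the binomial theorem; the binomial index becomes the
  entry at a.\<close>

lemma multinomial_theorem:
  fixes x :: "'d \<Rightarrow> 'a::field_char_0"
  assumes "finite S"
  shows "(y + sum x S) ^ n = (\<Sum>\<alpha>\<in>multi_index S n. fact n / (fact (n - sum \<alpha> S) * (\<Prod>i\<in>S. fact (\<alpha> i))) *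
    (y ^ (n - sum \<alpha> S) * (\<Prod>i\<in>S. x i ^ \<alpha> i)))"
  using assms
proof (induction S arbitrary: y rule: finite_induct)
  case empty
  have "multi_index {} n = {\<lambda>_::'d. 0}" by (auto simp: multi_index_def)
  then show ?case by simp
next
  case (insert a S)
  let ?t = "\<lambda>\<beta>. fact n / (fact (n - sum \<beta> (insert a S)) * (\<Prod>i\<in>insert a S. fact (\<beta> i))) *
    (y ^ (n - sum \<beta> (insert a S)) * (\<Prod>i\<in>insert a S. x i ^ \<beta> i))"
  have "(y + sum x (insert a S)) ^ n = ((y + x a) + sum x S) ^ n"
    using insert by (simp add: add.assoc)
  also have "\<dots> = (\<Sum>\<alpha>\<in>multi_index S n. fact n / (fact (n - sum \<alpha> S) * (\<Prod>i\<in>S. fact (\<alpha> i))) *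
    ((y + x a) ^ (n - sum \<alpha> S) * (\<Prod>i\<in>S. x i ^ \<alpha> i)))"
    by (rule insert.IH)
  also have "\<dots> = (\<Sum>\<alpha>\<in>multi_index S n. \<Sum>k\<in>{..n - sum \<alpha> S}. ?t (\<alpha>(a := k)))"
  proof (rule sum.cong[OF refl])
    fix \<alpha> assume \<alpha>: "\<alpha> \<in> multi_index S n"
    define m where "m = n - sum \<alpha> S"
    have "(y + x a) ^ m = (\<Sum>k\<le>m. of_nat (m choose k) * x a ^ k * y ^ (m - k))"
      by (subst add.commute) (rule binomial_ring)
    then have "fact n / (fact m * (\<Prod>i\<in>S. fact (\<alpha> i))) * ((y + x a) ^ m * (\<Prod>i\<in>S. x i ^ \<alpha> i)) =
      (\<Sum>k\<le>m. fact n / (fact m * (\<Prod>i\<in>S. fact (\<alpha> i))) * ((of_nat (m choose k) * x a ^ k * y ^ (m - k)) * (\<Prod>i\<in>S. x i ^ \<alpha> i)))"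
      by (simp only: sum_distrib_left sum_distrib_right)
    also have "\<dots> = (\<Sum>k\<le>m. ?t (\<alpha>(a := k)))"
    proof (rule sum.cong[OF refl])
      fix k assume k: "k \<in> {..m}"
      have s: "sum (\<alpha>(a := k)) (insert a S) = k + sum \<alpha> S"
        using insert.hyps by (simp add: sum.insert) (auto intro!: sum.cong)
      have p1: "(\<Prod>i\<in>insert a S. fact ((\<alpha>(a := k)) i)) = fact k * (\<Prod>i\<in>S. fact (\<alpha> i) :: 'a)"
        using insert.hyps by (simp add: prod.insert) (auto intro!: prod.cong)
      have p2: "(\<Prod>i\<in>insert a S. x i ^ (\<alpha>(a := k)) i) = x a ^ k * (\<Prod>i\<in>S. x i ^ \<alpha> i)"
      proof -
        have "(\<Prod>i\<in>S. x i ^ (\<alpha>(a := k)) i) = (\<Prod>i\<in>S. x i ^ \<alpha> i)"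
          using insert.hyps by (intro prod.cong) auto
        then show ?thesis unfolding prod.insert[OF insert.hyps] by simp
      qed
      have b: "of_nat (m choose k) = (fact m / (fact k * fact (m - k)) :: 'a)"
        using k by (simp add: binomial_fact)
      have nm: "n - (k + sum \<alpha> S) = m - k" by (simp add: m_def)
      show "fact n / (fact m * (\<Prod>i\<in>S. fact (\<alpha> i))) * ((of_nat (m choose k) * x a ^ k * y ^ (m - k)) * (\<Prod>i\<in>S. x i ^ \<alpha> i))
        = ?t (\<alpha>(a := k))"
        unfolding s p1 p2 b nm by (simp add: mult_ac)
    qed
    finally show "fact n / (fact (n - sum \<alpha> S) * (\<Prod>i\<in>S. fact (\<alpha> i))) *
      ((y + x a) ^ (n - sum \<alpha> S) * (\<Prod>i\<in>S. x i ^ \<alpha> i)) = (\<Sum>k\<le>n - sum \<alpha> S. ?t (\<alpha>(a := k)))"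
      unfolding m_def .
  qed
  also have "\<dots> = (\<Sum>(\<alpha>, k)\<in>Sigma (multi_index S n) (\<lambda>\<alpha>. {..n - sum \<alpha> S}). ?t (\<alpha>(a := k)))"
    using insert.hyps by (intro sum.Sigma) (auto intro: finite_multi_index)
  also have "\<dots> = (\<Sum>\<beta>\<in>multi_index (insert a S) n. ?t \<beta>)"
  proof (rule sum.reindex_bij_witness[where i = "\<lambda>\<beta>. (\<beta>(a := 0), \<beta> a)" and j = "\<lambda>(\<alpha>, k). \<alpha>(a := k)"])
    have e: "sum (\<alpha>(a := k)) S = sum \<alpha> S" for \<alpha> :: "'d \<Rightarrow> nat" and k
      using insert.hyps by (intro sum.cong) auto
    fix p assume p: "p \<in> Sigma (multi_index S n) (\<lambda>\<alpha>. {..n - sum \<alpha> S})"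
    obtain \<alpha> k where pk: "p = (\<alpha>, k)" by (cases p)
    have "\<alpha> a = 0" using p insert.hyps by (auto simp: pk multi_index_def)
    then show "(\<lambda>\<beta>. (\<beta>(a := 0), \<beta> a)) (case p of (\<alpha>, k) \<Rightarrow> \<alpha>(a := k)) = p" by (simp add: pk fun_upd_idem)
    show "(case p of (\<alpha>, k) \<Rightarrow> \<alpha>(a := k)) \<in> multi_index (insert a S) n"
      using p insert.hyps e by (auto simp: pk multi_index_def)
    show "?t (case p of (\<alpha>, k) \<Rightarrow> \<alpha>(a := k)) = (case p of (\<alpha>, k) \<Rightarrow> ?t (\<alpha>(a := k)))" by (simp add: pk)
  next
    have e: "sum (\<alpha>(a := k)) S = sum \<alpha> S" for \<alpha> :: "'d \<Rightarrow> nat" and k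
      using insert.hyps by (intro sum.cong) auto
    fix \<beta> assume b: "\<beta> \<in> multi_index (insert a S) n"
    show "(case (\<beta>(a := 0), \<beta> a) of (\<alpha>, k) \<Rightarrow> \<alpha>(a := k)) = \<beta>" by simp
    show "(\<beta>(a := 0), \<beta> a) \<in> Sigma (multi_index S n) (\<lambda>\<alpha>. {..n - sum \<alpha> S})"
      using b insert.hyps e by (auto simp: multi_index_def)
  qed
  finally show ?case .
qed

lemma borel_measurable_vec_lambda:
  "vec_lambda \<in> (\<Pi>\<^sub>M i\<in>(UNIV :: 'd::finite set). (borel :: 'a::euclidean_space measure)) \<rightarrow>\<^sub>M (borel :: ('a ^ 'd) measure)"
proof (rule borel_measurable_euclidean_space[THEN iffD2], intro ballI)
  fix b :: "'a ^ 'd" assume "b \<in> Basis"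
  then obtain i u where "b = axis i u" by (auto simp: Basis_vec_def)
  then show "(\<lambda>x. vec_lambda x \<bullet> b) \<in> borel_measurable (\<Pi>\<^sub>M i\<in>(UNIV :: 'd set). (borel :: 'a measure))"
    by (simp add: inner_axis)
qed

lemma prod_Basis_vec:
  "(\<Prod>b\<in>(Basis :: ('a::euclidean_space ^ 'd::finite) set). f b) = (\<Prod>i\<in>UNIV. \<Prod>u\<in>Basis. f (axis i u))"
proof -
  let ?h = "\<lambda>p :: 'd \<times> 'a. axis (fst p) (snd p)"
  have "prod f (Basis :: ('a ^ 'd) set) = prod f (?h ` (UNIV \<times> Basis))"
    by (rule prod.cong) (force simp: Basis_vec_def)+
  also have "\<dots> = (\<Prod>p\<in>UNIV \<times> Basis. f (?h p))"
    by (subst prod.reindex) (auto simp: inj_on_def axis_eq_axis)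
  also have "\<dots> = (\<Prod>i\<in>UNIV. \<Prod>u\<in>Basis. f (axis i u))"
    by (simp only: prod.cartesian_product case_prod_unfold)
  finally show ?thesis .
qed

text \<open>Lebesgue measure is determined by its values on boxes, and the volume of a box factors
  over the coordinates. This provides the product formula
  \<open>nn_integral_vec_prod\<close>.\<close>

lemma lborel_vec:
  "(lborel :: ('a::euclidean_space ^ 'd::finite) measure) = distr (\<Pi>\<^sub>M i\<in>UNIV. lborel) borel vec_lambda"
proof (rule lborel_eqI)
  interpret product_sigma_finite "\<lambda>_::'d. (lborel :: 'a measure)" ..
  have [measurable]: "vec_lambda \<in> (\<Pi>\<^sub>M i\<in>(UNIV :: 'd set). (lborel :: 'a measure)) \<rightarrow>\<^sub>M (borel :: ('a ^ 'd) measure)"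
    using borel_measurable_vec_lambda by (simp cong: measurable_cong_sets sets_PiM_cong)
  fix l u :: "'a ^ 'd" assume lu: "\<And>b. b \<in> Basis \<Longrightarrow> l \<bullet> b \<le> u \<bullet> b"
  have ax: "axis i b \<in> (Basis :: ('a ^ 'd) set)" if "b \<in> Basis" for i b using that by (auto simp: Basis_vec_def)
  have lui: "l $ i \<bullet> b \<le> u $ i \<bullet> b" if "b \<in> Basis" for i b
    using lu[OF ax[OF that, of i]] by (simp add: inner_axis)
  have "vec_lambda -` box l u \<inter> space (\<Pi>\<^sub>M i\<in>(UNIV :: 'd set). (lborel :: 'a measure)) = (\<Pi>\<^sub>E i\<in>UNIV. box (l $ i) (u $ i))"
    by (auto simp: space_PiM mem_box Basis_vec_def inner_axis PiE_iff)
  then have "emeasure (distr (\<Pi>\<^sub>M i\<in>UNIV. lborel) borel vec_lambda) (box l u) =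
    emeasure (\<Pi>\<^sub>M i\<in>(UNIV :: 'd set). (lborel :: 'a measure)) (\<Pi>\<^sub>E i\<in>UNIV. box (l $ i) (u $ i))"
    by (subst emeasure_distr) auto
  also have "\<dots> = (\<Prod>i\<in>UNIV. emeasure lborel (box (l $ i) (u $ i)))"
    by (rule emeasure_PiM) auto
  also have "\<dots> = (\<Prod>i\<in>UNIV. ennreal (\<Prod>b\<in>Basis. (u $ i - l $ i) \<bullet> b))"
    using lui by (intro prod.cong refl) (subst emeasure_lborel_box, auto)
  also have "\<dots> = ennreal (\<Prod>i\<in>UNIV. \<Prod>b\<in>Basis. (u $ i - l $ i) \<bullet> b)"
    using lui by (intro prod_ennreal prod_nonneg) (auto simp: inner_diff_left)
  also have "(\<Prod>i\<in>UNIV. \<Prod>b\<in>Basis. (u $ i - l $ i) \<bullet> b) = (\<Prod>b\<in>Basis. (u - l) \<bullet> b)"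
    by (simp add: prod_Basis_vec inner_axis)
  finally show "emeasure (distr (\<Pi>\<^sub>M i\<in>UNIV. lborel) borel vec_lambda) (box l u) = ennreal (\<Prod>b\<in>Basis. (u - l) \<bullet> b)" .
qed simp

lemma nn_integral_vec_prod:
  fixes f :: "'d::finite \<Rightarrow> 'a::euclidean_space \<Rightarrow> ennreal"
  assumes [measurable]: "\<And>i. f i \<in> borel_measurable borel"
  shows "(\<integral>\<^sup>+z. (\<Prod>i\<in>UNIV. f i (z $ i)) \<partial>lborel) = (\<Prod>i\<in>UNIV. \<integral>\<^sup>+x. f i x \<partial>lborel)"
proof -
  interpret product_sigma_finite "\<lambda>_::'d. (lborel :: 'a measure)" ..
  have [measurable]: "vec_lambda \<in> (\<Pi>\<^sub>M i\<in>(UNIV :: 'd set). (lborel :: 'a measure)) \<rightarrow>\<^sub>M (borel :: ('a ^ 'd) measure)"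
    using borel_measurable_vec_lambda by (simp cong: measurable_cong_sets sets_PiM_cong)
  have nth[measurable]: "(\<lambda>z::'a^'d. z $ i) \<in> borel_measurable borel" for i
    by (intro borel_measurable_continuous_onI linear_continuous_on bounded_linear_vec_nth)
  have "(\<integral>\<^sup>+z. (\<Prod>i\<in>UNIV. f i (z $ i)) \<partial>lborel) = (\<integral>\<^sup>+x. (\<Prod>i\<in>UNIV. f i (x i)) \<partial>(\<Pi>\<^sub>M i\<in>(UNIV :: 'd set). (lborel :: 'a measure)))"
    by (subst lborel_vec, subst nn_integral_distr) auto
  also have "\<dots> = (\<Prod>i\<in>UNIV. \<integral>\<^sup>+x. f i x \<partial>lborel)"
    by (rule product_nn_integral_prod) auto
  finally show ?thesis .
qed

lemma nn_integral_power_gaussian: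
  assumes t: "t > 0"
  shows "(\<integral>\<^sup>+r. ennreal (r ^ (2 * k + 1) * exp (- t * r\<^sup>2)) * indicator {0<..} r \<partial>lborel) = ennreal (fact k / (2 * t ^ (k + 1)))"
proof -
  define c where "c = 1 / sqrt t"
  have c: "c > 0" "t * c\<^sup>2 = 1" using t by (simp_all add: c_def power_divide)
  have "(\<integral>\<^sup>+r. ennreal (r ^ (2 * k + 1) * exp (- t * r\<^sup>2)) * indicator {0<..} r \<partial>lborel) =
    ennreal \<bar>c\<bar> * (\<integral>\<^sup>+r. ennreal ((0 + c * r) ^ (2 * k + 1) * exp (- t * (0 + c * r)\<^sup>2)) * indicator {0<..} (0 + c * r) \<partial>lborel)"
    by (rule nn_integral_real_affine) (use c in auto)
  also have "(\<integral>\<^sup>+r. ennreal ((0 + c * r) ^ (2 * k + 1) * exp (- t * (0 + c * r)\<^sup>2)) * indicator {0<..} (0 + c * r) \<partial>lborel)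
    = (\<integral>\<^sup>+r. ennreal (c ^ (2 * k + 1)) * ennreal (indicator {0..} r *\<^sub>R (exp (- r\<^sup>2) * r ^ (2 * k + 1))) \<partial>lborel)"
  proof (rule nn_integral_cong)
    fix r :: real
    have "t * (c * r)\<^sup>2 = r\<^sup>2" using c(2) by (simp add: power_mult_distrib flip: mult.assoc)
    then have e: "exp (- t * (0 + c * r)\<^sup>2) = exp (- r\<^sup>2)" by simp
    have w: "(0 + c * r) ^ (2 * k + 1) = c ^ (2 * k + 1) * r ^ (2 * k + 1)" by (simp only: add_0 power_mult_distrib)
    have i: "indicator {0<..} (0 + c * r) = (indicator {0<..} r :: ennreal)"
      using c(1) by (simp add: indicator_def zero_less_mult_iff)
    show "ennreal ((0 + c * r) ^ (2 * k + 1) * exp (- t * (0 + c * r)\<^sup>2)) * indicator {0<..} (0 + c * r) =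
      ennreal (c ^ (2 * k + 1)) * ennreal (indicator {0..} r *\<^sub>R (exp (- r\<^sup>2) * r ^ (2 * k + 1)))"
    proof (cases "r > 0")
      case True
      have "ennreal (c ^ (2 * k + 1) * r ^ (2 * k + 1) * exp (- r\<^sup>2)) = ennreal (c ^ (2 * k + 1)) * ennreal (exp (- r\<^sup>2) * r ^ (2 * k + 1))"
        using True c(1) by (subst ennreal_mult[symmetric]) (simp_all add: mult_ac)
      then show ?thesis unfolding e w i using True by simp
    next
      case False
      then show ?thesis unfolding i by (cases "r = 0") simp_all
    qed
  qed
  also have "\<dots> = ennreal (c ^ (2 * k + 1)) * (\<integral>\<^sup>+r. ennreal (indicator {0..} r *\<^sub>R (exp (- r\<^sup>2) * r ^ (2 * k + 1))) \<partial>lborel)"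
    by (rule nn_integral_cmult) simp
  also have "(\<integral>\<^sup>+r. ennreal (indicator {0..} r *\<^sub>R (exp (- r\<^sup>2) * r ^ (2 * k + 1))) \<partial>lborel) = ennreal (fact k / 2)"
    using gaussian_moment_odd_pos[of k] by (subst nn_integral_eq_integral) (auto simp: has_bochner_integral_iff field_simps intro!: AE_I2 split: split_indicator)
  also have "ennreal \<bar>c\<bar> * (ennreal (c ^ (2 * k + 1)) * ennreal (fact k / 2)) = ennreal (c * c ^ (2 * k + 1) * (fact k / 2))"
    using c by (simp add: mult.assoc flip: ennreal_mult)
  also have "c * c ^ (2 * k + 1) = (c\<^sup>2) ^ (k + 1)" unfolding power_mult[symmetric] by simp
  also have "c\<^sup>2 = 1 / t" using c(2) t by (simp add: field_simps)
  finally show ?thesis by (simp add: power_divide mult.commute)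
qed

lemma nn_integral_complex_gaussian:
  assumes t: "t > 0"
  shows "(\<integral>\<^sup>+z. ennreal (cmod z ^ (2 * k) * exp (- t * (cmod z)\<^sup>2)) \<partial>lborel) = ennreal (pi * fact k / t ^ (k + 1))"
proof -
  have "(\<integral>\<^sup>+z. ennreal (cmod z ^ (2 * k) * exp (- t * (cmod z)\<^sup>2)) \<partial>lborel) =
    (\<integral>\<^sup>+\<theta>. (\<integral>\<^sup>+r. ennreal (cmod (r *\<^sub>R \<theta>) ^ (2 * k) * exp (- t * (cmod (r *\<^sub>R \<theta>))\<^sup>2)) * ennreal (r ^ (DIM(complex) - 1)) * indicator {0<..} r \<partial>lborel)
      \<partial>(surface_measure :: complex measure))"
    by (rule nn_integral_polar) simp
  also have "\<dots> = (\<integral>\<^sup>+\<theta>. ennreal (fact k / (2 * t ^ (k + 1))) \<partial>(surface_measure :: complex measure))"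
  proof (rule nn_integral_cong)
    fix \<theta> :: complex assume "\<theta> \<in> space surface_measure"
    then have "cmod \<theta> = 1" by simp
    then show "(\<integral>\<^sup>+r. ennreal (cmod (r *\<^sub>R \<theta>) ^ (2 * k) * exp (- t * (cmod (r *\<^sub>R \<theta>))\<^sup>2)) * ennreal (r ^ (DIM(complex) - 1)) * indicator {0<..} r \<partial>lborel)
      = ennreal (fact k / (2 * t ^ (k + 1)))"
      by (subst nn_integral_power_gaussian[OF t, symmetric], intro nn_integral_cong)
         (simp add: indicator_def mult_ac flip: ennreal_mult)
  qed
  also have "\<dots> = ennreal (fact k / (2 * t ^ (k + 1))) * ennreal (sphere_vol TYPE(complex))"
    by (simp only: nn_integral_const emeasure_surface_space)
  also have "sphere_vol TYPE(complex) = 2 * pi"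
    by (simp add: sphere_vol_eq eval_unit_ball_vol)
  finally show ?thesis using t by (simp add: mult_ac flip: ennreal_mult)
qed

lemma measurable_vec_nth [measurable]:
  "(\<lambda>z::'a::euclidean_space^'d::finite. z $ i) \<in> borel_measurable borel"
  by (intro borel_measurable_continuous_onI linear_continuous_on bounded_linear_vec_nth)

lemma nn_integral_power_times_exp_Ioi:
  assumes t: "c > 0"
  shows "(\<integral>\<^sup>+x. ennreal (x ^ k * exp (- c * x)) * indicator {0<..} x \<partial>lborel) = ennreal (fact k / c ^ (k + 1))"
proof -
  let ?g = "\<lambda>x. ennreal (x ^ k * exp (- x)) * indicator {0 ..} x"
  have "ennreal (real_of_nat (fact k)) = (\<integral>\<^sup>+x. ?g x \<partial>lborel)"
    by (subst nn_intergal_power_times_exp_Ici) simp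
  also have "\<dots> = ennreal \<bar>c\<bar> * (\<integral>\<^sup>+x. ?g (0 + c * x) \<partial>lborel)"
    by (rule nn_integral_real_affine) (use t in auto)
  also have "(\<integral>\<^sup>+x. ?g (0 + c * x) \<partial>lborel) =
     (\<integral>\<^sup>+x. ennreal (c ^ k) * (ennreal (x ^ k * exp (- c * x)) * indicator {0<..} x) \<partial>lborel)"
  proof (rule nn_integral_cong_AE)
    have "AE x in lborel. x \<noteq> (0::real)" by (rule AE_lborel_singleton)
    then show "AE x in lborel. ?g (0 + c * x) = ennreal (c ^ k) * (ennreal (x ^ k * exp (- c * x)) * indicator {0<..} x)"
    proof (rule eventually_mono)
      fix x :: real assume x: "x \<noteq> 0"
      show "?g (0 + c * x) = ennreal (c ^ k) * (ennreal (x ^ k * exp (- c * x)) * indicator {0<..} x)"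
      proof (cases "x > 0")
        case True
        have "ennreal (c ^ k) * ennreal (x ^ k * exp (- c * x)) = ennreal ((c * x) ^ k * exp (- (c * x)))"
          using True t by (subst ennreal_mult[symmetric]) (simp_all add: power_mult_distrib mult.assoc)
        then show ?thesis using True t by simp
      next
        case False
        then have "c * x < 0" using x t by (simp add: mult_pos_neg)
        then show ?thesis using False by simp
      qed
    qed
  qed
  also have "\<dots> = ennreal (c ^ k) * (\<integral>\<^sup>+x. ennreal (x ^ k * exp (- c * x)) * indicator {0<..} x \<partial>lborel)"
    by (rule nn_integral_cmult) simp
  also have "ennreal \<bar>c\<bar> * (ennreal (c ^ k) * I) = ennreal (c ^ (k + 1)) * I" for I
    using t by (simp add: ennreal_mult mult.assoc)
  finally have e: "ennreal (fact k) = ennreal (c ^ (k + 1)) * (\<integral>\<^sup>+x. ennreal (x ^ k * exp (- c * x)) * indicator {0<..} x \<partial>lborel)"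
    by simp
  have "ennreal (fact k / c ^ (k + 1)) = ennreal (1 / c ^ (k + 1)) * ennreal (fact k)"
    using t by (subst ennreal_mult[symmetric]) auto
  also have "\<dots> = (ennreal (1 / c ^ (k + 1)) * ennreal (c ^ (k + 1))) * (\<integral>\<^sup>+x. ennreal (x ^ k * exp (- c * x)) * indicator {0<..} x \<partial>lborel)"
    unfolding e by (simp only: mult.assoc)
  also have "ennreal (1 / c ^ (k + 1)) * ennreal (c ^ (k + 1)) = 1"
    using t by (subst ennreal_mult[symmetric]) auto
  finally show ?thesis by simp
qed

text \<open>The square of the \<open>L^2\<close> norm of the weighted monomial, as computed in
  \<open>nn_integral_weighted_monomial\<close>.\<close>

definition monomial_norm :: "nat \<Rightarrow> ('d::finite \<Rightarrow> nat) \<Rightarrow> real" where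
  "monomial_norm L \<alpha> = pi ^ CARD('d) * (\<Prod>i\<in>UNIV. fact (\<alpha> i)) * fact (L - sum \<alpha> UNIV) / fact (CARD('d) + L)"

lemma norm_sq_vec: "(norm (z :: complex ^ 'd::finite))\<^sup>2 = (\<Sum>i\<in>UNIV. (cmod (z $ i))\<^sup>2)"
  by (simp add: norm_vec_def L2_set_def sum_nonneg)

lemma cmod_weighted_monomial:
  fixes z :: "complex ^ 'd::finite"
  shows "(cmod (weighted_monomial L \<alpha> z))\<^sup>2 =
    (\<Prod>i\<in>UNIV. cmod (z $ i) ^ (2 * \<alpha> i)) / (1 + (norm z)\<^sup>2) ^ (CARD('d) + L + 1)"
proof -
  have p: "1 + (norm z)\<^sup>2 > 0" by (simp add: add_pos_nonneg)
  have "((1 + (norm z)\<^sup>2) powr ((real CARD('d) + real L + 1) / 2))\<^sup>2 = (1 + (norm z)\<^sup>2) powr real (CARD('d) + L + 1)"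
    using p by (simp add: power2_eq_square powr_add[symmetric] add_ac)
  also have "\<dots> = (1 + (norm z)\<^sup>2) ^ (CARD('d) + L + 1)" using p by (rule powr_realpow)
  finally have e: "((1 + (norm z)\<^sup>2) powr ((real CARD('d) + real L + 1) / 2))\<^sup>2 = (1 + (norm z)\<^sup>2) ^ (CARD('d) + L + 1)" .
  have "(cmod (weighted_monomial L \<alpha> z))\<^sup>2 = (\<Prod>i\<in>UNIV. cmod (z $ i) ^ \<alpha> i)\<^sup>2 / ((1 + (norm z)\<^sup>2) powr ((real CARD('d) + real L + 1) / 2))\<^sup>2"
    unfolding weighted_monomial_def norm_divide norm_of_real power2_abs power_divide
    by (simp add: prod_norm[symmetric] norm_power)
  also have "(\<Prod>i\<in>UNIV. cmod (z $ i) ^ \<alpha> i)\<^sup>2 = (\<Prod>i\<in>UNIV. cmod (z $ i) ^ (2 * \<alpha> i))"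
    by (simp add: prod_power_distrib power_mult[symmetric] mult.commute)
  finally show ?thesis unfolding e .
qed

lemma weighted_monomial_measurable [measurable]:
  "(weighted_monomial L \<alpha> :: complex ^ 'd::finite \<Rightarrow> complex) \<in> borel_measurable borel"
  unfolding weighted_monomial_def[abs_def] by measurable

text \<open>With \<open>M = d + L\<close>, the weight \<open>1 / (1 + |z|^2) ^ (M + 1)\<close> is
  \<open>1 / M!\<close> times the integral of \<open>t ^ M * exp (- (1 + |z|^2) * t)\<close> over
  positive t. After exchanging the integrals, the Gaussian in z factors over the coordinates, and a
  Gamma integral in t remains.\<close>

lemma nn_integral_weighted_monomial:
  fixes \<alpha> :: "'d::finite \<Rightarrow> nat"
  assumes \<alpha>: "sum \<alpha> UNIV \<le> L"
  shows "(\<integral>\<^sup>+z. ennreal ((cmod (weighted_monomial L \<alpha> z))\<^sup>2) \<partial>lborel) = ennreal (monomial_norm L \<alpha>)"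
proof -
  let ?d = "CARD('d)"
  define M where "M = ?d + L"
  let ?n = "sum \<alpha> UNIV"
  define R where "R = pi ^ ?d * (\<Prod>i\<in>UNIV. fact (\<alpha> i) :: real)"
  have R: "R \<ge> 0" unfolding R_def by (intro mult_nonneg_nonneg prod_nonneg) auto
  let ?G = "\<lambda>(z::complex^'d) t. ennreal (1 / fact M * (\<Prod>i\<in>UNIV. cmod (z $ i) ^ (2 * \<alpha> i)) * (t ^ M * exp (- (1 + (norm z)\<^sup>2) * t))) * indicator {0<..} t"
  have "(\<integral>\<^sup>+z. ennreal ((cmod (weighted_monomial L \<alpha> z))\<^sup>2) \<partial>lborel) = (\<integral>\<^sup>+z. (\<integral>\<^sup>+t. ?G z t \<partial>lborel) \<partial>lborel)"
  proof (rule nn_integral_cong)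
    fix z :: "complex ^ 'd"
    define P where "P = (\<Prod>i\<in>UNIV. cmod (z $ i) ^ (2 * \<alpha> i))"
    have P: "P \<ge> 0" unfolding P_def by (intro prod_nonneg) auto
    have p: "1 + (norm z)\<^sup>2 > 0" by (simp add: add_pos_nonneg)
    have "(\<integral>\<^sup>+t. ?G z t \<partial>lborel) = (\<integral>\<^sup>+t. ennreal (1 / fact M * P) * (ennreal (t ^ M * exp (- (1 + (norm z)\<^sup>2) * t)) * indicator {0<..} t) \<partial>lborel)"
    proof (rule nn_integral_cong)
      fix t :: real
      have "ennreal (1 / fact M * P * X) = ennreal (1 / fact M * P) * ennreal X" if "X \<ge> 0" for X
        using P that by (intro ennreal_mult) auto
      then show "?G z t = ennreal (1 / fact M * P) * (ennreal (t ^ M * exp (- (1 + (norm z)\<^sup>2) * t)) * indicator {0<..} t)"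
        unfolding P_def[symmetric] by (cases "t > 0") simp_all
    qed
    also have "\<dots> = ennreal (1 / fact M * P) * ennreal (fact M / (1 + (norm z)\<^sup>2) ^ (M + 1))"
      by (subst nn_integral_cmult, simp, subst nn_integral_power_times_exp_Ioi[OF p]) simp
    also have "\<dots> = ennreal ((cmod (weighted_monomial L \<alpha> z))\<^sup>2)"
      unfolding cmod_weighted_monomial P_def[symmetric] M_def[symmetric] using P p
      by (subst ennreal_mult[symmetric]) auto
    finally show "ennreal ((cmod (weighted_monomial L \<alpha> z))\<^sup>2) = (\<integral>\<^sup>+t. ?G z t \<partial>lborel)" ..
  qed
  also have "\<dots> = (\<integral>\<^sup>+t. (\<integral>\<^sup>+z. ?G z t \<partial>lborel) \<partial>lborel)"
    by (rule lborel_pair.Fubini') measurable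
  also have "\<dots> = (\<integral>\<^sup>+t. ennreal (R / fact M) * (ennreal (t ^ (L - ?n) * exp (- 1 * t)) * indicator {0<..} t) \<partial>lborel)"
  proof (rule nn_integral_cong)
    fix t :: real
    show "(\<integral>\<^sup>+z. ?G z t \<partial>lborel) = ennreal (R / fact M) * (ennreal (t ^ (L - ?n) * exp (- 1 * t)) * indicator {0<..} t)"
    proof (cases "t > 0")
      case True
      have "(\<integral>\<^sup>+z. ?G z t \<partial>lborel) = (\<integral>\<^sup>+z. ennreal (1 / fact M * t ^ M * exp (- t)) *
         (\<Prod>i\<in>UNIV. ennreal (cmod (z $ i) ^ (2 * \<alpha> i) * exp (- t * (cmod (z $ i))\<^sup>2))) \<partial>(lborel :: (complex ^ 'd) measure))"
      proof (rule nn_integral_cong)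
        fix z :: "complex ^ 'd"
        have "exp (- (1 + (norm z)\<^sup>2) * t) = exp (- t) * (\<Prod>i\<in>UNIV. exp (- t * (cmod (z $ i))\<^sup>2))"
          unfolding norm_sq_vec by (simp add: exp_sum[symmetric] sum_negf sum_distrib_left mult_exp_exp algebra_simps)
        then have "1 / fact M * (\<Prod>i\<in>UNIV. cmod (z $ i) ^ (2 * \<alpha> i)) * (t ^ M * exp (- (1 + (norm z)\<^sup>2) * t)) =
           (1 / fact M * t ^ M * exp (- t)) * (\<Prod>i\<in>UNIV. cmod (z $ i) ^ (2 * \<alpha> i) * exp (- t * (cmod (z $ i))\<^sup>2))"
          by (simp add: prod.distrib)
        then have "?G z t = ennreal ((1 / fact M * t ^ M * exp (- t)) * (\<Prod>i\<in>UNIV. cmod (z $ i) ^ (2 * \<alpha> i) * exp (- t * (cmod (z $ i))\<^sup>2)))"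
          using True by (simp only: indicator_simps greaterThan_iff mult_1_right)
        also have "\<dots> = ennreal (1 / fact M * t ^ M * exp (- t)) * ennreal (\<Prod>i\<in>UNIV. cmod (z $ i) ^ (2 * \<alpha> i) * exp (- t * (cmod (z $ i))\<^sup>2))"
          using True by (intro ennreal_mult prod_nonneg) auto
        finally show "?G z t = ennreal (1 / fact M * t ^ M * exp (- t)) *
           (\<Prod>i\<in>UNIV. ennreal (cmod (z $ i) ^ (2 * \<alpha> i) * exp (- t * (cmod (z $ i))\<^sup>2)))"
          by (subst prod_ennreal) simp_all
      qed
      also have "\<dots> = ennreal (1 / fact M * t ^ M * exp (- t)) *
         (\<integral>\<^sup>+z. (\<Prod>i\<in>UNIV. ennreal (cmod (z $ i) ^ (2 * \<alpha> i) * exp (- t * (cmod (z $ i))\<^sup>2))) \<partial>(lborel :: (complex ^ 'd) measure))"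
        by (rule nn_integral_cmult) measurable
      also have "(\<integral>\<^sup>+z. (\<Prod>i\<in>UNIV. ennreal (cmod (z $ i) ^ (2 * \<alpha> i) * exp (- t * (cmod (z $ i))\<^sup>2))) \<partial>(lborel :: (complex ^ 'd) measure)) =
        (\<Prod>i\<in>(UNIV :: 'd set). ennreal (pi * fact (\<alpha> i) / t ^ (\<alpha> i + 1)))"
        by (subst nn_integral_vec_prod[where f = "\<lambda>i x. ennreal (cmod x ^ (2 * \<alpha> i) * exp (- t * (cmod x)\<^sup>2))"])
           (simp_all only: nn_integral_complex_gaussian[OF True], simp)
      also have "\<dots> = ennreal (\<Prod>i\<in>(UNIV :: 'd set). pi * fact (\<alpha> i) / t ^ (\<alpha> i + 1))"
        using True by (intro prod_ennreal) auto
      also have "(\<Prod>i\<in>(UNIV :: 'd set). pi * fact (\<alpha> i) / t ^ (\<alpha> i + 1)) = R / t ^ (?n + ?d)"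
        by (simp add: prod_dividef prod.distrib R_def power_add power_sum mult.commute)
      also have "ennreal (1 / fact M * t ^ M * exp (- t)) * ennreal (R / t ^ (?n + ?d)) = ennreal (R / fact M) * ennreal (t ^ (L - ?n) * exp (- 1 * t))"
      proof -
        \<comment> \<open>The natural-number subtraction is exact because the degree is at most L;
          this is where the degree bound enters.\<close>
        have "M = (L - ?n) + (?n + ?d)" using \<alpha> by (simp add: M_def)
        then have "t ^ M = t ^ (L - ?n) * t ^ (?n + ?d)" by (metis power_add)
        then have "1 / fact M * t ^ M * exp (- t) * (R / t ^ (?n + ?d)) = R / fact M * (t ^ (L - ?n) * exp (- 1 * t))"
          using True by simp
        then show ?thesis using True R by (subst (1 2) ennreal_mult[symmetric]) auto
      qed
      finally show ?thesis using True by simp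
    qed simp
  qed
  also have "\<dots> = ennreal (R / fact M) * ennreal (fact (L - ?n) / 1 ^ (L - ?n + 1))"
    by (subst nn_integral_cmult, simp, subst nn_integral_power_times_exp_Ioi) simp_all
  also have "\<dots> = ennreal (monomial_norm L \<alpha>)"
    unfolding monomial_norm_def R_def[symmetric] M_def[symmetric] using R by (subst ennreal_mult[symmetric]) auto
  finally show ?thesis .
qed

lemma monomial_norm_pos: "monomial_norm L \<alpha> > 0"
  unfolding monomial_norm_def by (intro mult_pos_pos divide_pos_pos prod_pos) auto

lemma borel_measurable_cnj [measurable (raw)]:
  "f \<in> borel_measurable M \<Longrightarrow> (\<lambda>x. cnj (f x)) \<in> borel_measurable M"
  by (rule measurable_compose[of f M borel cnj]) (auto intro!: borel_measurable_continuous_onI continuous_intros)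

lemma monomial_norm_nz: "monomial_norm L \<alpha> \<noteq> 0"
  using monomial_norm_pos[of L \<alpha>] by simp

lemma integrable_weighted_monomial_sq:
  assumes "sum \<alpha> UNIV \<le> L"
  shows "integrable lborel (\<lambda>z::complex^'d::finite. (cmod (weighted_monomial L \<alpha> z))\<^sup>2)"
  by (rule integrableI_nn_integral_finite[OF _ _ nn_integral_weighted_monomial[OF assms]])
     (auto simp: monomial_norm_pos less_imp_le)

lemma integral_weighted_monomial_sq:
  assumes "sum \<alpha> UNIV \<le> L"
  shows "(\<integral>(z::complex^'d::finite). (cmod (weighted_monomial L \<alpha> z))\<^sup>2 \<partial>lborel) = monomial_norm L \<alpha>"
  using nn_integral_weighted_monomial[OF assms] integrable_weighted_monomial_sq[OF assms]
    monomial_norm_pos[of L \<alpha>]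
  by (subst (asm) nn_integral_eq_integral) auto

lemma integrable_weighted_monomial_prod:
  assumes "sum \<alpha> UNIV \<le> L" "sum \<beta> UNIV \<le> L"
  shows "integrable lborel (\<lambda>z::complex^'d::finite. weighted_monomial L \<alpha> z * cnj (weighted_monomial L \<beta> z))"
proof (rule Bochner_Integration.integrable_bound)
  show "integrable lborel (\<lambda>z::complex^'d::finite. (cmod (weighted_monomial L \<alpha> z))\<^sup>2 + (cmod (weighted_monomial L \<beta> z))\<^sup>2)"
    using assms by (intro Bochner_Integration.integrable_add integrable_weighted_monomial_sq)
  have ab: "a * b \<le> a\<^sup>2 + b\<^sup>2" if "0 \<le> a" "0 \<le> b" for a b :: real
  proof -
    have "0 \<le> (a - b)\<^sup>2" by simp
    then have "2 * (a * b) \<le> a\<^sup>2 + b\<^sup>2" by (simp add: power2_eq_square algebra_simps)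
    moreover have "0 \<le> a * b" using that by simp
    ultimately show ?thesis by linarith
  qed
  show "AE z in lborel. norm (weighted_monomial L \<alpha> (z :: complex^'d) * cnj (weighted_monomial L \<beta> z))
      \<le> norm ((cmod (weighted_monomial L \<alpha> z))\<^sup>2 + (cmod (weighted_monomial L \<beta> z))\<^sup>2)"
    by (rule AE_I2) (simp add: norm_mult ab)
qed simp

section \<open>Orthogonality and the reproducing kernel\<close>

definition rotate_coord :: "'d::finite \<Rightarrow> complex \<Rightarrow> complex ^ 'd \<Rightarrow> complex ^ 'd" where
  "rotate_coord i c z = (\<chi> j. if j = i then c * z $ j else z $ j)"

lemma linear_rotate_coord: "linear (rotate_coord i c)"
  by (rule linearI) (auto simp: rotate_coord_def vec_eq_iff algebra_simps)

lemma norm_rotate_coord: "cmod c = 1 \<Longrightarrow> norm (rotate_coord i c z) = norm z"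
  unfolding norm_vec_def L2_set_def
  by (intro arg_cong[where f = sqrt] sum.cong refl) (simp add: rotate_coord_def norm_mult)

lemma weighted_monomial_rotate_coord:
  assumes "cmod c = 1"
  shows "weighted_monomial L \<alpha> (rotate_coord i c z) = c ^ \<alpha> i * weighted_monomial L \<alpha> z"
proof -
  have "(\<Prod>j\<in>UNIV. (rotate_coord i c z $ j) ^ \<alpha> j) = (\<Prod>j\<in>UNIV. (if j = i then c ^ \<alpha> j else 1) * (z $ j) ^ \<alpha> j)"
    by (intro prod.cong refl) (simp add: rotate_coord_def power_mult_distrib)
  also have "\<dots> = c ^ \<alpha> i * (\<Prod>j\<in>UNIV. (z $ j) ^ \<alpha> j)"
    by (simp add: prod.distrib)
  finally show ?thesis by (simp add: weighted_monomial_def norm_rotate_coord[OF assms])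
qed

text \<open>Multiplying one coordinate by a phase preserves Lebesgue measure. In a coordinate where
  the exponents differ, the phase is chosen so that the integrand is multiplied by -1; the integral
  then equals its own negative.\<close>

lemma integral_weighted_monomial_prod:
  fixes \<alpha> \<beta> :: "'d::finite \<Rightarrow> nat"
  assumes "sum \<alpha> UNIV \<le> L" "sum \<beta> UNIV \<le> L"
  shows "(\<integral>z. weighted_monomial L \<alpha> z * cnj (weighted_monomial L \<beta> z) \<partial>lborel) =
    (if \<alpha> = \<beta> then complex_of_real (monomial_norm L \<alpha>) else 0)"
proof (cases "\<alpha> = \<beta>")
  case True
  then have "(\<integral>z. weighted_monomial L \<alpha> z * cnj (weighted_monomial L \<beta> z) \<partial>lborel) =
     (\<integral>(z::complex^'d). complex_of_real ((cmod (weighted_monomial L \<alpha> z))\<^sup>2) \<partial>lborel)"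
    by (intro Bochner_Integration.integral_cong refl) (simp only: complex_norm_square)
  then show ?thesis using True integral_weighted_monomial_sq[OF assms(1)] by (simp del: of_real_power add: integral_complex_of_real)
next
  case False
  then obtain i where i: "\<alpha> i \<noteq> \<beta> i" by auto
  \<comment> \<open>Real copies of the exponents, since their difference, by which the angle pi is
    divided, may be negative.\<close>
  define a b where "a = real (\<alpha> i)" and "b = real (\<beta> i)"
  have ab: "a \<noteq> b" using i by (simp add: a_def b_def)
  define c where "c = cis (pi / (a - b))"
  have c: "cmod c = 1" by (simp add: c_def)
  have "c ^ \<alpha> i * cnj (c ^ \<beta> i) = cis (a * (pi / (a - b)) + - (b * (pi / (a - b))))"
    by (simp only: c_def a_def b_def Complex.DeMoivre cis_cnj cis_mult)
  also have "a * (pi / (a - b)) + - (b * (pi / (a - b))) = (a - b) * (pi / (a - b))" by (simp add: left_diff_distrib diff_divide_distrib)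
  also have "\<dots> = pi" using ab by simp
  finally have cc: "c ^ \<alpha> i * cnj (c ^ \<beta> i) = -1" by simp
  let ?F = "\<lambda>z::complex^'d. weighted_monomial L \<alpha> z * cnj (weighted_monomial L \<beta> z)"
  have [measurable]: "rotate_coord i c \<in> borel_measurable borel"
    by (intro borel_measurable_continuous_onI linear_continuous_on linear_conv_bounded_linear[THEN iffD1] linear_rotate_coord)
  have "(\<integral>z. ?F z \<partial>lborel) = (\<integral>z. ?F z \<partial>(distr lborel borel (rotate_coord i c)))"
    by (subst lborel_isometry[OF linear_rotate_coord norm_rotate_coord[OF c]]) (rule refl)
  also have "\<dots> = (\<integral>z. ?F (rotate_coord i c z) \<partial>lborel)"
    by (rule integral_distr) auto
  also have "\<dots> = (\<integral>z. (c ^ \<alpha> i * cnj (c ^ \<beta> i)) * ?F z \<partial>lborel)"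
    by (simp add: weighted_monomial_rotate_coord[OF c] mult_ac)
  also have "\<dots> = - (\<integral>z. ?F z \<partial>lborel)" unfolding cc by simp
  finally show ?thesis using False by simp
qed

text \<open>The usual sum of \<open>e(z) * cnj (e(w))\<close> over an orthonormal basis, here the
  normalized weighted monomials.\<close>

definition proj_kernel :: "nat \<Rightarrow> complex ^ 'd::finite \<Rightarrow> complex ^ 'd \<Rightarrow> complex" where
  "proj_kernel L z w = (\<Sum>\<alpha> | sum \<alpha> UNIV \<le> L.
     weighted_monomial L \<alpha> z * cnj (weighted_monomial L \<alpha> w) / complex_of_real (monomial_norm L \<alpha>))"

lemma finite_multi_indices: "finite {\<alpha> :: 'd::finite \<Rightarrow> nat. sum \<alpha> UNIV \<le> L}"
  using finite_multi_index[of "UNIV :: 'd set" L] by (simp add: multi_index_def)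

lemma proj_kernel_in_space: "(\<lambda>z. proj_kernel L z w) \<in> weighted_poly_space L"
  unfolding weighted_poly_space_def proj_kernel_def
  by (intro CollectI exI[of _ "\<lambda>\<alpha>. cnj (weighted_monomial L \<alpha> w) / complex_of_real (monomial_norm L \<alpha>)"])
     (simp add: mult_ac)

lemma proj_kernel_herm: "cnj (proj_kernel L z w) = proj_kernel L w z"
  by (simp add: proj_kernel_def mult.commute)

lemma proj_kernel_reproducing:
  fixes f :: "complex ^ 'd::finite \<Rightarrow> complex"
  assumes f: "f \<in> weighted_poly_space L"
  shows "f w = (\<integral>z. f z * cnj (proj_kernel L z w) \<partial>lborel)"
proof -
  let ?I = "{\<alpha> :: 'd \<Rightarrow> nat. sum \<alpha> UNIV \<le> L}"
  let ?m = "weighted_monomial L"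
  obtain c where c: "f = (\<lambda>z. \<Sum>\<beta>\<in>?I. c \<beta> * ?m \<beta> z)"
    using f by (auto simp: weighted_poly_space_def)
  let ?k = "\<lambda>\<alpha> \<beta>. c \<beta> * (?m \<alpha> w / complex_of_real (monomial_norm L \<alpha>))"
  have "(\<integral>z. f z * cnj (proj_kernel L z w) \<partial>lborel) =
     (\<integral>z. (\<Sum>\<beta>\<in>?I. \<Sum>\<alpha>\<in>?I. ?k \<alpha> \<beta> * (?m \<beta> z * cnj (?m \<alpha> z))) \<partial>lborel)"
    unfolding c proj_kernel_def
    by (intro Bochner_Integration.integral_cong refl) (simp add: sum_product mult_ac)
  also have "\<dots> = (\<Sum>\<beta>\<in>?I. \<Sum>\<alpha>\<in>?I. ?k \<alpha> \<beta> * (\<integral>z. ?m \<beta> z * cnj (?m \<alpha> z) \<partial>lborel))"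
  proof -
    have int: "integrable lborel (\<lambda>z. ?k \<alpha> \<beta> * (?m \<beta> z * cnj (?m \<alpha> z)))" if "\<alpha> \<in> ?I" "\<beta> \<in> ?I" for \<alpha> \<beta>
      using that by (intro Bochner_Integration.integrable_mult_right integrable_weighted_monomial_prod) auto
    have "(\<integral>z. (\<Sum>\<beta>\<in>?I. \<Sum>\<alpha>\<in>?I. ?k \<alpha> \<beta> * (?m \<beta> z * cnj (?m \<alpha> z))) \<partial>lborel) =
      (\<Sum>\<beta>\<in>?I. (\<integral>z. (\<Sum>\<alpha>\<in>?I. ?k \<alpha> \<beta> * (?m \<beta> z * cnj (?m \<alpha> z))) \<partial>lborel))"
      by (rule Bochner_Integration.integral_sum) (intro Bochner_Integration.integrable_sum int)
    also have "\<dots> = (\<Sum>\<beta>\<in>?I. \<Sum>\<alpha>\<in>?I. (\<integral>z. ?k \<alpha> \<beta> * (?m \<beta> z * cnj (?m \<alpha> z)) \<partial>lborel))"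
      by (intro sum.cong refl Bochner_Integration.integral_sum int)
    also have "\<dots> = (\<Sum>\<beta>\<in>?I. \<Sum>\<alpha>\<in>?I. ?k \<alpha> \<beta> * (\<integral>z. ?m \<beta> z * cnj (?m \<alpha> z) \<partial>lborel))"
      by (simp only: Bochner_Integration.integral_mult_right_zero)
    finally show ?thesis .
  qed
  also have "\<dots> = (\<Sum>\<beta>\<in>?I. \<Sum>\<alpha>\<in>?I. (if \<beta> = \<alpha> then ?k \<alpha> \<beta> * complex_of_real (monomial_norm L \<alpha>) else 0))"
    by (intro sum.cong refl) (simp add: integral_weighted_monomial_prod)
  also have "\<dots> = (\<Sum>\<beta>\<in>?I. ?k \<beta> \<beta> * complex_of_real (monomial_norm L \<beta>))"
    by (intro sum.cong refl) (simp add: finite_multi_indices)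
  also have "\<dots> = f w"
    unfolding c by (intro sum.cong refl) (simp add: monomial_norm_nz)
  finally show ?thesis ..
qed

text \<open>Each kernel reproduces the sections of the other; comparing the two evaluations after
  conjugation identifies them at every pair of points, since the space consists of genuine
  functions.\<close>

lemma reproducing_kernel_unique:
  fixes K :: "complex ^ 'd::finite \<Rightarrow> complex ^ 'd \<Rightarrow> complex"
  assumes K: "reproducing_kernel lborel (weighted_poly_space L) K"
  shows "K v w = proj_kernel L v w"
proof -
  have KH: "(\<lambda>z. K z w) \<in> weighted_poly_space L"
    and rep: "f w = (\<integral>z. f z * cnj (K z w) \<partial>lborel)" if "f \<in> weighted_poly_space L" for f
    using K that by (auto simp: reproducing_kernel_def)
  have KH: "(\<lambda>z. K z w) \<in> weighted_poly_space L"
    using K by (auto simp: reproducing_kernel_def)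
  have "proj_kernel L w v = (\<integral>z. proj_kernel L z v * cnj (K z w) \<partial>lborel)"
    by (rule rep[OF proj_kernel_in_space])
  then have "cnj (proj_kernel L w v) = (\<integral>z. cnj (proj_kernel L z v * cnj (K z w)) \<partial>lborel)"
    by (simp only: Bochner_Integration.integral_cnj)
  also have "\<dots> = (\<integral>z. K z w * cnj (proj_kernel L z v) \<partial>lborel)"
    by (simp add: mult.commute)
  also have "\<dots> = K v w" by (rule proj_kernel_reproducing[OF KH, symmetric])
  finally show ?thesis by (simp add: proj_kernel_herm)
qed

text \<open>Up to a common factor the coefficients \<open>1 / monomial_norm L \<alpha>\<close> are
  the multinomial coefficients in the expansion of \<open>(1 + herm z w) ^ L\<close>.\<close>

lemma proj_kernel_eq:
  fixes z w :: "complex ^ 'd::finite"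
  shows "proj_kernel L z w = complex_of_real (fact (CARD('d) + L) / (fact L * pi ^ CARD('d))) * (1 + herm z w) ^ L /
    complex_of_real ((1 + (norm z)\<^sup>2) powr ((real CARD('d) + real L + 1) / 2) * (1 + (norm w)\<^sup>2) powr ((real CARD('d) + real L + 1) / 2))"
proof -
  let ?e = "(real CARD('d) + real L + 1) / 2"
  define a b where "a = complex_of_real ((1 + (norm z)\<^sup>2) powr ?e)" and "b = complex_of_real ((1 + (norm w)\<^sup>2) powr ?e)"
  define C where "C = complex_of_real (fact (CARD('d) + L) / (fact L * pi ^ CARD('d)))"
  have I: "multi_index UNIV L = {\<alpha> :: 'd \<Rightarrow> nat. sum \<alpha> UNIV \<le> L}" by (simp add: multi_index_def)
  have "C * (1 + herm z w) ^ L / (a * b) = (\<Sum>\<alpha> | sum \<alpha> UNIV \<le> L. C / (a * b) *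
     (fact L / (fact (L - sum \<alpha> UNIV) * (\<Prod>i\<in>UNIV. fact (\<alpha> i))) * (\<Prod>i\<in>UNIV. (z $ i * cnj (w $ i)) ^ \<alpha> i)))"
    unfolding herm_def by (subst multinomial_theorem) (simp_all add: I sum_distrib_left sum_divide_distrib mult_ac)
  also have "\<dots> = proj_kernel L z w"
    unfolding proj_kernel_def
  proof (rule sum.cong[OF refl])
    fix \<alpha> :: "'d \<Rightarrow> nat"
    define p where "p = (\<Prod>i\<in>UNIV. fact (\<alpha> i) :: real)"
    have p: "p > 0" unfolding p_def by (intro prod_pos) auto
    have pc: "(\<Prod>i\<in>UNIV. fact (\<alpha> i)) = complex_of_real p" by (simp add: p_def)
    have mn: "monomial_norm L \<alpha> = pi ^ CARD('d) * p * fact (L - sum \<alpha> UNIV) / fact (CARD('d) + L)"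
      by (simp add: monomial_norm_def p_def)
    have "C * (fact L / (fact (L - sum \<alpha> UNIV) * complex_of_real p)) = 1 / complex_of_real (monomial_norm L \<alpha>)"
      unfolding mn C_def by (simp add: field_simps)
    moreover have "weighted_monomial L \<alpha> z * cnj (weighted_monomial L \<alpha> w) = (\<Prod>i\<in>UNIV. (z $ i * cnj (w $ i)) ^ \<alpha> i) / (a * b)"
      by (simp add: weighted_monomial_def a_def b_def prod.distrib power_mult_distrib)
    moreover have "C / (a * b) * (fact L / (fact (L - sum \<alpha> UNIV) * complex_of_real p) * (\<Prod>i\<in>UNIV. (z $ i * cnj (w $ i)) ^ \<alpha> i))
      = C * (fact L / (fact (L - sum \<alpha> UNIV) * complex_of_real p)) * ((\<Prod>i\<in>UNIV. (z $ i * cnj (w $ i)) ^ \<alpha> i) / (a * b))"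
      by (simp add: mult_ac)
    ultimately show "C / (a * b) * (fact L / (fact (L - sum \<alpha> UNIV) * (\<Prod>i\<in>UNIV. fact (\<alpha> i))) * (\<Prod>i\<in>UNIV. (z $ i * cnj (w $ i)) ^ \<alpha> i))
      = weighted_monomial L \<alpha> z * cnj (weighted_monomial L \<alpha> w) / complex_of_real (monomial_norm L \<alpha>)"
      unfolding pc by simp
  qed
  finally show ?thesis unfolding a_def b_def C_def by simp
qed

text \<open>Isolates the L-th power of the squared cosine of the Fubini-Study distance from the
  densities that are transported to the sphere.\<close>

lemma cmod_proj_kernel_sq:
  fixes z w :: "complex ^ 'd::finite"
  shows "(cmod (proj_kernel L z w))\<^sup>2 = (real ((CARD('d) + L) choose CARD('d)))\<^sup>2 * fs_density z * fs_density w *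
    ((cmod (1 + herm z w))\<^sup>2 / ((1 + (norm z)\<^sup>2) * (1 + (norm w)\<^sup>2))) ^ L"
proof -
  let ?d = "CARD('d)"
  let ?e = "(real ?d + real L + 1) / 2"
  define N where "N = real ((?d + L) choose ?d)"
  have N: "N = fact (?d + L) / (fact ?d * fact L)" unfolding N_def by (subst binomial_fact) auto
  have pw: "(x powr ?e)\<^sup>2 = x ^ (?d + 1) * x ^ L" if "x > 0" for x :: real
  proof -
    have "(x powr ?e)\<^sup>2 = x powr real (?d + 1 + L)"
      using that by (simp add: power2_eq_square powr_add[symmetric] add_ac)
    also have "\<dots> = x ^ (?d + 1 + L)" using that by (rule powr_realpow)
    finally show ?thesis by (simp only: power_add)
  qed
  define x y where "x = 1 + (norm z)\<^sup>2" and "y = 1 + (norm w)\<^sup>2"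
  have xy: "x > 0" "y > 0" by (simp_all add: x_def y_def add_pos_nonneg)
  have C: "fact (?d + L) / (fact L * pi ^ ?d) = N * (fact ?d / pi ^ ?d)" by (simp add: N)
  have "(cmod (proj_kernel L z w))\<^sup>2 = (N * (fact ?d / pi ^ ?d) * cmod (1 + herm z w) ^ L / (x powr ?e * y powr ?e))\<^sup>2"
    unfolding proj_kernel_eq C x_def[symmetric] y_def[symmetric] norm_divide norm_mult norm_of_real norm_power
    by (simp add: power_divide power_mult_distrib)
  also have "\<dots> = (N * (fact ?d / pi ^ ?d))\<^sup>2 * (cmod (1 + herm z w) ^ L)\<^sup>2 / ((x ^ (?d + 1) * x ^ L) * (y ^ (?d + 1) * y ^ L))"
    by (simp only: power_divide power_mult_distrib[of _ "cmod (1 + herm z w) ^ L"] power_mult_distrib[of "x powr ?e"] pw[OF xy(1)] pw[OF xy(2)])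
  also have "\<dots> = N\<^sup>2 * (fact ?d / pi ^ ?d / x ^ (?d + 1)) * (fact ?d / pi ^ ?d / y ^ (?d + 1)) * ((cmod (1 + herm z w))\<^sup>2 / (x * y)) ^ L"
    using xy by (simp add: power_divide power_mult_distrib power2_eq_square mult_ac)
  finally show ?thesis by (simp only: N_def fs_density_def x_def y_def)
qed

text \<open>On the diagonal the kernel is real and nonnegative, hence equal to its modulus, and the
  squared cosine is 1.\<close>

lemma proj_kernel_diag:
  fixes z :: "complex ^ 'd::finite"
  shows "proj_kernel L z z = complex_of_real (real ((CARD('d) + L) choose CARD('d)) * fs_density z)"
proof -
  let ?N = "real ((CARD('d) + L) choose CARD('d))"
  have h: "1 + herm z z = complex_of_real (1 + (norm z)\<^sup>2)"
    by (simp add: herm_def norm_sq_vec complex_norm_square[symmetric])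
  have p: "1 + (norm z)\<^sup>2 > 0" by (simp add: add_pos_nonneg)
  have "proj_kernel L z z = complex_of_real (Re (proj_kernel L z z))" "Re (proj_kernel L z z) \<ge> 0"
    unfolding proj_kernel_eq h of_real_power[symmetric] of_real_mult[symmetric] of_real_divide[symmetric] Re_complex_of_real
    using p by auto
  then have e: "proj_kernel L z z = complex_of_real (cmod (proj_kernel L z z))"
    by (metis abs_of_nonneg norm_of_real)
  have "cmod (1 + herm z z) = 1 + (norm z)\<^sup>2" unfolding h norm_of_real using p by simp
  then have "(cmod (proj_kernel L z z))\<^sup>2 = (?N * fs_density z)\<^sup>2"
    unfolding cmod_proj_kernel_sq using p by (simp add: power2_eq_square)
  then have "cmod (proj_kernel L z z) = ?N * fs_density z"
    using fs_density_nonneg[of z] by (simp add: power2_eq_iff_nonneg)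
  then show ?thesis using e by simp
qed

section \<open>Expected pair sums of determinantal processes\<close>

text \<open>The signature of x with respect to the first n sets. Points with equal signature form
  one cell of a finite partition, and the partitions refine as n grows.\<close>

definition cell :: "(nat \<Rightarrow> 'a set) \<Rightarrow> nat \<Rightarrow> 'a \<Rightarrow> nat set" where
  "cell B n x = {i. i < n \<and> x \<in> B i}"

lemma cell_mono: "cell B m x = cell B m y" if "cell B n x = cell B n y" "m \<le> n"
proof -
  have "cell B m x = {i \<in> cell B n x. i < m}" for x
    using \<open>m \<le> n\<close> by (auto simp: cell_def)
  then show ?thesis using that by simp
qed

lemma cell_eq_mem: "cell B n x = cell B n y \<Longrightarrow> i < n \<Longrightarrow> x \<in> B i \<Longrightarrow> y \<in> B i"
  unfolding cell_def set_eq_iff by auto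

text \<open>Lower step approximation of \<open>h\<close> on pairs of distinct cells.\<close>

definition cell_inf :: "(nat \<Rightarrow> 'a set) \<Rightarrow> ('a \<Rightarrow> 'a \<Rightarrow> ennreal) \<Rightarrow> nat \<Rightarrow> nat set \<Rightarrow> nat set \<Rightarrow> ennreal" where
  "cell_inf B h n I J = (if I = J then 0 else (INF p\<in>{(x, y). cell B n x = I \<and> cell B n y = J}. h (fst p) (snd p)))"

definition cell_approx :: "(nat \<Rightarrow> 'a set) \<Rightarrow> ('a \<Rightarrow> 'a \<Rightarrow> ennreal) \<Rightarrow> nat \<Rightarrow> 'a \<Rightarrow> 'a \<Rightarrow> ennreal" where
  "cell_approx B h n x y = cell_inf B h n (cell B n x) (cell B n y)"

lemma cell_approx_le: "x \<noteq> y \<Longrightarrow> cell_approx B h n x y \<le> h x y"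
  unfolding cell_approx_def cell_inf_def by (auto intro!: INF_lower2[of "(x, y)"])

lemma cell_approx_diag [simp]: "cell_approx B h n x x = 0"
  by (simp add: cell_approx_def cell_inf_def)

text \<open>Once two points are separated they stay separated, and finer cells take the infimum over
  smaller sets.\<close>

lemma cell_approx_incseq: "incseq (\<lambda>n. cell_approx B h n x y)"
proof (rule incseq_SucI)
  fix n
  show "cell_approx B h n x y \<le> cell_approx B h (Suc n) x y"
  proof (cases "cell B n x = cell B n y")
    case True
    then show ?thesis by (simp add: cell_approx_def cell_inf_def)
  next
    case False
    then have "cell B (Suc n) x \<noteq> cell B (Suc n) y" using cell_mono[of B "Suc n" x y n] by auto
    moreover have "cell B n a = cell B n x" if "cell B (Suc n) a = cell B (Suc n) x" for a x
      using that by (rule cell_mono) simp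
    then have "{(a, b). cell B (Suc n) a = cell B (Suc n) x \<and> cell B (Suc n) b = cell B (Suc n) y} \<subseteq>
        {(a, b). cell B n a = cell B n x \<and> cell B n b = cell B n y}"
      by blast
    then have "(INF p\<in>{(a, b). cell B n a = cell B n x \<and> cell B n b = cell B n y}. h (fst p) (snd p)) \<le>
        (INF p\<in>{(a, b). cell B (Suc n) a = cell B (Suc n) x \<and> cell B (Suc n) b = cell B (Suc n) y}. h (fst p) (snd p))"
      by (rule INF_superset_mono) simp
    ultimately show ?thesis using False unfolding cell_approx_def cell_inf_def by simp
  qed
qed

text \<open>Lower semicontinuity provides neighbourhoods of x and y on which h stays above c. Basis
  sets inside them, taken disjoint by the Hausdorff property, are among the first n sets for large
  n. Then x and y lie in different cells, and the infimum over these is at least c.\<close>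

lemma cell_approx_SUP:
  fixes h :: "'a::t2_space \<Rightarrow> 'a \<Rightarrow> ennreal"
  assumes B: "topological_basis (range B)"
    and h: "\<And>c. c < h x y \<Longrightarrow> \<exists>U V. open U \<and> open V \<and> x \<in> U \<and> y \<in> V \<and> (\<forall>x'\<in>U. \<forall>y'\<in>V. c \<le> h x' y')"
    and xy: "x \<noteq> y"
  shows "(SUP n. cell_approx B h n x y) = h x y"
proof (rule antisym)
  show "(SUP n. cell_approx B h n x y) \<le> h x y"
    using cell_approx_le[OF xy] by (intro SUP_least)
  show "h x y \<le> (SUP n. cell_approx B h n x y)"
  proof (rule dense_le)
    fix c assume "c < h x y"
    from h[OF this] obtain U V where UV: "open U" "open V" "x \<in> U" "y \<in> V" "\<And>x' y'. x' \<in> U \<Longrightarrow> y' \<in> V \<Longrightarrow> c \<le> h x' y'"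
      by blast
    obtain U' V' where sep: "open U'" "open V'" "x \<in> U'" "y \<in> V'" "U' \<inter> V' = {}"
      using hausdorff[OF xy] by blast
    have "open (U \<inter> U')" "x \<in> U \<inter> U'" using UV sep by auto
    then obtain B1 where "B1 \<in> range B" "x \<in> B1" "B1 \<subseteq> U \<inter> U'" by (rule topological_basisE[OF B])
    then obtain i where i: "x \<in> B i" "B i \<subseteq> U \<inter> U'" by blast
    have "open (V \<inter> V')" "y \<in> V \<inter> V'" using UV sep by auto
    then obtain B2 where "B2 \<in> range B" "y \<in> B2" "B2 \<subseteq> V \<inter> V'" by (rule topological_basisE[OF B])
    then obtain j where j: "y \<in> B j" "B j \<subseteq> V \<inter> V'" by blast
    define n where "n = Suc (max i j)"
    have n: "i < n" "j < n" by (auto simp: n_def)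
    have "cell B n x \<noteq> cell B n y"
    proof
      assume "cell B n x = cell B n y"
      then have "y \<in> B i" using cell_eq_mem n i by metis
      then show False using i j sep by blast
    qed
    moreover have "c \<le> (INF p\<in>{(x', y'). cell B n x' = cell B n x \<and> cell B n y' = cell B n y}. h (fst p) (snd p))"
    proof (rule INF_greatest)
      fix p assume "p \<in> {(x', y'). cell B n x' = cell B n x \<and> cell B n y' = cell B n y}"
      then have "fst p \<in> B i" "snd p \<in> B j"
        using cell_eq_mem[of B n x "fst p" i] cell_eq_mem[of B n y "snd p" j] n i j by auto
      then show "c \<le> h (fst p) (snd p)" using i j by (intro UV) auto
    qed
    ultimately have "c \<le> cell_approx B h n x y" unfolding cell_approx_def cell_inf_def by simp
    then show "c \<le> (SUP n. cell_approx B h n x y)" by (rule order_trans) (auto intro: SUP_upper)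
  qed
qed

text \<open>A finite combination of products of indicators is the form to which joint intensities
  apply.\<close>

lemma cell_approx_expand:
  "cell_approx B h n x y = (\<Sum>I\<in>Pow {..<n}. \<Sum>J\<in>Pow {..<n}. cell_inf B h n I J *
     (indicator {x. cell B n x = I} x * indicator {y. cell B n y = J} y))"
proof -
  have m: "cell B n x \<in> Pow {..<n}" for x by (auto simp: cell_def)
  have "(\<Sum>I\<in>Pow {..<n}. \<Sum>J\<in>Pow {..<n}. cell_inf B h n I J * (indicator {x. cell B n x = I} x * indicator {y. cell B n y = J} y))
    = (\<Sum>I\<in>Pow {..<n}. if cell B n x = I then (\<Sum>J\<in>Pow {..<n}. if cell B n y = J then cell_inf B h n I J else 0) else 0)"
    by (intro sum.cong refl) (auto simp: indicator_def intro!: sum.cong)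
  also have "\<dots> = cell_approx B h n x y"
    using m by (simp add: cell_approx_def)
  finally show ?thesis ..
qed

lemma cell_measurable:
  fixes B :: "nat \<Rightarrow> 'b::topological_space set"
  assumes B: "\<And>i. open (B i)" and f: "f \<in> borel_measurable M"
  shows "{x\<in>space M. cell B n (f x) = I} \<in> sets M"
proof -
  have [measurable]: "B i \<in> sets borel" for i using B by (rule borel_open)
  note [measurable] = f
  have "{x\<in>space M. cell B n (f x) = I} = {x\<in>space M. \<forall>i. (i < n \<and> f x \<in> B i) = (i \<in> I)}"
    by (auto simp: cell_def set_eq_iff)
  also have "\<dots> \<in> sets M" by measurable
  finally show ?thesis .
qed

lemma nn_integral_count_space_Times:
  fixes A B :: "'a set"
  shows "(\<integral>\<^sup>+p. indicator A (fst p) * indicator B (snd p) \<partial>count_space (UNIV :: ('a \<times> 'a) set)) =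
     emeasure (count_space UNIV) A * emeasure (count_space UNIV) B"
proof -
  have "(\<integral>\<^sup>+p. indicator A (fst p) * indicator B (snd p) \<partial>count_space (UNIV :: ('a \<times> 'a) set)) =
    (\<integral>\<^sup>+x. \<integral>\<^sup>+y. indicator A x * indicator B y \<partial>count_space UNIV \<partial>count_space UNIV)"
    by (subst nn_integral_fst_count_space[symmetric]) simp
  also have "\<dots> = emeasure (count_space UNIV) A * emeasure (count_space UNIV) B"
    by (simp add: nn_integral_cmult nn_integral_multc)
  finally show ?thesis .
qed

definition offdiag :: "'a set \<Rightarrow> ('a \<times> 'a) set" where
  "offdiag A = {(x, y). x \<in> A \<and> y \<in> A \<and> x \<noteq> y}"

text \<open>A sum over ordered pairs of distinct points, written as an integral for counting measure
  so that it is meaningful with values in \<open>[0, \<infinity>]\<close> for infinite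
  configurations as well.\<close>

definition pair_sum :: "('a \<Rightarrow> 'a \<Rightarrow> ennreal) \<Rightarrow> 'a set \<Rightarrow> ennreal" where
  "pair_sum h A = (\<integral>\<^sup>+p. h (fst p) (snd p) * indicator (offdiag A) p \<partial>count_space UNIV)"

lemma cell_approx_count:
  fixes \<Phi> :: "'a \<Rightarrow> 'b"
  shows "(\<integral>\<^sup>+p. cell_approx B h n (\<Phi> (fst p)) (\<Phi> (snd p)) * indicator (A \<times> A) p \<partial>count_space UNIV) =
    (\<Sum>I\<in>Pow {..<n}. \<Sum>J\<in>Pow {..<n}. cell_inf B h n I J *
      (point_count A {x. cell B n (\<Phi> x) = I} * point_count A {x. cell B n (\<Phi> x) = J}))"
proof -
  let ?f = "\<lambda>n p. cell_approx B h n (\<Phi> (fst p)) (\<Phi> (snd p)) * indicator (A \<times> A) p"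
  let ?C = "\<lambda>I. {x. cell B n (\<Phi> x) = I}"
  have "(\<integral>\<^sup>+p. ?f n p \<partial>count_space UNIV) = (\<integral>\<^sup>+p. (\<Sum>I\<in>Pow {..<n}. \<Sum>J\<in>Pow {..<n}. cell_inf B h n I J *
    (indicator (A \<inter> ?C I) (fst p) * indicator (A \<inter> ?C J) (snd p))) \<partial>count_space UNIV)"
  proof (rule nn_integral_cong)
    fix p :: "'a \<times> 'a"
    have t: "cell_inf B h n I J * (indicator {x. cell B n x = I} (\<Phi> (fst p)) * indicator {y. cell B n y = J} (\<Phi> (snd p))) *
        indicator (A \<times> A) p =
      cell_inf B h n I J * (indicator (A \<inter> ?C I) (fst p) * indicator (A \<inter> ?C J) (snd p))" for I J
      by (cases p) (auto simp: indicator_def)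
    show "?f n p = (\<Sum>I\<in>Pow {..<n}. \<Sum>J\<in>Pow {..<n}. cell_inf B h n I J *
      (indicator (A \<inter> ?C I) (fst p) * indicator (A \<inter> ?C J) (snd p)))"
      unfolding cell_approx_expand sum_distrib_right t ..
  qed
  also have "\<dots> = (\<Sum>I\<in>Pow {..<n}. \<Sum>J\<in>Pow {..<n}. cell_inf B h n I J * (point_count A (?C I) * point_count A (?C J)))"
    by (subst nn_integral_sum, simp, subst nn_integral_sum, simp)
       (simp add: nn_integral_cmult nn_integral_count_space_Times point_count_def)
  finally show ?thesis .
qed

lemma pair_sum_approx:
  fixes \<Phi> :: "'a \<Rightarrow> 'b::t2_space"
  assumes B: "topological_basis (range B)" and inj: "inj \<Phi>"
    and h: "\<And>x y c. x \<noteq> y \<Longrightarrow> c < h x y \<Longrightarrow> \<exists>U V. open U \<and> open V \<and> x \<in> U \<and> y \<in> V \<and> (\<forall>x'\<in>U. \<forall>y'\<in>V. c \<le> h x' y')"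
  shows "pair_sum (\<lambda>x y. h (\<Phi> x) (\<Phi> y)) A =
    (SUP n. \<Sum>I\<in>Pow {..<n}. \<Sum>J\<in>Pow {..<n}. cell_inf B h n I J *
      (point_count A {x. cell B n (\<Phi> x) = I} * point_count A {x. cell B n (\<Phi> x) = J}))"
proof -
  let ?f = "\<lambda>n p. cell_approx B h n (\<Phi> (fst p)) (\<Phi> (snd p)) * indicator (A \<times> A) p"
  have pt: "h (\<Phi> (fst p)) (\<Phi> (snd p)) * indicator (offdiag A) p = (SUP n. ?f n p)" for p
  proof (cases "p \<in> offdiag A")
    case True
    then have "\<Phi> (fst p) \<noteq> \<Phi> (snd p)" "p \<in> A \<times> A" using inj by (auto simp: offdiag_def inj_eq)
    then show ?thesis using cell_approx_SUP[OF B h, of "\<Phi> (fst p)" "\<Phi> (snd p)"] True by simp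
  next
    case False
    then have z: "?f n p = 0" for n by (cases p) (auto simp: offdiag_def indicator_def)
    have "(SUP n. ?f n p) = (SUP n::nat. 0)" by (rule SUP_cong[OF refl z])
    then show ?thesis using False by simp
  qed
  have "pair_sum (\<lambda>x y. h (\<Phi> x) (\<Phi> y)) A = (SUP n. \<integral>\<^sup>+p. ?f n p \<partial>count_space UNIV)"
    unfolding pair_sum_def pt
    by (rule nn_integral_monotone_convergence_SUP)
       (auto simp: incseq_def le_fun_def intro!: mult_right_mono incseqD[OF cell_approx_incseq])
  also have "\<dots> = (SUP n. \<Sum>I\<in>Pow {..<n}. \<Sum>J\<in>Pow {..<n}. cell_inf B h n I J *
      (point_count A {x. cell B n (\<Phi> x) = I} * point_count A {x. cell B n (\<Phi> x) = J}))"
    unfolding cell_approx_count by (rule refl)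
  finally show ?thesis .
qed

lemma nn_integral_PiM_two:
  fixes g :: "'a::euclidean_space \<Rightarrow> 'a \<Rightarrow> ennreal"
  assumes [measurable]: "(\<lambda>(x, y). g x y) \<in> borel_measurable (borel \<Otimes>\<^sub>M borel)"
  shows "(\<integral>\<^sup>+x. g (x 0) (x 1) \<partial>(\<Pi>\<^sub>M i\<in>{..<2::nat}. lborel)) = (\<integral>\<^sup>+x. (\<integral>\<^sup>+y. g x y \<partial>lborel) \<partial>lborel)"
proof -
  interpret product_sigma_finite "\<lambda>_::nat. (lborel :: 'a measure)" ..
  have two: "{..<2::nat} = insert 1 {0}" by auto
  have "(\<integral>\<^sup>+x. g (x 0) (x 1) \<partial>(\<Pi>\<^sub>M i\<in>{..<2::nat}. lborel)) =
    (\<integral>\<^sup>+x. (\<integral>\<^sup>+y. g ((x(1 := y)) 0) ((x(1 := y)) 1) \<partial>lborel) \<partial>(\<Pi>\<^sub>M i\<in>{0::nat}. lborel))"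
    unfolding two by (rule product_nn_integral_insert) simp_all
  also have "\<dots> = (\<integral>\<^sup>+x. (\<integral>\<^sup>+y. g (x 0) y \<partial>lborel) \<partial>(\<Pi>\<^sub>M i\<in>{0::nat}. lborel))"
    by simp
  also have "\<dots> = (\<integral>\<^sup>+x. (\<integral>\<^sup>+y. g x y \<partial>lborel) \<partial>lborel)"
    by (rule product_nn_integral_singleton) measurable
  finally show ?thesis .
qed

lemma nn_integral_PiM_one:
  fixes g :: "'a::euclidean_space \<Rightarrow> ennreal"
  assumes [measurable]: "g \<in> borel_measurable borel"
  shows "(\<integral>\<^sup>+x. g (x 0) \<partial>(\<Pi>\<^sub>M i\<in>{..<1::nat}. lborel)) = (\<integral>\<^sup>+x. g x \<partial>lborel)"
proof -
  interpret product_sigma_finite "\<lambda>_::nat. (lborel :: 'a measure)" ..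
  have one: "{..<1::nat} = {0}" by auto
  show ?thesis unfolding one by (rule product_nn_integral_singleton) simp
qed

lemma det_one: "Determinant.det (Matrix.mat 1 1 f) = (f (0, 0) :: 'a::comm_ring_1)"
  by (subst det_single[of _]) simp_all

lemma det_two: "Determinant.det (Matrix.mat 2 2 f) = f (0, 0) * f (1, 1) - f (0, 1) * (f (1, 0) :: 'a::comm_ring_1)"
proof -
  let ?A = "Matrix.mat 2 2 f"
  have A: "?A \<in> carrier_mat 2 2" by simp
  have two: "{..<2::nat} = {0, 1}" by auto
  have d: "Determinant.det (mat_delete ?A i 0) = mat_delete ?A i 0 $$ (0, 0)" if "i < 2" for i
    using that by (intro det_single carrier_matI) (simp_all add: mat_delete_def)
  have "Determinant.det ?A = (\<Sum>i<2. ?A $$ (i, 0) * cofactor ?A i 0)"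
    by (rule laplace_expansion_column[OF A]) simp
  also have "\<dots> = f (0, 0) * f (1, 1) - f (0, 1) * f (1, 0)"
    unfolding two cofactor_def by (simp add: d) (simp add: mat_delete_def)
  finally show ?thesis .
qed

lemma determinantal_intensity_1:
  fixes K :: "'a::euclidean_space \<Rightarrow> 'a \<Rightarrow> complex"
  assumes dp: "determinantal_process P lborel X K" and D: "D \<in> sets borel"
    and K: "(\<lambda>x. Re (K x x)) \<in> borel_measurable borel"
  shows "(\<integral>\<^sup>+w. point_count (X w) D \<partial>P) = (\<integral>\<^sup>+x. indicator D x * ennreal (Re (K x x)) \<partial>lborel)"
proof -
  obtain \<rho> where \<rho>: "joint_intensity P lborel X 1 \<rho>"
    "\<And>x. x \<in> space (\<Pi>\<^sub>M i\<in>{..<1::nat}. (lborel :: 'a measure)) \<Longrightarrow>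
       complex_of_real (\<rho> x) = Determinant.det (Matrix.mat 1 1 (\<lambda>(i, j). K (x i) (x j)))"
    using dp unfolding determinantal_process_def by blast
  have "(\<integral>\<^sup>+w. (\<Prod>i<1::nat. point_count (X w) ((\<lambda>_. D) i)) \<partial>P) =
     (\<integral>\<^sup>+x \<in> Pi\<^sub>E {..<1::nat} (\<lambda>_. D). ennreal (\<rho> x) \<partial>(\<Pi>\<^sub>M i\<in>{..<1::nat}. lborel))"
    using \<rho>(1) D unfolding joint_intensity_def by (auto simp: disjoint_family_on_def)
  also have "\<dots> = (\<integral>\<^sup>+x. indicator D (x 0) * ennreal (Re (K (x 0) (x 0))) \<partial>(\<Pi>\<^sub>M i\<in>{..<1::nat}. lborel))"
  proof (rule nn_integral_cong)
    fix x assume x: "x \<in> space (\<Pi>\<^sub>M i\<in>{..<1::nat}. (lborel :: 'a measure))"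
    have "complex_of_real (\<rho> x) = K (x 0) (x 0)" using \<rho>(2)[OF x] by (simp only: det_one case_prod_conv)
    then have "\<rho> x = Re (K (x 0) (x 0))" by (metis Re_complex_of_real)
    then show "ennreal (\<rho> x) * indicator (Pi\<^sub>E {..<1::nat} (\<lambda>_. D)) x = indicator D (x 0) * ennreal (Re (K (x 0) (x 0)))"
      using x by (auto simp: indicator_def space_PiM PiE_iff)
  qed
  also have "\<dots> = (\<integral>\<^sup>+x. indicator D x * ennreal (Re (K x x)) \<partial>lborel)"
    by (rule nn_integral_PiM_one) (use K D in measurable)
  finally show ?thesis by simp
qed

lemma determinantal_intensity_2:
  fixes K :: "'a::euclidean_space \<Rightarrow> 'a \<Rightarrow> complex"
  assumes dp: "determinantal_process P lborel X K" and D: "D \<in> sets borel" "D' \<in> sets borel" "D \<inter> D' = {}"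
    and K: "(\<lambda>(x, y). Re (K x x * K y y - K x y * K y x)) \<in> borel_measurable (borel \<Otimes>\<^sub>M borel)"
  shows "(\<integral>\<^sup>+w. point_count (X w) D * point_count (X w) D' \<partial>P) =
    (\<integral>\<^sup>+x. (\<integral>\<^sup>+y. indicator D x * indicator D' y * ennreal (Re (K x x * K y y - K x y * K y x)) \<partial>lborel) \<partial>lborel)"
proof -
  obtain \<rho> where \<rho>: "joint_intensity P lborel X 2 \<rho>"
    "\<And>x. x \<in> space (\<Pi>\<^sub>M i\<in>{..<2::nat}. (lborel :: 'a measure)) \<Longrightarrow>
       complex_of_real (\<rho> x) = Determinant.det (Matrix.mat 2 2 (\<lambda>(i, j). K (x i) (x j)))"
    using dp unfolding determinantal_process_def by (metis one_le_numeral)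
  let ?D = "\<lambda>i::nat. if i = 0 then D else D'"
  have two: "{..<2::nat} = {0, 1}" by auto
  have "(\<integral>\<^sup>+w. (\<Prod>i<2::nat. point_count (X w) (?D i)) \<partial>P) =
     (\<integral>\<^sup>+x \<in> Pi\<^sub>E {..<2::nat} ?D. ennreal (\<rho> x) \<partial>(\<Pi>\<^sub>M i\<in>{..<2::nat}. lborel))"
  proof -
    have "(\<forall>i<2. ?D i \<in> sets lborel) \<and> disjoint_family_on ?D {..<2}"
      using D by (auto simp: disjoint_family_on_def two)
    then show ?thesis
      by (rule \<rho>(1)[unfolded joint_intensity_def, THEN conjunct2, THEN conjunct2, THEN spec, THEN mp])
  qed
  also have "\<dots> = (\<integral>\<^sup>+x. indicator D (x 0) * indicator D' (x 1) * ennreal (Re (K (x 0) (x 0) * K (x 1) (x 1) - K (x 0) (x 1) * K (x 1) (x 0)))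
      \<partial>(\<Pi>\<^sub>M i\<in>{..<2::nat}. lborel))"
  proof (rule nn_integral_cong)
    fix x assume x: "x \<in> space (\<Pi>\<^sub>M i\<in>{..<2::nat}. (lborel :: 'a measure))"
    have "complex_of_real (\<rho> x) = K (x 0) (x 0) * K (x 1) (x 1) - K (x 0) (x 1) * K (x 1) (x 0)"
      using \<rho>(2)[OF x] by (simp only: det_two case_prod_conv)
    then have "\<rho> x = Re (K (x 0) (x 0) * K (x 1) (x 1) - K (x 0) (x 1) * K (x 1) (x 0))" by (metis Re_complex_of_real)
    moreover have "indicator (Pi\<^sub>E {..<2::nat} ?D) x = (indicator D (x 0) * indicator D' (x 1) :: ennreal)"
      using x by (auto simp: indicator_def space_PiM PiE_iff two)
    ultimately show "ennreal (\<rho> x) * indicator (Pi\<^sub>E {..<2::nat} ?D) x =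
      indicator D (x 0) * indicator D' (x 1) * ennreal (Re (K (x 0) (x 0) * K (x 1) (x 1) - K (x 0) (x 1) * K (x 1) (x 0)))"
      by (simp only: mult.commute)
  qed
  also have "\<dots> = (\<integral>\<^sup>+x. (\<integral>\<^sup>+y. indicator D x * indicator D' y * ennreal (Re (K x x * K y y - K x y * K y x)) \<partial>lborel) \<partial>lborel)"
    by (rule nn_integral_PiM_two) (use K D in measurable)
  finally show ?thesis by (simp add: two)
qed

text \<open>Joint intensities control products of counts on disjoint sets only. Off the diagonal h
  is the increasing limit of step functions on pairs of distinct, hence disjoint, cells. For these
  the formula is the definition of the intensity, and monotone convergence carries it over to h. The
  diagonal is omitted from the pair sum and is a null set for the integral.\<close>

lemma expected_pair_sum:
  fixes K :: "'a::euclidean_space \<Rightarrow> 'a \<Rightarrow> complex" and \<Phi> :: "'a \<Rightarrow> 'b::{t2_space, second_countable_topology}"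
  assumes dp: "determinantal_process P lborel X K"
    and K: "(\<lambda>(x, y). Re (K x x * K y y - K x y * K y x)) \<in> borel_measurable (borel \<Otimes>\<^sub>M borel)"
    and \<Phi>: "\<Phi> \<in> borel_measurable borel" and inj: "inj \<Phi>"
    and h: "\<And>x y c. x \<noteq> y \<Longrightarrow> c < h x y \<Longrightarrow> \<exists>U V. open U \<and> open V \<and> x \<in> U \<and> y \<in> V \<and> (\<forall>x'\<in>U. \<forall>y'\<in>V. c \<le> h x' y')"
  shows "(\<lambda>w. pair_sum (\<lambda>x y. h (\<Phi> x) (\<Phi> y)) (X w)) \<in> borel_measurable P" (is ?meas)
    and "(\<integral>\<^sup>+w. pair_sum (\<lambda>x y. h (\<Phi> x) (\<Phi> y)) (X w) \<partial>P) =
      (\<integral>\<^sup>+x. (\<integral>\<^sup>+y. h (\<Phi> x) (\<Phi> y) * ennreal (Re (K x x * K y y - K x y * K y x)) \<partial>lborel) \<partial>lborel)" (is ?int)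
proof -
  define R where "R x y = ennreal (Re (K x x * K y y - K x y * K y x))" for x y
  have Rm[measurable]: "(\<lambda>(x, y). R x y) \<in> borel_measurable (borel \<Otimes>\<^sub>M borel)"
    using K unfolding R_def by measurable
  have pp: "point_process P lborel X" using dp by (simp add: determinantal_process_def)
  obtain \<B> :: "'b set set" where "countable \<B>" "topological_basis \<B>" using ex_countable_basis by auto
  define B where "B = from_nat_into \<B>"
  \<comment> \<open>The enumeration \<open>from_nat_into\<close> has the basis as its range only if
    the basis is nonempty.\<close>
  have ne: "\<B> \<noteq> {}"
  proof
    assume "\<B> = {}"
    with \<open>topological_basis \<B>\<close> have "(UNIV :: 'b set) = {}"
      unfolding topological_basis_def by (metis Union_empty open_UNIV subset_empty)
    then show False by simp
  qed
  have B: "topological_basis (range B)"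
    using \<open>topological_basis \<B>\<close> range_from_nat_into[OF ne \<open>countable \<B>\<close>] by (simp add: B_def)
  have Bo: "open (B i)" for i using B by (metis rangeI topological_basis_open)
  define C where "C n I = {x. cell B n (\<Phi> x) = I}" for n I
  have Cm[measurable]: "C n I \<in> sets borel" for n I
    using cell_measurable[where B = B and f = \<Phi> and n = n and I = I, OF Bo \<Phi>] by (simp add: C_def)
  have Ci: "indicator {u. cell B n u = I} (\<Phi> x) = (indicator (C n I) x :: ennreal)" for n I x
    by (simp add: indicator_def C_def)
  have pcm[measurable]: "(\<lambda>w. point_count (X w) D) \<in> borel_measurable P" if "D \<in> sets borel" for D
    using pp that by (simp add: point_process_def)
  let ?S = "\<lambda>n w. \<Sum>I\<in>Pow {..<n}. \<Sum>J\<in>Pow {..<n}. cell_inf B h n I J * (point_count (X w) (C n I) * point_count (X w) (C n J))"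
  have eq: "pair_sum (\<lambda>x y. h (\<Phi> x) (\<Phi> y)) (X w) = (SUP n. ?S n w)" for w
    unfolding C_def by (rule pair_sum_approx[OF B inj h])
  have Sm: "?S n \<in> borel_measurable P" for n
    by measurable
  show ?meas unfolding eq by (rule borel_measurable_SUP) (auto intro: Sm)
  have incP: "incseq ?S"
  proof (rule incseq_SucI, rule le_funI)
    fix n w
    have e: "?S n w = (\<integral>\<^sup>+p. cell_approx B h n (\<Phi> (fst p)) (\<Phi> (snd p)) * indicator (X w \<times> X w) p \<partial>count_space UNIV)" for n
      unfolding C_def by (rule cell_approx_count[symmetric])
    show "?S n w \<le> ?S (Suc n) w" unfolding e
      by (intro nn_integral_mono mult_right_mono incseq_SucD[OF cell_approx_incseq]) simp
  qed
  have a: "(\<integral>\<^sup>+w. ?S n w \<partial>P) = (\<integral>\<^sup>+x. (\<integral>\<^sup>+y. cell_approx B h n (\<Phi> x) (\<Phi> y) * R x y \<partial>lborel) \<partial>lborel)" for n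
  proof -
    let ?T = "\<lambda>I J. (\<integral>\<^sup>+x. (\<integral>\<^sup>+y. indicator (C n I) x * indicator (C n J) y * R x y \<partial>lborel) \<partial>lborel)"
    have "(\<integral>\<^sup>+w. ?S n w \<partial>P) = (\<Sum>I\<in>Pow {..<n}. \<Sum>J\<in>Pow {..<n}. cell_inf B h n I J * (\<integral>\<^sup>+w. point_count (X w) (C n I) * point_count (X w) (C n J) \<partial>P))"
      by (simp add: nn_integral_sum nn_integral_cmult)
    also have "\<dots> = (\<Sum>I\<in>Pow {..<n}. \<Sum>J\<in>Pow {..<n}. cell_inf B h n I J * ?T I J)"
    proof (intro sum.cong refl)
      fix I J
      show "cell_inf B h n I J * (\<integral>\<^sup>+w. point_count (X w) (C n I) * point_count (X w) (C n J) \<partial>P) = cell_inf B h n I J * ?T I J"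
      \<comment> \<open>For equal indices the coefficient \<open>cell_inf\<close> is 0, so the
        intensity is asked for on disjoint cells only.\<close>
      proof (cases "I = J")
        case False
        then have "C n I \<inter> C n J = {}" by (auto simp: C_def)
        then show ?thesis unfolding R_def by (subst determinantal_intensity_2[OF dp Cm Cm _ K]) simp_all
      qed (simp add: cell_inf_def)
    qed
    also have "\<dots> = (\<integral>\<^sup>+x. (\<integral>\<^sup>+y. (\<Sum>I\<in>Pow {..<n}. \<Sum>J\<in>Pow {..<n}. cell_inf B h n I J * (indicator (C n I) x * indicator (C n J) y * R x y)) \<partial>lborel) \<partial>lborel)"
      by (simp add: nn_integral_sum nn_integral_cmult)
    also have "\<dots> = (\<integral>\<^sup>+x. (\<integral>\<^sup>+y. cell_approx B h n (\<Phi> x) (\<Phi> y) * R x y \<partial>lborel) \<partial>lborel)"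
    proof (intro nn_integral_cong)
      fix x y
      show "(\<Sum>I\<in>Pow {..<n}. \<Sum>J\<in>Pow {..<n}. cell_inf B h n I J * (indicator (C n I) x * indicator (C n J) y * R x y)) =
        cell_approx B h n (\<Phi> x) (\<Phi> y) * R x y"
        unfolding cell_approx_expand Ci by (simp only: sum_distrib_right mult.assoc)
    qed
    finally show ?thesis .
  qed
  have cam: "(\<lambda>(x, y). cell_approx B h n (\<Phi> x) (\<Phi> y) * R x y) \<in> borel_measurable (lborel \<Otimes>\<^sub>M lborel)" for n
    unfolding cell_approx_expand Ci by measurable
  have "(\<integral>\<^sup>+w. pair_sum (\<lambda>x y. h (\<Phi> x) (\<Phi> y)) (X w) \<partial>P) = (SUP n. \<integral>\<^sup>+w. ?S n w \<partial>P)"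
    unfolding eq by (rule nn_integral_monotone_convergence_SUP[OF incP Sm])
  also have "\<dots> = (SUP n. \<integral>\<^sup>+x. (\<integral>\<^sup>+y. cell_approx B h n (\<Phi> x) (\<Phi> y) * R x y \<partial>lborel) \<partial>lborel)"
    unfolding a by (rule refl)
  also have "\<dots> = (\<integral>\<^sup>+x. (SUP n. \<integral>\<^sup>+y. cell_approx B h n (\<Phi> x) (\<Phi> y) * R x y \<partial>lborel) \<partial>lborel)"
  proof (rule nn_integral_monotone_convergence_SUP[symmetric])
    show "incseq (\<lambda>n x. \<integral>\<^sup>+y. cell_approx B h n (\<Phi> x) (\<Phi> y) * R x y \<partial>lborel)"
      by (intro incseq_SucI le_funI nn_integral_mono mult_right_mono incseq_SucD[OF cell_approx_incseq]) simp
    show "(\<lambda>x. \<integral>\<^sup>+y. cell_approx B h n (\<Phi> x) (\<Phi> y) * R x y \<partial>lborel) \<in> borel_measurable lborel" for n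
      by (rule lborel.borel_measurable_nn_integral[OF cam])
  qed
  also have "\<dots> = (\<integral>\<^sup>+x. (\<integral>\<^sup>+y. h (\<Phi> x) (\<Phi> y) * R x y \<partial>lborel) \<partial>lborel)"
  proof (rule nn_integral_cong)
    fix x :: 'a
    have "(SUP n. \<integral>\<^sup>+y. cell_approx B h n (\<Phi> x) (\<Phi> y) * R x y \<partial>lborel) = (\<integral>\<^sup>+y. (SUP n. cell_approx B h n (\<Phi> x) (\<Phi> y) * R x y) \<partial>lborel)"
    proof (rule nn_integral_monotone_convergence_SUP[symmetric])
      show "incseq (\<lambda>n y. cell_approx B h n (\<Phi> x) (\<Phi> y) * R x y)"
        by (intro incseq_SucI le_funI mult_right_mono incseq_SucD[OF cell_approx_incseq]) simp
      show "(\<lambda>y. cell_approx B h n (\<Phi> x) (\<Phi> y) * R x y) \<in> borel_measurable lborel" for n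
        using measurable_Pair2[OF cam, of x n] by simp
    qed
    also have "\<dots> = (\<integral>\<^sup>+y. h (\<Phi> x) (\<Phi> y) * R x y \<partial>lborel)"
    proof (rule nn_integral_cong_AE)
      have "AE y in lborel. y \<noteq> x" by (rule AE_lborel_singleton)
      then show "AE y in lborel. (SUP n. cell_approx B h n (\<Phi> x) (\<Phi> y) * R x y) = h (\<Phi> x) (\<Phi> y) * R x y"
      proof (rule eventually_mono)
        fix y assume "y \<noteq> x"
        then have xy: "\<Phi> x \<noteq> \<Phi> y" using inj by (auto simp: inj_eq)
        show "(SUP n. cell_approx B h n (\<Phi> x) (\<Phi> y) * R x y) = h (\<Phi> x) (\<Phi> y) * R x y"
          using cell_approx_SUP[OF B h[OF xy] xy] by (simp add: SUP_mult_right_ennreal[symmetric])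
      qed
    qed
    finally show "(SUP n. \<integral>\<^sup>+y. cell_approx B h n (\<Phi> x) (\<Phi> y) * R x y \<partial>lborel) = (\<integral>\<^sup>+y. h (\<Phi> x) (\<Phi> y) * R x y \<partial>lborel)" .
  qed
  finally show ?int unfolding R_def .
qed

section \<open>Expected Riesz energy of the image process\<close>

text \<open>The height determines the norm through \<open>inv_height\<close>; for a nonzero point
  the horizontal part then determines the direction, its factor being positive.\<close>

lemma sphere_map_inj: "inj (sphere_map :: complex ^ 'd::finite \<Rightarrow> _)"
proof (rule injI)
  fix z w :: "complex ^ 'd" assume eq: "sphere_map z = sphere_map w"
  let ?h = "height CARD('d)"
  have "snd (sphere_map z) = snd (sphere_map w)" using eq by (rule arg_cong)
  then have h: "?h (norm z) = ?h (norm w)" unfolding sphere_map_eq Let_def snd_conv .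
  have n: "norm w = norm z"
    using inv_height_height[where d = "CARD('d)", OF zero_less_card_finite norm_ge_zero[of z]]
      inv_height_height[where d = "CARD('d)", OF zero_less_card_finite norm_ge_zero[of w]]
    unfolding h by (rule trans[OF sym, rotated])
  show "z = w"
  proof (cases "z = 0")
    case False
    then have z: "inverse (norm z) \<noteq> 0" "norm z \<noteq> 0" by simp_all
    have "-1 < ?h (norm z)" "?h (norm z) < 1"
      by (rule height_gt[OF zero_less_card_finite z(2)], rule height(2)[OF zero_less_card_finite])
    then have "(?h (norm z))\<^sup>2 < 1" unfolding abs_square_less_1 abs_less_iff by linarith
    then have "0 < sqrt (1 - (?h (norm z))\<^sup>2)" by (simp only: real_sqrt_gt_0_iff diff_gt_0_iff_gt)
    then have q: "sqrt (1 - (?h (norm z))\<^sup>2) \<noteq> 0" by linarith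
    have "fst (sphere_map z) = fst (sphere_map w)" using eq by (rule arg_cong)
    then have "sqrt (1 - (?h (norm z))\<^sup>2) *\<^sub>R (z /\<^sub>R norm z) = sqrt (1 - (?h (norm z))\<^sup>2) *\<^sub>R (w /\<^sub>R norm z)"
      unfolding sphere_map_eq Let_def fst_conv n .
    then show ?thesis by (rule scaleR_left_imp_eq[OF z(1) scaleR_left_imp_eq[OF q]])
  qed (use n in auto)
qed

definition riesz_kernel :: "real \<Rightarrow> 'a::real_normed_vector \<Rightarrow> 'a \<Rightarrow> ennreal" where
  "riesz_kernel s x y = ennreal (norm (x - y) powr (- s))"

text \<open>The kernel is continuous off the diagonal. The restriction to distinct points matches
  the value 0 that \<open>powr\<close> assigns on the diagonal.\<close>

lemma riesz_kernel_lsc: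
  assumes xy: "x \<noteq> y" and c: "c < riesz_kernel s x y"
  shows "\<exists>U V. open U \<and> open V \<and> x \<in> U \<and> y \<in> V \<and> (\<forall>x'\<in>U. \<forall>y'\<in>V. c \<le> riesz_kernel s x' y')"
proof -
  have "((\<lambda>p. ennreal (norm (fst p - snd p) powr (- s))) \<longlongrightarrow> ennreal (norm (fst (x, y) - snd (x, y)) powr (- s))) (nhds (x, y))"
    by (intro tendsto_ennrealI tendsto_powr tendsto_norm tendsto_diff tendsto_fst tendsto_snd tendsto_const filterlim_ident)
       (use xy in simp)
  then have "eventually (\<lambda>p. c < ennreal (norm (fst p - snd p) powr (- s))) (nhds (x, y))"
    by (rule order_tendstoD(1)) (use c in \<open>simp add: riesz_kernel_def\<close>)
  then obtain W where W: "open W" "(x, y) \<in> W" "\<And>p. p \<in> W \<Longrightarrow> c < ennreal (norm (fst p - snd p) powr (- s))"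
    unfolding eventually_nhds by blast
  obtain U V where "open U" "open V" "(x, y) \<in> U \<times> V" "U \<times> V \<subseteq> W"
    using open_prod_elim[OF W(1,2)] by blast
  moreover have "c \<le> riesz_kernel s x' y'" if "x' \<in> U" "y' \<in> V" for x' y'
  proof -
    have "(x', y') \<in> W" using that \<open>U \<times> V \<subseteq> W\<close> by blast
    from W(3)[OF this] show ?thesis by (simp add: riesz_kernel_def less_imp_le)
  qed
  ultimately show ?thesis by blast
qed

lemma finite_offdiag_iff: "finite A \<Longrightarrow> finite (offdiag A)"
  by (rule finite_subset[of _ "A \<times> A"]) (auto simp: offdiag_def)

lemma riesz_energy_infinite:
  assumes "infinite A" shows "riesz_energy s A = 0"
proof -
  obtain a where a: "a \<in> A" using assms by fastforce
  have "infinite (A - {a})" using assms by simp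
  then have "infinite (Pair a ` (A - {a}))" by (subst finite_image_iff) (auto simp: inj_on_def)
  moreover have "Pair a ` (A - {a}) \<subseteq> {(x, y). x \<in> A \<and> y \<in> A \<and> x \<noteq> y}" using a by auto
  ultimately have "infinite {(x, y). x \<in> A \<and> y \<in> A \<and> x \<noteq> y}" using finite_subset by blast
  then show ?thesis by (simp add: riesz_energy_def)
qed

lemma riesz_energy_image:
  fixes \<Phi> :: "'a \<Rightarrow> 'b::real_normed_vector"
  assumes inj: "inj \<Phi>" and fin: "finite A"
  shows "ennreal (riesz_energy s (\<Phi> ` A)) = pair_sum (\<lambda>x y. riesz_kernel s (\<Phi> x) (\<Phi> y)) A"
proof -
  have img: "{(x, y). x \<in> \<Phi> ` A \<and> y \<in> \<Phi> ` A \<and> x \<noteq> y} = map_prod \<Phi> \<Phi> ` offdiag A"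
  proof (intro equalityI subsetI)
    fix q assume "q \<in> {(x, y). x \<in> \<Phi> ` A \<and> y \<in> \<Phi> ` A \<and> x \<noteq> y}"
    then obtain a b where "a \<in> A" "b \<in> A" "q = map_prod \<Phi> \<Phi> (a, b)" "\<Phi> a \<noteq> \<Phi> b" by auto
    then show "q \<in> map_prod \<Phi> \<Phi> ` offdiag A"
      by (intro image_eqI[of _ _ "(a, b)"]) (auto simp: offdiag_def)
  next
    fix q assume "q \<in> map_prod \<Phi> \<Phi> ` offdiag A"
    then show "q \<in> {(x, y). x \<in> \<Phi> ` A \<and> y \<in> \<Phi> ` A \<and> x \<noteq> y}"
      using inj by (auto simp: offdiag_def inj_eq)
  qed
  have "riesz_energy s (\<Phi> ` A) = (\<Sum>p\<in>offdiag A. norm (\<Phi> (fst p) - \<Phi> (snd p)) powr (- s))"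
  proof -
    have i: "inj_on (map_prod \<Phi> \<Phi>) (offdiag A)"
      using prod.inj_map[OF inj inj] by (rule inj_on_subset) simp
    show ?thesis unfolding riesz_energy_def img sum.reindex[OF i] by (simp add: case_prod_unfold)
  qed
  then have "ennreal (riesz_energy s (\<Phi> ` A)) = (\<Sum>p\<in>offdiag A. riesz_kernel s (\<Phi> (fst p)) (\<Phi> (snd p)))"
    by (simp add: riesz_kernel_def sum_ennreal)
  also have "\<dots> = (\<integral>\<^sup>+p. riesz_kernel s (\<Phi> (fst p)) (\<Phi> (snd p)) \<partial>count_space (offdiag A))"
    by (rule nn_integral_count_space_finite[symmetric, OF finite_offdiag_iff[OF fin]])
  also have "\<dots> = pair_sum (\<lambda>x y. riesz_kernel s (\<Phi> x) (\<Phi> y)) A"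
    unfolding pair_sum_def by (rule nn_integral_count_space_indicator) simp
  finally show ?thesis .
qed

lemma proj_kernel_measurable: "(\<lambda>(z, w). proj_kernel L z w) \<in> borel_measurable (borel \<Otimes>\<^sub>M (borel :: (complex ^ 'd::finite) measure))"
  unfolding proj_kernel_def by measurable

lemma proj_kernel_det:
  fixes z w :: "complex ^ 'd::finite"
  shows "Re (proj_kernel L z z * proj_kernel L w w - proj_kernel L z w * proj_kernel L w z) =
    (real ((CARD('d) + L) choose CARD('d)))\<^sup>2 * fs_density z * fs_density w - (cmod (proj_kernel L z w))\<^sup>2"
proof -
  have "proj_kernel L z w * proj_kernel L w z = complex_of_real ((cmod (proj_kernel L z w))\<^sup>2)"
    unfolding proj_kernel_herm[of L z w, symmetric] complex_norm_square by (rule refl)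
  then show ?thesis
    unfolding proj_kernel_diag by (simp only: of_real_mult[symmetric] of_real_diff[symmetric] Re_complex_of_real)
      (simp add: power2_eq_square)
qed

text \<open>The determinant is the two-point intensity, and intensities are pointwise nonnegative.
  This is what later allows the two terms of the determinant to be separated inside
  \<open>[0, \<infinity>]\<close>.\<close>

lemma determinantal_nonneg:
  fixes K :: "'a::euclidean_space \<Rightarrow> 'a \<Rightarrow> complex"
  assumes dp: "determinantal_process P lborel X K"
  shows "0 \<le> Re (K x x * K y y - K x y * K y x)"
proof -
  obtain \<rho> where \<rho>: "joint_intensity P lborel X 2 \<rho>"
    "\<And>x. x \<in> space (\<Pi>\<^sub>M i\<in>{..<2::nat}. (lborel :: 'a measure)) \<Longrightarrow>
       complex_of_real (\<rho> x) = Determinant.det (Matrix.mat 2 2 (\<lambda>(i, j). K (x i) (x j)))"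
    using dp unfolding determinantal_process_def by (metis one_le_numeral)
  let ?x = "\<lambda>i\<in>{..<2::nat}. if i = 0 then x else y"
  have s: "?x \<in> space (\<Pi>\<^sub>M i\<in>{..<2::nat}. (lborel :: 'a measure))" by (simp add: space_PiM)
  have "complex_of_real (\<rho> ?x) = K x x * K y y - K x y * K y x"
    using \<rho>(2)[OF s] by (simp add: det_two)
  then have "Re (K x x * K y y - K x y * K y x) = \<rho> ?x" by (metis Re_complex_of_real)
  also have "\<dots> \<ge> 0" using \<rho>(1) s by (simp add: joint_intensity_def)
  finally show ?thesis .
qed

lemma nn_integral_fs_density: "(\<integral>\<^sup>+z. ennreal (fs_density (z :: complex ^ 'd::finite)) \<partial>lborel) = 1"
proof -
  have "(\<integral>\<^sup>+z. ennreal (fs_density (z :: complex ^ 'd)) \<partial>lborel) =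
    ennreal (1 / sphere_vol TYPE((complex ^ 'd) \<times> real)) * (\<integral>\<^sup>+p. 1 \<partial>(surface_measure :: ((complex ^ 'd) \<times> real) measure))"
    by (subst nn_integral_sphere_map[symmetric]) simp_all
  also have "(\<integral>\<^sup>+p. 1 \<partial>(surface_measure :: ((complex ^ 'd) \<times> real) measure)) = ennreal (sphere_vol TYPE((complex ^ 'd) \<times> real))"
    by (simp only: nn_integral_const emeasure_surface_space mult_1)
  finally show ?thesis
    using sphere_vol_pos[where 'a = "(complex ^ 'd) \<times> real"] by (simp flip: ennreal_mult)
qed

lemma projection_DPP_kernel:
  fixes X :: "'w \<Rightarrow> (complex ^ 'd::finite) set"
  assumes "projection_DPP P lborel (weighted_poly_space L) X"
  shows "determinantal_process P lborel X (proj_kernel L)"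
proof -
  obtain K where K: "reproducing_kernel lborel (weighted_poly_space L) K" "determinantal_process P lborel X K"
    using assms unfolding projection_DPP_def by blast
  then have "K = proj_kernel L" using reproducing_kernel_unique by blast
  with K show ?thesis by simp
qed

text \<open>The expected number of points is the integral of the diagonal of the kernel, which is N
  and hence finite.\<close>

lemma AE_finite_projection_DPP:
  fixes X :: "'w \<Rightarrow> (complex ^ 'd::finite) set"
  assumes dp: "determinantal_process P lborel X (proj_kernel L)"
  shows "AE w in P. finite (X w)"
proof -
  let ?N = "real ((CARD('d) + L) choose CARD('d))"
  have m: "(\<lambda>w. point_count (X w) UNIV) \<in> borel_measurable P"
    using dp by (simp add: determinantal_process_def point_process_def)
  have "(\<integral>\<^sup>+w. point_count (X w) UNIV \<partial>P) = (\<integral>\<^sup>+(z::complex^'d). indicator UNIV z * ennreal (Re (proj_kernel L z z)) \<partial>lborel)"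
    by (rule determinantal_intensity_1[OF dp]) (simp_all add: proj_kernel_diag)
  also have "\<dots> = (\<integral>\<^sup>+z. ennreal ?N * ennreal (fs_density (z :: complex ^ 'd)) \<partial>lborel)"
    by (simp add: proj_kernel_diag ennreal_mult fs_density_nonneg)
  also have "\<dots> = ennreal ?N" by (simp add: nn_integral_cmult nn_integral_fs_density)
  finally have "AE w in P. point_count (X w) UNIV \<noteq> \<infinity>"
    by (intro nn_integral_PInf_AE m) simp
  then show ?thesis
    by (rule eventually_mono) (auto simp: point_count_def emeasure_count_space split: if_splits)
qed

lemma expected_riesz_energy:
  fixes X :: "'w \<Rightarrow> (complex ^ 'd::finite) set"
  assumes dpp: "projection_DPP P lborel (weighted_poly_space L) X"
  shows "(\<lambda>w. riesz_energy s (sphere_config (X w))) \<in> borel_measurable P" (is ?meas)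
    and "(\<integral>\<^sup>+w. ennreal (riesz_energy s (sphere_config (X w))) \<partial>P) =
      (\<integral>\<^sup>+(z::complex^'d). (\<integral>\<^sup>+w. riesz_kernel s (sphere_map z) (sphere_map w) * ennreal
         ((real ((CARD('d) + L) choose CARD('d)))\<^sup>2 * fs_density z * fs_density w - (cmod (proj_kernel L z w))\<^sup>2) \<partial>lborel) \<partial>lborel)" (is ?int)
proof -
  have dp: "determinantal_process P lborel X (proj_kernel L)" by (rule projection_DPP_kernel[OF dpp])
  have sc: "sphere_config A = sphere_map ` A" for A :: "(complex ^ 'd) set"
    by (simp add: sphere_config_def sphere_map_def)
  let ?S = "\<lambda>w. pair_sum (\<lambda>x y. riesz_kernel s (sphere_map x) (sphere_map y)) (X w)"
  note [measurable] = proj_kernel_measurable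
  have Km: "(\<lambda>(x, y). Re (proj_kernel L x x * proj_kernel L y y - proj_kernel L x y * proj_kernel L y x))
    \<in> borel_measurable (borel \<Otimes>\<^sub>M (borel :: (complex ^ 'd) measure))"
    unfolding proj_kernel_det by measurable
  have Sint: "(\<integral>\<^sup>+w. ?S w \<partial>P) = (\<integral>\<^sup>+(x::complex^'d). (\<integral>\<^sup>+y. riesz_kernel s (sphere_map x) (sphere_map y) *
      ennreal (Re (proj_kernel L x x * proj_kernel L y y - proj_kernel L x y * proj_kernel L y x)) \<partial>lborel) \<partial>lborel)"
    by (rule expected_pair_sum(2)[OF dp Km borel_measurable_sphere_map sphere_map_inj]) (rule riesz_kernel_lsc)
  have m: "(\<lambda>w. point_count (X w) UNIV) \<in> borel_measurable P"
    using dp by (simp add: determinantal_process_def point_process_def)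
  have Sm: "?S \<in> borel_measurable P"
    by (rule expected_pair_sum(1)[OF dp Km borel_measurable_sphere_map sphere_map_inj]) (rule riesz_kernel_lsc)
  have fin: "finite (X w) \<longleftrightarrow> point_count (X w) UNIV < \<infinity>" for w
    by (simp add: point_count_def emeasure_count_space ennreal_of_nat_eq_real_of_nat)
  \<comment> \<open>The real-valued energy is 0 on infinite configurations, where the pair sum may
    differ. Expressing finiteness through the number of points makes the case distinction
    measurable.\<close>
  have re: "riesz_energy s (sphere_config (X w)) = (if point_count (X w) UNIV < \<infinity> then enn2real (?S w) else 0)" for w
  proof (cases "finite (X w)")
    case True
    have nn: "0 \<le> riesz_energy s (sphere_config (X w))"
      unfolding riesz_energy_def by (intro sum_nonneg) auto
    have "?S w = ennreal (riesz_energy s (sphere_config (X w)))"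
      unfolding sc by (rule riesz_energy_image[OF sphere_map_inj True, symmetric])
    then have "enn2real (?S w) = riesz_energy s (sphere_config (X w))"
      using nn by (simp only: enn2real_ennreal)
    then show ?thesis using True fin[of w] by simp
  next
    case False
    then have "infinite (sphere_config (X w))"
      unfolding sc finite_image_iff[OF inj_on_subset[OF sphere_map_inj subset_UNIV]] .
    then show ?thesis using False fin[of w] by (simp add: riesz_energy_infinite)
  qed
  show ?meas unfolding re using m Sm by measurable
  have "(\<integral>\<^sup>+w. ennreal (riesz_energy s (sphere_config (X w))) \<partial>P) = (\<integral>\<^sup>+w. ?S w \<partial>P)"
  proof (rule nn_integral_cong_AE)
    show "AE w in P. ennreal (riesz_energy s (sphere_config (X w))) = ?S w"
      using AE_finite_projection_DPP[OF dp]
      by (rule eventually_mono) (simp add: sc riesz_energy_image[OF sphere_map_inj])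
  qed
  then show ?int using Sint by (simp only: proj_kernel_det)
qed

section \<open>Rotation invariance and truncated Riesz integrals\<close>

text \<open>A linear isometry commutes with radial projection, so invariance is inherited from
  Lebesgue measure on the ball.\<close>

lemma nn_integral_surface_isometry:
  fixes f :: "'a::euclidean_space \<Rightarrow> ennreal" and T :: "'a \<Rightarrow> 'a"
  assumes lin: "linear T" and norm: "\<And>x. norm (T x) = norm x" and f[measurable]: "f \<in> borel_measurable borel"
  shows "(\<integral>\<^sup>+p. f (T p) \<partial>surface_measure) = (\<integral>\<^sup>+p. f p \<partial>surface_measure)"
proof -
  have Tm[measurable]: "T \<in> borel_measurable borel"
    using lin by (simp add: borel_measurable_continuous_onI linear_continuous_on linear_linear)
  let ?F = "\<lambda>x. indicator (cball 0 1 - {0}) x * f (x /\<^sub>R norm x)"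
  have "indicator (cball 0 1 - {0}) x * f (T (x /\<^sub>R norm x)) = ?F (T x)" for x
  proof -
    have "T x = 0 \<longleftrightarrow> x = 0" using norm[of x] by (metis norm_eq_zero)
    then have "T x \<in> cball 0 1 - {0} \<longleftrightarrow> x \<in> cball 0 1 - {0}" by (simp add: norm)
    moreover have "T (x /\<^sub>R norm x) = T x /\<^sub>R norm (T x)" by (simp add: norm linear_cmul[OF lin])
    ultimately show ?thesis by (simp only: indicator_def)
  qed
  moreover have "?F \<in> borel_measurable borel" by (rule borel_measurable_radial_projection[OF f])
  ultimately show ?thesis
    using nn_integral_lborel_isometry[OF lin norm, of ?F]
    by (simp add: nn_integral_surface_measure)
qed

text \<open>The Householder reflection in the hyperplane orthogonal to \<open>e - p\<close>.\<close>

lemma ex_isometry_moving: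
  fixes e p :: "'a::euclidean_space"
  assumes e: "norm e = 1" and p: "norm p = 1"
  obtains T :: "'a \<Rightarrow> 'a" where "linear T" "\<And>x. norm (T x) = norm x" "T e = p"
proof (cases "e = p")
  case True
  then show thesis using that[of id] by (simp add: linear_id)
next
  case False
  define v where "v = e - p"
  have v: "inner v v > 0" using False by (simp add: v_def)
  let ?T = "\<lambda>x. x - (2 * inner x v / inner v v) *\<^sub>R v"
  have "linear ?T"
    by (rule linearI) (simp_all add: inner_add_left algebra_simps add_divide_distrib scaleR_add_left)
  moreover have "norm (?T x) = norm x" for x
  proof -
    define c where "c = 2 * inner x v / inner v v"
    have "inner (x - c *\<^sub>R v) (x - c *\<^sub>R v) = inner x x - 2 * c * inner x v + c * (c * inner v v)"
      by (simp add: inner_diff_left inner_diff_right inner_commute algebra_simps)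
    also have "c * inner v v = 2 * inner x v" using v by (simp add: c_def)
    finally have "inner (x - c *\<^sub>R v) (x - c *\<^sub>R v) = inner x x" by simp
    then show ?thesis unfolding c_def[symmetric] norm_eq_sqrt_inner by simp
  qed
  moreover have "?T e = p"
  proof -
    have ee: "inner e e = 1" "inner p p = 1" using e p by (simp_all add: dot_square_norm)
    have "inner v v = 2 * inner e v"
      by (simp add: v_def inner_diff_left inner_diff_right inner_commute ee)
    then have "2 * inner e v / inner v v = 1" using v by simp
    then have "?T e = e - 1 *\<^sub>R v" by (simp only:)
    then show ?thesis by (simp add: v_def)
  qed
  ultimately show thesis by (rule that)
qed

definition local_riesz :: "real \<Rightarrow> real \<Rightarrow> 'a::euclidean_space \<Rightarrow> 'a \<Rightarrow> ennreal" where
  "local_riesz s \<delta> p q = riesz_kernel s p q * (if norm (p - q) < \<delta> then 1 else 0)"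

lemma riesz_kernel_measurable [measurable]:
  "(\<lambda>(p, q). riesz_kernel s p q) \<in> borel_measurable (borel \<Otimes>\<^sub>M (borel :: 'a::euclidean_space measure))"
  unfolding riesz_kernel_def by measurable

lemma local_riesz_measurable [measurable]:
  "(\<lambda>(p, q). local_riesz s \<delta> p q) \<in> borel_measurable (borel \<Otimes>\<^sub>M (borel :: 'a::euclidean_space measure))"
  unfolding local_riesz_def riesz_kernel_def by measurable

text \<open>An isometry carries the north pole to p, and the squared distance from the north pole to
  a point of height h is \<open>2 - 2 * h\<close>. In particular the value does not depend on p. The
  product \<open>\<delta> * \<bar>\<delta>\<bar>\<close> is a signed square, so that the condition
  correctly fails when \<delta> is not positive.\<close>

lemma nn_integral_local_riesz:
  fixes p :: "'a::euclidean_space \<times> real"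
  assumes p: "norm p = 1" and dim: "DIM('a) = 2 * d"
  shows "(\<integral>\<^sup>+q. local_riesz s \<delta> p q \<partial>surface_measure) = ennreal (sphere_vol TYPE('a)) *
    (\<integral>\<^sup>+h. ennreal ((2 - 2 * h) powr (- s / 2)) * (if 2 - 2 * h < \<delta> * \<bar>\<delta>\<bar> then 1 else 0) * ennreal ((1 - h\<^sup>2) ^ (d - 1)) * indicator {-1<..<1} h \<partial>lborel)"
proof -
  let ?e = "(0, 1) :: 'a \<times> real"
  have e: "norm ?e = 1" by (simp add: norm_Pair)
  obtain T :: "'a \<times> real \<Rightarrow> 'a \<times> real" where T: "linear T" "\<And>x. norm (T x) = norm x" "T ?e = p" by (rule ex_isometry_moving[OF e p]) blast
  have m: "(\<lambda>q. local_riesz s \<delta> x q) \<in> borel_measurable borel" for x :: "'a \<times> real"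
    using measurable_Pair2[OF local_riesz_measurable[where 'a = "'a \<times> real", of s \<delta>], of x] by simp
  have "(\<integral>\<^sup>+q. local_riesz s \<delta> p q \<partial>surface_measure) = (\<integral>\<^sup>+q. local_riesz s \<delta> p (T q) \<partial>surface_measure)"
    by (rule nn_integral_surface_isometry[OF T(1,2) m, symmetric])
  also have "\<dots> = (\<integral>\<^sup>+q. local_riesz s \<delta> ?e q \<partial>surface_measure)"
  proof (rule nn_integral_cong)
    fix q :: "'a \<times> real"
    have "norm (p - T q) = norm (?e - q)" unfolding T(3)[symmetric] linear_diff[OF T(1), symmetric] by (rule T(2))
    then show "local_riesz s \<delta> p (T q) = local_riesz s \<delta> ?e q" by (simp add: local_riesz_def riesz_kernel_def)
  qed
  also have "\<dots> = (\<integral>\<^sup>+\<theta>. (\<integral>\<^sup>+h. local_riesz s \<delta> ?e (sqrt (1 - h\<^sup>2) *\<^sub>R \<theta>, h) * ennreal ((1 - h\<^sup>2) ^ (d - 1)) * indicator {-1<..<1} h \<partial>lborel) \<partial>(surface_measure :: 'a measure))"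
    by (rule nn_integral_surface_measure_height[OF m dim])
  also have "\<dots> = (\<integral>\<^sup>+\<theta>. (\<integral>\<^sup>+h. ennreal ((2 - 2 * h) powr (- s / 2)) * (if 2 - 2 * h < \<delta> * \<bar>\<delta>\<bar> then 1 else 0) * ennreal ((1 - h\<^sup>2) ^ (d - 1)) * indicator {-1<..<1} h \<partial>lborel) \<partial>(surface_measure :: 'a measure))"
  proof (intro nn_integral_cong)
    fix \<theta> :: 'a and h :: real assume "\<theta> \<in> space surface_measure"
    then have \<theta>: "norm \<theta> = 1" by simp
    show "local_riesz s \<delta> ?e (sqrt (1 - h\<^sup>2) *\<^sub>R \<theta>, h) * ennreal ((1 - h\<^sup>2) ^ (d - 1)) * indicator {-1<..<1} h =
      ennreal ((2 - 2 * h) powr (- s / 2)) * (if 2 - 2 * h < \<delta> * \<bar>\<delta>\<bar> then 1 else 0) * ennreal ((1 - h\<^sup>2) ^ (d - 1)) * indicator {-1<..<1} h"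
    proof (cases "h \<in> {-1<..<1}")
      case True
      then have h: "-1 < h" "h < 1" by auto
      have h2: "h\<^sup>2 \<le> 1" using h unfolding abs_square_le_1 by linarith
      have "norm (?e - (sqrt (1 - h\<^sup>2) *\<^sub>R \<theta>, h)) = sqrt ((sqrt (1 - h\<^sup>2))\<^sup>2 + (1 - h)\<^sup>2)"
        using h2 by (simp add: norm_Pair \<theta>)
      also have "(sqrt (1 - h\<^sup>2))\<^sup>2 = 1 - h\<^sup>2" using h2 by simp
      also have "1 - h\<^sup>2 + (1 - h)\<^sup>2 = 2 - 2 * h" by (simp add: power2_eq_square algebra_simps)
      finally have n: "norm (?e - (sqrt (1 - h\<^sup>2) *\<^sub>R \<theta>, h)) = sqrt (2 - 2 * h)" .
      have "sqrt (2 - 2 * h) powr (- s) = (2 - 2 * h) powr (- s / 2)"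
        using h by (simp add: powr_half_sqrt[symmetric] powr_powr)
      moreover have "sqrt (2 - 2 * h) < \<delta> \<longleftrightarrow> 2 - 2 * h < \<delta> * \<bar>\<delta>\<bar>"
      proof (cases "\<delta> > 0")
        case True
        have "sqrt (2 - 2 * h) < \<delta> \<longleftrightarrow> 2 - 2 * h < \<delta>\<^sup>2"
          using True h real_sqrt_less_iff[of "2 - 2 * h" "\<delta>\<^sup>2"] by simp
        then show ?thesis using True by (simp add: power2_eq_square)
      next
        case False
        then have "\<delta> * \<bar>\<delta>\<bar> \<le> 0" by (simp add: mult_nonpos_nonneg)
        moreover have "0 \<le> sqrt (2 - 2 * h)" using h by simp
        ultimately show ?thesis using False h by linarith
      qed
      ultimately show ?thesis unfolding local_riesz_def riesz_kernel_def n by (simp only:)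
    qed simp
  qed
  also have "\<dots> = (\<integral>\<^sup>+h. ennreal ((2 - 2 * h) powr (- s / 2)) * (if 2 - 2 * h < \<delta> * \<bar>\<delta>\<bar> then 1 else 0) * ennreal ((1 - h\<^sup>2) ^ (d - 1)) * indicator {-1<..<1} h \<partial>lborel) * ennreal (sphere_vol TYPE('a))"
    by (simp only: nn_integral_const emeasure_surface_space)
  finally show ?thesis by (simp only: mult.commute)
qed

lemma nn_integral_powr_at_one:
  assumes x: "x > 0" and a: "a > 0"
  shows "(\<integral>\<^sup>+h. ennreal ((1 - h) powr (x - 1)) * indicator {1 - a<..<1} h \<partial>lborel) = ennreal (a powr x / x)"
proof -
  have "(\<integral>\<^sup>+h. ennreal ((1 - h) powr (x - 1)) * indicator {1 - a<..<1} h \<partial>lborel) =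
    ennreal \<bar>-1\<bar> * (\<integral>\<^sup>+u. ennreal ((1 - (1 + (-1) * u)) powr (x - 1)) * indicator {1 - a<..<1} (1 + (-1) * u) \<partial>lborel)"
    by (rule nn_integral_real_affine) auto
  also have "\<dots> = (\<integral>\<^sup>+u. ennreal (if u \<in> {0..a} then u powr (x - 1) else 0) \<partial>lborel)"
  proof -
    have "AE u in lborel. u \<noteq> 0 \<and> u \<noteq> a" by (intro AE_conjI AE_lborel_singleton)
    then have "AE u in lborel. ennreal ((1 - (1 + (-1) * u)) powr (x - 1)) * indicator {1 - a<..<1} (1 + (-1) * u) =
      ennreal (if u \<in> {0..a} then u powr (x - 1) else 0)"
      by (rule eventually_mono) (auto simp: indicator_def)
    from nn_integral_cong_AE[OF this] show ?thesis by simp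
  qed
  also have "\<dots> = ennreal (a powr x / x)"
  proof (rule nn_integral_has_integral_lborel)
    have "((\<lambda>u. u powr (x - 1)) has_integral (a powr (x - 1 + 1) / (x - 1 + 1))) {0..a}"
      using x a by (intro has_integral_powr_from_0) auto
    then show "((\<lambda>u. if u \<in> {0..a} then u powr (x - 1) else 0) has_integral (a powr x / x)) UNIV"
      by (subst has_integral_restrict_UNIV) simp
  qed auto
  finally show ?thesis .
qed

text \<open>Separates the power of \<open>1 - h\<close>, which carries the singularity at the pole,
  from the bounded factor \<open>(1 + h) ^ (d - 1)\<close>.\<close>

lemma cap_power_split:
  assumes h: "-1 < h" "h < 1" and d: "d > 0"
  shows "(2 - 2 * h) powr (- s / 2) * (1 - h\<^sup>2) ^ (d - 1) = 2 powr (- s / 2) * (1 + h) ^ (d - 1) * (1 - h) powr (real d - s / 2 - 1)"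
proof -
  have "1 - h\<^sup>2 = (1 - h) * (1 + h)" by (simp add: power2_eq_square algebra_simps)
  then have "(1 - h\<^sup>2) ^ (d - 1) = (1 - h) powr (real d - 1) * (1 + h) ^ (d - 1)"
    using h d by (simp add: power_mult_distrib powr_realpow[symmetric] of_nat_diff)
  moreover have "(2 - 2 * h) powr (- s / 2) = 2 powr (- s / 2) * (1 - h) powr (- s / 2)"
    using h powr_mult[of 2 "1 - h" "- s / 2"] by (simp add: algebra_simps)
  moreover have "(1 - h) powr (- s / 2) * (1 - h) powr (real d - 1) = (1 - h) powr (real d - s / 2 - 1)"
    by (simp add: powr_add[symmetric] algebra_simps)
  ultimately show ?thesis by (simp add: mult_ac)
qed

text \<open>The truncation is dropped and \<open>1 + h\<close> is bounded by 2; what remains is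
  integrable at the pole because \<open>d - s / 2\<close> is positive.\<close>

lemma nn_integral_local_riesz_le:
  fixes p :: "'a::euclidean_space \<times> real"
  assumes p: "norm p = 1" and dim: "DIM('a) = 2 * d" and s: "s < 2 * real d"
  shows "(\<integral>\<^sup>+q. local_riesz s \<delta> p q \<partial>surface_measure) \<le>
     ennreal (sphere_vol TYPE('a) * (2 powr (- s / 2) * 2 ^ (d - 1) * (2 powr (real d - s / 2) / (real d - s / 2))))"
proof -
  define x where "x = real d - s / 2"
  have x: "x > 0" using s by (simp add: x_def)
  have d: "d > 0" using dim DIM_positive[where 'a = 'a] by simp
  have "(\<integral>\<^sup>+h. ennreal ((2 - 2 * h) powr (- s / 2)) * (if 2 - 2 * h < \<delta> * \<bar>\<delta>\<bar> then 1 else 0) * ennreal ((1 - h\<^sup>2) ^ (d - 1)) * indicator {-1<..<1} h \<partial>lborel)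
    \<le> (\<integral>\<^sup>+h. ennreal (2 powr (- s / 2) * 2 ^ (d - 1)) * (ennreal ((1 - h) powr (x - 1)) * indicator {1 - 2<..<1} h) \<partial>lborel)"
  proof (rule nn_integral_mono)
    fix h :: real
    show "ennreal ((2 - 2 * h) powr (- s / 2)) * (if 2 - 2 * h < \<delta> * \<bar>\<delta>\<bar> then 1 else 0) * ennreal ((1 - h\<^sup>2) ^ (d - 1)) * indicator {-1<..<1} h
      \<le> ennreal (2 powr (- s / 2) * 2 ^ (d - 1)) * (ennreal ((1 - h) powr (x - 1)) * indicator {1 - 2<..<1} h)"
    proof (cases "h \<in> {-1<..<1}")
      case True
      then have h: "-1 < h" "h < 1" by auto
      have "ennreal ((2 - 2 * h) powr (- s / 2)) * (if 2 - 2 * h < \<delta> * \<bar>\<delta>\<bar> then 1 else 0) * ennreal ((1 - h\<^sup>2) ^ (d - 1))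
        \<le> ennreal ((2 - 2 * h) powr (- s / 2)) * 1 * ennreal ((1 - h\<^sup>2) ^ (d - 1))"
        by (intro mult_right_mono mult_left_mono) auto
      also have "\<dots> = ennreal (2 powr (- s / 2) * (1 + h) ^ (d - 1) * (1 - h) powr (x - 1))"
        using cap_power_split[OF h d, of s] cap_density_pos[OF h, of "d - 1"]
        by (simp add: x_def flip: ennreal_mult)
      also have "\<dots> \<le> ennreal (2 powr (- s / 2) * 2 ^ (d - 1) * (1 - h) powr (x - 1))"
        using h by (intro ennreal_leI mult_right_mono mult_left_mono power_mono) auto
      also have "\<dots> = ennreal (2 powr (- s / 2) * 2 ^ (d - 1)) * ennreal ((1 - h) powr (x - 1))"
        by (rule ennreal_mult) auto
      finally show ?thesis using True by simp
    qed simp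
  qed
  also have "\<dots> = ennreal (2 powr (- s / 2) * 2 ^ (d - 1)) * ennreal (2 powr x / x)"
    by (subst nn_integral_cmult, simp, subst nn_integral_powr_at_one[OF x]) simp_all
  also have "\<dots> = ennreal (2 powr (- s / 2) * 2 ^ (d - 1) * (2 powr x / x))"
    using x by (subst ennreal_mult) auto
  finally show ?thesis
    unfolding nn_integral_local_riesz[OF p dim] x_def[symmetric]
    using sphere_vol_pos[where 'a = 'a] x by (subst ennreal_mult) (auto intro!: mult_left_mono)
qed

text \<open>Within distance \<delta> of the pole \<open>1 - h < \<delta>^2 / 2\<close>, so
  \<open>1 + h\<close> is at least \<open>2 - \<delta>^2 / 2\<close>, and the power of
  \<open>1 - h\<close> integrates exactly. The estimate is sharp to leading order for small
  \<delta>.\<close>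

lemma nn_integral_local_riesz_ge:
  fixes p :: "'a::euclidean_space \<times> real"
  assumes p: "norm p = 1" and dim: "DIM('a) = 2 * d" and s: "s < 2 * real d" and \<delta>: "0 < \<delta>" "\<delta> \<le> 1"
  shows "ennreal (sphere_vol TYPE('a) * (2 powr (- s / 2) * (2 - \<delta>\<^sup>2 / 2) ^ (d - 1) * ((\<delta>\<^sup>2 / 2) powr (real d - s / 2) / (real d - s / 2))))
    \<le> (\<integral>\<^sup>+q. local_riesz s \<delta> p q \<partial>surface_measure)"
proof -
  define x where "x = real d - s / 2"
  have x: "x > 0" using s by (simp add: x_def)
  have d: "d > 0" using dim DIM_positive[where 'a = 'a] by simp
  define a where "a = \<delta>\<^sup>2 / 2"
  have "\<delta>\<^sup>2 \<le> 1" using \<delta> by (simp add: power_le_one)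
  then have a: "a > 0" "a \<le> 1" using \<delta> by (simp_all add: a_def)
  have "ennreal (2 powr (- s / 2) * (2 - a) ^ (d - 1) * (a powr x / x)) = ennreal (2 powr (- s / 2) * (2 - a) ^ (d - 1)) * ennreal (a powr x / x)"
    using x a by (intro ennreal_mult) auto
  also have "\<dots> = (\<integral>\<^sup>+h. ennreal (2 powr (- s / 2) * (2 - a) ^ (d - 1)) * (ennreal ((1 - h) powr (x - 1)) * indicator {1 - a<..<1} h) \<partial>lborel)"
    by (subst nn_integral_cmult, simp, subst nn_integral_powr_at_one[OF x a(1)]) simp_all
  also have "\<dots> \<le> (\<integral>\<^sup>+h. ennreal ((2 - 2 * h) powr (- s / 2)) * (if 2 - 2 * h < \<delta> * \<bar>\<delta>\<bar> then 1 else 0) * ennreal ((1 - h\<^sup>2) ^ (d - 1)) * indicator {-1<..<1} h \<partial>lborel)"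
  proof (rule nn_integral_mono)
    fix h :: real
    show "ennreal (2 powr (- s / 2) * (2 - a) ^ (d - 1)) * (ennreal ((1 - h) powr (x - 1)) * indicator {1 - a<..<1} h) \<le>
      ennreal ((2 - 2 * h) powr (- s / 2)) * (if 2 - 2 * h < \<delta> * \<bar>\<delta>\<bar> then 1 else 0) * ennreal ((1 - h\<^sup>2) ^ (d - 1)) * indicator {-1<..<1} h"
    proof (cases "h \<in> {1 - a<..<1}")
      case True
      then have h: "-1 < h" "h < 1" using a by auto
      have lt: "2 - 2 * h < \<delta> * \<bar>\<delta>\<bar>" using True \<delta> by (simp add: a_def power2_eq_square)
      have "ennreal (2 powr (- s / 2) * (2 - a) ^ (d - 1)) * ennreal ((1 - h) powr (x - 1)) =
        ennreal (2 powr (- s / 2) * (2 - a) ^ (d - 1) * (1 - h) powr (x - 1))"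
        using a by (intro ennreal_mult[symmetric]) auto
      also have "\<dots> \<le> ennreal (2 powr (- s / 2) * (1 + h) ^ (d - 1) * (1 - h) powr (x - 1))"
        using True a by (intro ennreal_leI mult_right_mono mult_left_mono power_mono) auto
      also have "\<dots> = ennreal ((2 - 2 * h) powr (- s / 2)) * ennreal ((1 - h\<^sup>2) ^ (d - 1))"
        using cap_power_split[OF h d, of s] cap_density_pos[OF h, of "d - 1"]
        by (simp add: x_def flip: ennreal_mult)
      finally show ?thesis using True h lt by simp
    qed simp
  qed
  finally show ?thesis
    unfolding nn_integral_local_riesz[OF p dim] x_def[symmetric] a_def[symmetric]
    using sphere_vol_pos[where 'a = 'a] x a by (subst ennreal_mult) (auto intro!: mult_left_mono)
qed

text \<open>Integration by parts: \<open>h * (1 - h^2) ^ (d - 1)\<close> vanishes at both ends, and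
  its derivative is the corresponding combination of the two densities.\<close>

lemma cap_integral_recurrence:
  assumes d: "d \<ge> 2"
  shows "(2 * real d - 2) * cap_integral (d - 1) 1 = (2 * real d - 1) * cap_integral d 1"
proof -
  let ?G = "\<lambda>h. (2 * real d - 1) * cap_integral d h - (2 * real d - 2) * cap_integral (d - 1) h - h * (1 - h\<^sup>2) ^ (d - 1)"
  obtain e where e: "d = Suc (Suc e)" using d by (metis Suc_le_D numeral_2_eq_2 Suc_le_mono)
  have "?G 1 = ?G (-1)"
  proof (rule DERIV_isconst_end[where f = ?G and a = "-1" and b = 1])
    show "continuous_on {-1..1} ?G"
      by (intro continuous_intros cap_integral_continuous)
    fix h :: real assume h: "-1 < h" "h < 1"
    have "((\<lambda>h. h * (1 - h\<^sup>2) ^ (d - 1)) has_real_derivative (1 - h\<^sup>2) ^ (d - 1) - h * (real (d - 1) * (1 - h\<^sup>2) ^ (d - 1 - 1) * (2 * h))) (at h)"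
      by (auto intro!: derivative_eq_intros)
    then have "(?G has_real_derivative (2 * real d - 1) * (1 - h\<^sup>2) ^ (d - 1) - (2 * real d - 2) * (1 - h\<^sup>2) ^ (d - 1 - 1)
      - ((1 - h\<^sup>2) ^ (d - 1) - h * (real (d - 1) * (1 - h\<^sup>2) ^ (d - 1 - 1) * (2 * h)))) (at h)"
      by (intro DERIV_diff DERIV_cmult cap_integral_deriv[OF h])
    moreover have "(2 * real d - 1) * (1 - h\<^sup>2) ^ (d - 1) - (2 * real d - 2) * (1 - h\<^sup>2) ^ (d - 1 - 1)
      - ((1 - h\<^sup>2) ^ (d - 1) - h * (real (d - 1) * (1 - h\<^sup>2) ^ (d - 1 - 1) * (2 * h))) = 0"
      unfolding e by (simp add: algebra_simps power2_eq_square)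
    ultimately show "(?G has_real_derivative 0) (at h)" by simp
  qed simp
  then show ?thesis using d by (simp add: power_0_left)
qed

text \<open>At height h the squared distance to the axis is \<open>1 - h^2\<close>, so division by
  it lowers the exponent of the density by one, and \<open>cap_integral_recurrence\<close> evaluates
  the quotient. For d = 1 the integral diverges.\<close>

lemma nn_integral_inverse_fst_sq:
  assumes dim: "DIM('a::euclidean_space) = 2 * d" and d: "d \<ge> 2"
  shows "(\<integral>\<^sup>+p. ennreal (1 / (norm (fst p))\<^sup>2) \<partial>(surface_measure :: ('a \<times> real) measure)) =
    ennreal (sphere_vol TYPE('a \<times> real) * ((2 * real d - 1) / (2 * real d - 2)))"
proof -
  have dim1: "d - 1 > 0" using d by simp
  have "(\<integral>\<^sup>+p. ennreal (1 / (norm (fst p))\<^sup>2) \<partial>(surface_measure :: ('a \<times> real) measure)) =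
    (\<integral>\<^sup>+\<theta>. (\<integral>\<^sup>+h. ennreal (1 / (norm (fst (sqrt (1 - h\<^sup>2) *\<^sub>R \<theta>, h)))\<^sup>2) * ennreal ((1 - h\<^sup>2) ^ (d - 1)) * indicator {-1<..<1} h \<partial>lborel) \<partial>(surface_measure :: 'a measure))"
    by (rule nn_integral_surface_measure_height[OF _ dim]) (simp add: borel_prod[symmetric])
  also have "\<dots> = (\<integral>\<^sup>+\<theta>. (\<integral>\<^sup>+h. ennreal ((1 - h\<^sup>2) ^ (d - 1 - 1)) * indicator {-1<..<1} h \<partial>lborel) \<partial>(surface_measure :: 'a measure))"
  proof (intro nn_integral_cong)
    fix \<theta> :: 'a and h :: real assume "\<theta> \<in> space surface_measure"
    then have \<theta>: "norm \<theta> = 1" by simp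
    show "ennreal (1 / (norm (fst (sqrt (1 - h\<^sup>2) *\<^sub>R \<theta>, h)))\<^sup>2) * ennreal ((1 - h\<^sup>2) ^ (d - 1)) * indicator {-1<..<1} h =
      ennreal ((1 - h\<^sup>2) ^ (d - 1 - 1)) * indicator {-1<..<1} h"
    proof (cases "h \<in> {-1<..<1}")
      case True
      then have h: "-1 < h" "h < 1" by auto
      have p: "1 - h\<^sup>2 > 0" using cap_density_pos[OF h, of 1] by simp
      have n: "(norm (fst (sqrt (1 - h\<^sup>2) *\<^sub>R \<theta>, h)))\<^sup>2 = 1 - h\<^sup>2" using p \<theta> by simp
      have "(1 - h\<^sup>2) ^ (d - 1) = (1 - h\<^sup>2) * (1 - h\<^sup>2) ^ (d - 1 - 1)"
        by (metis power_minus_mult[OF dim1] mult.commute)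
      then have "1 / (1 - h\<^sup>2) * (1 - h\<^sup>2) ^ (d - 1) = (1 - h\<^sup>2) ^ (d - 1 - 1)" using p by simp
      then have "ennreal (1 / (1 - h\<^sup>2)) * ennreal ((1 - h\<^sup>2) ^ (d - 1)) = ennreal ((1 - h\<^sup>2) ^ (d - 1 - 1))"
        using p by (subst ennreal_mult[symmetric]) auto
      then show ?thesis unfolding n by simp
    qed simp
  qed
  also have "\<dots> = ennreal (cap_integral (d - 1) 1) * ennreal (sphere_vol TYPE('a))"
    by (simp only: nn_integral_cap_density nn_integral_const emeasure_surface_space)
  also have "\<dots> = ennreal (cap_integral (d - 1) 1 * sphere_vol TYPE('a))"
    using cap_total_pos[of "d - 1"] sphere_vol_pos[where 'a = 'a] by (intro ennreal_mult[symmetric]) auto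
  also have "cap_integral (d - 1) 1 * sphere_vol TYPE('a) = sphere_vol TYPE('a \<times> real) * ((2 * real d - 1) / (2 * real d - 2))"
  proof -
    have "cap_integral (d - 1) 1 = cap_integral d 1 * ((2 * real d - 1) / (2 * real d - 2))"
      using cap_integral_recurrence[OF d] d by (simp add: field_simps)
    then show ?thesis unfolding sphere_vol_height[OF dim] by simp
  qed
  finally show ?thesis .
qed

section \<open>The continuous energy and the exact expectation\<close>

lemma measurable_borel_surface [measurable (raw)]:
  assumes "(\<lambda>(p, q). f p q) \<in> borel_measurable (borel \<Otimes>\<^sub>M (borel :: 'b::euclidean_space measure))"
  shows "(\<lambda>(p, q). f p q) \<in> borel_measurable ((borel :: 'a::euclidean_space measure) \<Otimes>\<^sub>M (surface_measure :: 'b measure))"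
proof -
  have "(\<lambda>x. x) \<in> measurable (surface_measure :: 'b measure) borel"
    by (rule borel_measurable_surface_measure) simp
  then have "(\<lambda>x. (fst x, snd x)) \<in> (borel :: 'a measure) \<Otimes>\<^sub>M (surface_measure :: 'b measure) \<rightarrow>\<^sub>M borel \<Otimes>\<^sub>M borel"
    by (intro measurable_Pair measurable_fst measurable_compose[OF measurable_snd])
  from measurable_compose[OF this assms] show ?thesis by (simp add: case_prod_unfold)
qed

lemma measurable_surface_surface:
  assumes "(\<lambda>(p, q). f p q) \<in> borel_measurable (borel \<Otimes>\<^sub>M (borel :: 'b::euclidean_space measure))"
  shows "(\<lambda>(p, q). f p q) \<in> borel_measurable ((surface_measure :: 'a::euclidean_space measure) \<Otimes>\<^sub>M (surface_measure :: 'b measure))"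
proof -
  have "(\<lambda>x. x) \<in> measurable (surface_measure :: 'a measure) borel"
    by (rule borel_measurable_surface_measure) simp
  then have "(\<lambda>x. (fst x, snd x)) \<in> (surface_measure :: 'a measure) \<Otimes>\<^sub>M (surface_measure :: 'b measure) \<rightarrow>\<^sub>M borel \<Otimes>\<^sub>M surface_measure"
    by (intro measurable_Pair measurable_snd measurable_compose[OF measurable_fst])
  from measurable_compose[OF this measurable_borel_surface[OF assms]] show ?thesis by (simp add: case_prod_unfold)
qed

lemma measurable_nn_integral_surface:
  assumes "(\<lambda>(p, q). f p q) \<in> borel_measurable (borel \<Otimes>\<^sub>M (borel :: 'b::euclidean_space measure))"
  shows "(\<lambda>p. \<integral>\<^sup>+q. f p q \<partial>(surface_measure :: 'b measure)) \<in> borel_measurable (borel :: 'a::euclidean_space measure)"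
  by (rule surface.borel_measurable_nn_integral) (rule measurable_borel_surface[OF assms])

lemma borel_measurable_nn_integral_lborel:
  fixes g :: "'a::euclidean_space \<Rightarrow> 'b::euclidean_space \<Rightarrow> ennreal"
  assumes g: "(\<lambda>(z, w). g z w) \<in> borel_measurable (borel \<Otimes>\<^sub>M borel)"
  shows "(\<lambda>z. \<integral>\<^sup>+w. g z w \<partial>lborel) \<in> borel_measurable lborel"
proof (rule lborel.borel_measurable_nn_integral)
    have eq: "sets ((lborel :: 'a measure) \<Otimes>\<^sub>M (lborel :: 'b measure)) = sets ((borel :: 'a measure) \<Otimes>\<^sub>M (borel :: 'b measure))"
      by (rule sets_pair_measure_cong) simp_all
    show "(\<lambda>(z, w). g z w) \<in> borel_measurable ((lborel :: 'a measure) \<Otimes>\<^sub>M (lborel :: 'b measure))"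
      by (subst measurable_cong_sets[OF eq refl]) (rule g)
qed

lemma nn_integral_sphere_map2:
  fixes f :: "(complex ^ 'd::finite) \<times> real \<Rightarrow> (complex ^ 'd) \<times> real \<Rightarrow> ennreal"
  assumes f: "(\<lambda>(p, q). f p q) \<in> borel_measurable (borel \<Otimes>\<^sub>M borel)"
  shows "(\<integral>\<^sup>+z. (\<integral>\<^sup>+w. f (sphere_map z) (sphere_map w) * ennreal (fs_density z * fs_density w) \<partial>lborel) \<partial>lborel) =
    ennreal (1 / (sphere_vol TYPE((complex ^ 'd) \<times> real))\<^sup>2) * (\<integral>\<^sup>+p. (\<integral>\<^sup>+q. f p q \<partial>surface_measure) \<partial>surface_measure)"
proof -
  let ?v = "sphere_vol TYPE((complex ^ 'd) \<times> real)"
  have v: "?v > 0" by (rule sphere_vol_pos)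
  have m: "f p \<in> borel_measurable borel" for p
    using measurable_Pair2[OF f, of p] by simp
  note [measurable] = borel_measurable_sphere_map
  have "(\<integral>\<^sup>+w. f (sphere_map z) (sphere_map w) * ennreal (fs_density z * fs_density w) \<partial>lborel) =
      ennreal (1 / ?v) * (\<integral>\<^sup>+q. f (sphere_map z) q \<partial>surface_measure) * ennreal (fs_density z)" for z :: "complex ^ 'd"
  proof -
    have [measurable]: "f (sphere_map z) \<in> borel_measurable borel" by (rule m)
    have "(\<integral>\<^sup>+w. f (sphere_map z) (sphere_map w) * ennreal (fs_density z * fs_density w) \<partial>lborel) =
      (\<integral>\<^sup>+w. ennreal (fs_density z) * (f (sphere_map z) (sphere_map w) * ennreal (fs_density w)) \<partial>lborel)"
      by (intro nn_integral_cong) (simp add: ennreal_mult fs_density_nonneg mult.left_commute)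
    also have "\<dots> = ennreal (fs_density z) * (ennreal (1 / ?v) * (\<integral>\<^sup>+q. f (sphere_map z) q \<partial>surface_measure))"
      by (subst nn_integral_cmult) (simp_all add: nn_integral_sphere_map)
    finally show ?thesis by (simp only: mult.assoc mult.commute)
  qed
  then have "(\<integral>\<^sup>+z. (\<integral>\<^sup>+w. f (sphere_map z) (sphere_map w) * ennreal (fs_density z * fs_density w) \<partial>lborel) \<partial>lborel) =
     (\<integral>\<^sup>+z. (\<lambda>p. ennreal (1 / ?v) * (\<integral>\<^sup>+q. f p q \<partial>surface_measure)) (sphere_map z) * ennreal (fs_density z) \<partial>lborel)"
    by simp
  also have "\<dots> = ennreal (1 / ?v) * (\<integral>\<^sup>+p. ennreal (1 / ?v) * (\<integral>\<^sup>+q. f p q \<partial>surface_measure) \<partial>surface_measure)"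
    by (rule nn_integral_sphere_map) (use measurable_nn_integral_surface[OF f] in measurable)
  also have "\<dots> = ennreal (1 / ?v) * (ennreal (1 / ?v) * (\<integral>\<^sup>+p. (\<integral>\<^sup>+q. f p q \<partial>surface_measure) \<partial>surface_measure))"
    by (subst nn_integral_cmult) (rule borel_measurable_surface_measure[OF measurable_nn_integral_surface[OF f]], rule refl)
  also have "\<dots> = ennreal (1 / ?v\<^sup>2) * (\<integral>\<^sup>+p. (\<integral>\<^sup>+q. f p q \<partial>surface_measure) \<partial>surface_measure)"
    using v by (simp add: mult.assoc[symmetric] ennreal_mult[symmetric] power2_eq_square)
  finally show ?thesis .
qed

text \<open>The formula \<open>nn_integral_local_riesz\<close> has no p on its right side, and
  \<open>nn_integral_local_riesz_le\<close> makes it finite.\<close>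

lemma ex_local_riesz_mass:
  assumes dim: "DIM('a::euclidean_space) = 2 * d" and s: "s < 2 * real d"
  obtains M where "M \<ge> 0" "\<And>p :: 'a \<times> real. norm p = 1 \<Longrightarrow> (\<integral>\<^sup>+q. local_riesz s \<delta> p q \<partial>surface_measure) = ennreal M"
proof -
  let ?p = "(0, 1) :: 'a \<times> real"
  have e: "norm ?p = 1" by (simp add: norm_Pair)
  let ?I = "\<integral>\<^sup>+q. local_riesz s \<delta> ?p q \<partial>surface_measure"
  have "?I \<noteq> \<top>" using nn_integral_local_riesz_le[OF e dim s, of \<delta>] by (auto simp: top_unique)
  then have I: "?I = ennreal (enn2real ?I)" by (simp only: ennreal_enn2real_if if_False)
  have "(\<integral>\<^sup>+q. local_riesz s \<delta> p q \<partial>surface_measure) = ?I" if "norm p = 1" for p :: "'a \<times> real"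
    unfolding nn_integral_local_riesz[OF that dim] nn_integral_local_riesz[OF e dim] by (rule refl)
  from trans[OF this I] show thesis by (rule that[OF enn2real_nonneg])
qed

text \<open>Distances on the unit sphere are at most 2, so truncation at 3 removes nothing and the
  inner integral is one finite constant for all p. Thus the Bochner integral in
  \<open>riesz_V\<close> agrees with the nonnegative one.\<close>

lemma nn_integral_riesz_kernel:
  assumes dim: "DIM('a::euclidean_space) = 2 * d" and s: "s < 2 * real d"
  shows "(\<integral>\<^sup>+p. (\<integral>\<^sup>+q. riesz_kernel s p q \<partial>(surface_measure :: ('a \<times> real) measure)) \<partial>surface_measure) =
    ennreal ((sphere_vol TYPE('a \<times> real))\<^sup>2 * riesz_V TYPE('a \<times> real) s)"
    and "0 \<le> riesz_V TYPE('a \<times> real) s"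
proof -
  let ?\<sigma> = "surface_measure :: ('a \<times> real) measure" and ?v = "sphere_vol TYPE('a \<times> real)"
  let ?I = "\<integral>\<^sup>+p. (\<integral>\<^sup>+q. riesz_kernel s p q \<partial>?\<sigma>) \<partial>?\<sigma>"
  have v: "?v > 0" by (rule sphere_vol_pos)
  obtain M where M: "M \<ge> 0" "\<And>p :: 'a \<times> real. norm p = 1 \<Longrightarrow> (\<integral>\<^sup>+q. local_riesz s 3 p q \<partial>surface_measure) = ennreal M"
    using ex_local_riesz_mass[where 'a = 'a, OF dim s] by blast
  have "?I = (\<integral>\<^sup>+p. (\<integral>\<^sup>+q. local_riesz s 3 p q \<partial>?\<sigma>) \<partial>?\<sigma>)"
  proof (intro nn_integral_cong)
    fix p q :: "'a \<times> real" assume "p \<in> space ?\<sigma>" "q \<in> space ?\<sigma>"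
    then have "norm (p - q) < 3" using norm_triangle_ineq4[of p q] by simp
    then show "riesz_kernel s p q = local_riesz s 3 p q" by (simp add: local_riesz_def)
  qed
  also have "\<dots> = (\<integral>\<^sup>+p. ennreal M \<partial>?\<sigma>)" by (intro nn_integral_cong M) simp
  also have "\<dots> = ennreal (M * ?v)"
    using v M(1) by (simp only: nn_integral_const emeasure_surface_space ennreal_mult less_imp_le)
  finally have I: "?I = ennreal (M * ?v)" .
  have meas: "(\<lambda>(p, q). riesz_kernel s p q) \<in> borel_measurable (?\<sigma> \<Otimes>\<^sub>M ?\<sigma>)"
    by (rule measurable_surface_surface) measurable
  have "(\<lambda>(p, q). norm (p - q) powr (- s)) \<in> borel_measurable (?\<sigma> \<Otimes>\<^sub>M ?\<sigma>)"
    using borel_measurable_enn2real[OF meas] by (simp add: case_prod_unfold riesz_kernel_def)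
  then have "(\<integral>(p, q). norm (p - q) powr (- s) \<partial>(?\<sigma> \<Otimes>\<^sub>M ?\<sigma>)) =
     enn2real (\<integral>\<^sup>+x. ennreal ((\<lambda>(p, q). norm (p - q) powr (- s)) x) \<partial>(?\<sigma> \<Otimes>\<^sub>M ?\<sigma>))"
    by (intro integral_eq_nn_integral) auto
  also have "(\<integral>\<^sup>+x. ennreal ((\<lambda>(p, q). norm (p - q) powr (- s)) x) \<partial>(?\<sigma> \<Otimes>\<^sub>M ?\<sigma>)) = (\<integral>\<^sup>+x. (\<lambda>(p, q). riesz_kernel s p q) x \<partial>(?\<sigma> \<Otimes>\<^sub>M ?\<sigma>))"
    by (intro nn_integral_cong) (auto simp: riesz_kernel_def)
  also have "\<dots> = ?I"
    by (subst surface.nn_integral_fst[symmetric, OF meas]) simp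
  finally have "(\<integral>(p, q). norm (p - q) powr (- s) \<partial>(?\<sigma> \<Otimes>\<^sub>M ?\<sigma>)) = M * ?v"
    unfolding I using M(1) v by simp
  then have V: "riesz_V TYPE('a \<times> real) s = 1 / ?v\<^sup>2 * (M * ?v)" unfolding riesz_V_def by (simp only:)
  show "?I = ennreal (?v\<^sup>2 * riesz_V TYPE('a \<times> real) s)" unfolding I V using v by simp
  show "0 \<le> riesz_V TYPE('a \<times> real) s" unfolding V using v M(1) by simp
qed

text \<open>The repulsion term T, by which the expected energy falls short of
  \<open>V * N^2\<close>. An infinite integral would be sent to 0 by \<open>enn2real\<close>;
  finiteness is established in \<open>nn_integral_riesz_kernel_proj_kernel\<close>.\<close>

definition kernel_energy :: "real \<Rightarrow> nat \<Rightarrow> (complex ^ 'd::finite) itself \<Rightarrow> real" where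
  "kernel_energy s L _ = enn2real (\<integral>\<^sup>+(z::complex^'d). (\<integral>\<^sup>+w. riesz_kernel s (sphere_map z) (sphere_map w) *
     ennreal ((cmod (proj_kernel L z w))\<^sup>2) \<partial>lborel) \<partial>lborel)"


lemma nn_integral_riesz_kernel_sphere_map:
  fixes L :: nat
  defines "N \<equiv> real ((CARD('d::finite) + L) choose CARD('d))"
  assumes s: "s < 2 * real CARD('d)"
  shows "(\<integral>\<^sup>+(z::complex^'d). (\<integral>\<^sup>+w. riesz_kernel s (sphere_map z) (sphere_map w) * ennreal (N\<^sup>2 * fs_density z * fs_density w) \<partial>lborel) \<partial>lborel) =
    ennreal (riesz_V TYPE((complex ^ 'd) \<times> real) s * N\<^sup>2)"
proof -
  let ?v = "sphere_vol TYPE((complex ^ 'd) \<times> real)" and ?V = "riesz_V TYPE((complex ^ 'd) \<times> real) s"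
  have v: "?v > 0" by (rule sphere_vol_pos)
  have V: "?V \<ge> 0" by (rule nn_integral_riesz_kernel(2)[OF DIM_complex_vec s])
  have "(\<integral>\<^sup>+(z::complex^'d). (\<integral>\<^sup>+w. riesz_kernel s (sphere_map z) (sphere_map w) * ennreal (N\<^sup>2 * fs_density z * fs_density w) \<partial>lborel) \<partial>lborel) =
    (\<integral>\<^sup>+(z::complex^'d). (\<integral>\<^sup>+w. (ennreal (N\<^sup>2) * riesz_kernel s (sphere_map z) (sphere_map w)) * ennreal (fs_density z * fs_density w) \<partial>lborel) \<partial>lborel)"
    by (intro nn_integral_cong) (simp add: ennreal_mult fs_density_nonneg mult_ac)
  also have "\<dots> = ennreal (1 / ?v\<^sup>2) * (\<integral>\<^sup>+p. (\<integral>\<^sup>+q. ennreal (N\<^sup>2) * riesz_kernel s p q \<partial>(surface_measure :: ((complex^'d) \<times> real) measure)) \<partial>surface_measure)"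
    by (rule nn_integral_sphere_map2[where f = "\<lambda>p q. ennreal (N\<^sup>2) * riesz_kernel s p q"]) measurable
  also have "(\<integral>\<^sup>+p. (\<integral>\<^sup>+q. ennreal (N\<^sup>2) * riesz_kernel s p q \<partial>(surface_measure :: ((complex^'d) \<times> real) measure)) \<partial>surface_measure) =
    (\<integral>\<^sup>+p. ennreal (N\<^sup>2) * (\<integral>\<^sup>+q. riesz_kernel s p q \<partial>(surface_measure :: ((complex^'d) \<times> real) measure)) \<partial>surface_measure)"
    by (intro nn_integral_cong nn_integral_cmult borel_measurable_surface_measure) (simp add: riesz_kernel_def)
  also have "\<dots> = ennreal (N\<^sup>2) * (\<integral>\<^sup>+p. (\<integral>\<^sup>+q. riesz_kernel s p q \<partial>(surface_measure :: ((complex^'d) \<times> real) measure)) \<partial>surface_measure)"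
    by (intro nn_integral_cmult borel_measurable_surface_measure measurable_nn_integral_surface) measurable
  also have "\<dots> = ennreal (N\<^sup>2) * ennreal (?v\<^sup>2 * ?V)"
    by (simp only: nn_integral_riesz_kernel(1)[OF DIM_complex_vec s])
  also have "ennreal (1 / ?v\<^sup>2) * (ennreal (N\<^sup>2) * ennreal (?v\<^sup>2 * ?V)) = ennreal (1 / ?v\<^sup>2 * (N\<^sup>2 * (?v\<^sup>2 * ?V)))"
    using V by (subst ennreal_mult[symmetric], simp, simp, subst ennreal_mult[symmetric]) simp_all
  also have "1 / ?v\<^sup>2 * (N\<^sup>2 * (?v\<^sup>2 * ?V)) = ?V * N\<^sup>2" using v by simp
  finally show ?thesis .
qed

lemma add_eq_ennrealD:
  assumes "a + b = ennreal c" "c \<ge> 0"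
  shows "a < \<top>" "b < \<top>" "enn2real a = c - enn2real b"
proof -
  have ab: "a + b < \<top>" unfolding assms(1) by simp
  show a: "a < \<top>" by (rule le_less_trans[OF _ ab]) simp
  show b: "b < \<top>" by (rule le_less_trans[OF _ ab]) simp
  have "enn2real (a + b) = c" unfolding assms(1) using assms(2) by simp
  then show "enn2real a = c - enn2real b" unfolding enn2real_plus[OF a b] by simp
qed

text \<open>Since the two-point intensity is nonnegative, expected energy and T can be added inside
  \<open>[0, \<infinity>]\<close>, where their sum is the product term \<open>V * N^2\<close>. Hence
  both are finite, and only then is the difference taken.\<close>

lemma
  fixes L :: nat and X :: "'w \<Rightarrow> (complex ^ 'd::finite) set"
  defines "N \<equiv> real ((CARD('d) + L) choose CARD('d))"
  assumes dpp: "projection_DPP P lborel (weighted_poly_space L) X" and s: "s < 2 * real CARD('d)"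
  shows nn_integral_riesz_kernel_proj_kernel: "(\<integral>\<^sup>+(z::complex^'d). (\<integral>\<^sup>+w. riesz_kernel s (sphere_map z) (sphere_map w) *
      ennreal ((cmod (proj_kernel L z w))\<^sup>2) \<partial>lborel) \<partial>lborel) = ennreal (kernel_energy s L TYPE(complex ^ 'd))" (is "?T = _")
    and integrable_riesz_energy: "integrable P (\<lambda>w. riesz_energy s (sphere_config (X w)))"
    and integral_riesz_energy: "(\<integral>w. riesz_energy s (sphere_config (X w)) \<partial>P) =
      riesz_V TYPE((complex ^ 'd) \<times> real) s * N\<^sup>2 - kernel_energy s L TYPE(complex ^ 'd)"
proof -
  let ?V = "riesz_V TYPE((complex ^ 'd) \<times> real) s"
  let ?f = "\<lambda>w. riesz_energy s (sphere_config (X w))"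
  let ?k = "\<lambda>z w :: complex ^ 'd. riesz_kernel s (sphere_map z) (sphere_map w)"
  have V: "?V \<ge> 0" by (rule nn_integral_riesz_kernel(2)[OF DIM_complex_vec s])
  have f: "?f \<in> borel_measurable P" "0 \<le> ?f w" for w
    by (rule expected_riesz_energy(1)[OF dpp]) (auto simp: riesz_energy_def intro!: sum_nonneg)
  have dens: "0 \<le> N\<^sup>2 * fs_density z * fs_density w - (cmod (proj_kernel L z w))\<^sup>2" for z w :: "complex ^ 'd"
    using determinantal_nonneg[OF projection_DPP_kernel[OF dpp], of z w] unfolding proj_kernel_det N_def .
  note [measurable] = proj_kernel_measurable borel_measurable_sphere_map
  have km [measurable]: "(\<lambda>(z, w). ?k z w) \<in> borel_measurable (borel \<Otimes>\<^sub>M borel)"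
    unfolding riesz_kernel_def by measurable
  let ?E = "\<integral>\<^sup>+w. ennreal (?f w) \<partial>P"
  let ?g = "\<lambda>z w. ?k z w * ennreal (N\<^sup>2 * fs_density z * fs_density w - (cmod (proj_kernel L z w))\<^sup>2)"
  let ?h = "\<lambda>z w. ?k z w * ennreal ((cmod (proj_kernel L z w))\<^sup>2)"
  have gm [measurable]: "(\<lambda>(z, w). ?g z w) \<in> borel_measurable (borel \<Otimes>\<^sub>M borel)" by measurable
  have hm [measurable]: "(\<lambda>(z, w). ?h z w) \<in> borel_measurable (borel \<Otimes>\<^sub>M borel)" by measurable
  have E: "?E = (\<integral>\<^sup>+z. (\<integral>\<^sup>+w. ?g z w \<partial>lborel) \<partial>lborel)"
    unfolding N_def by (rule expected_riesz_energy(2)[OF dpp])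
  have inner: "(\<lambda>z. \<integral>\<^sup>+w. g z w \<partial>lborel) \<in> borel_measurable lborel"
    if "(\<lambda>(z, w). g z w) \<in> borel_measurable (borel \<Otimes>\<^sub>M borel)" for g :: "complex ^ 'd \<Rightarrow> complex ^ 'd \<Rightarrow> ennreal"
    by (rule borel_measurable_nn_integral_lborel[OF that])
  have inner': "g z \<in> borel_measurable lborel"
    if "(\<lambda>(z, w). g z w) \<in> borel_measurable (borel \<Otimes>\<^sub>M borel)" for z and g :: "complex ^ 'd \<Rightarrow> complex ^ 'd \<Rightarrow> ennreal"
    using measurable_Pair2[OF that, of z] by simp
  have "?E + ?T = (\<integral>\<^sup>+z. ((\<integral>\<^sup>+w. ?g z w \<partial>lborel) + (\<integral>\<^sup>+w. ?h z w \<partial>lborel)) \<partial>lborel)"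
    unfolding E by (rule nn_integral_add[symmetric, OF inner[OF gm] inner[OF hm]])
  also have "\<dots> = (\<integral>\<^sup>+z. (\<integral>\<^sup>+w. ?g z w + ?h z w \<partial>lborel) \<partial>lborel)"
    by (intro nn_integral_cong nn_integral_add[symmetric] inner'[OF gm] inner'[OF hm])
  also have "\<dots> = (\<integral>\<^sup>+z. (\<integral>\<^sup>+w. ?k z w * ennreal (N\<^sup>2 * fs_density z * fs_density w) \<partial>lborel) \<partial>lborel)"
  proof (intro nn_integral_cong)
    fix z w :: "complex ^ 'd"
    have "?g z w + ?h z w = ?k z w * (ennreal (N\<^sup>2 * fs_density z * fs_density w - (cmod (proj_kernel L z w))\<^sup>2) + ennreal ((cmod (proj_kernel L z w))\<^sup>2))"
      by (simp only: distrib_left)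
    also have "ennreal (N\<^sup>2 * fs_density z * fs_density w - (cmod (proj_kernel L z w))\<^sup>2) + ennreal ((cmod (proj_kernel L z w))\<^sup>2) =
      ennreal (N\<^sup>2 * fs_density z * fs_density w)"
      by (subst ennreal_plus[symmetric]) (use dens[of z w] in auto)
    finally show "?g z w + ?h z w = ?k z w * ennreal (N\<^sup>2 * fs_density z * fs_density w)" .
  qed
  also have "\<dots> = ennreal (?V * N\<^sup>2)"
    unfolding N_def by (rule nn_integral_riesz_kernel_sphere_map[OF s])
  finally have sum: "?E + ?T = ennreal (?V * N\<^sup>2)" .
  note fin = add_eq_ennrealD[OF sum mult_nonneg_nonneg[OF V zero_le_power2]]
  show T: "?T = ennreal (kernel_energy s L TYPE(complex ^ 'd))"
    unfolding kernel_energy_def by (rule ennreal_enn2real[OF fin(2), symmetric])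
  show int: "integrable P ?f"
    by (rule integrableI_nonneg[OF f(1) AE_I2[OF f(2)] fin(1)[folded infinity_ennreal_def]])
  have "(\<integral>w. ?f w \<partial>P) = enn2real ?E"
    by (rule integral_eq_nn_integral[OF f(1) AE_I2[OF f(2)]])
  then show "(\<integral>w. ?f w \<partial>P) = ?V * N\<^sup>2 - kernel_energy s L TYPE(complex ^ 'd)"
    unfolding kernel_energy_def fin(3) .
qed

section \<open>Lower bound for the repulsion term\<close>

text \<open>The convex function \<open>Y ^ L\<close> lies above its tangent at
  \<open>u = 1 - c / L\<close>, by Bernoulli's inequality for \<open>Y / u\<close>; then
  \<open>1 - Y\<close> is replaced by the larger X. A tangent point at distance of order
  \<open>1 / L\<close> from 1 keeps \<open>u ^ L\<close> from vanishing in the limit.\<close>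

lemma power_lower_bound:
  fixes X Y c :: real
  assumes Y: "0 \<le> Y" "1 - X \<le> Y" and c: "0 < c" "c < real L"
  shows "(1 - c / real L) ^ (L - 1) * (1 - c / real L + c) \<le> Y ^ L + real L * (1 - c / real L) ^ (L - 1) * X"
proof -
  define u where "u = 1 - c / real L"
  have L: "real L > 0" using c by linarith
  have u: "u > 0" using c L by (simp add: u_def)
  have uL: "real L * u = real L - c" using L by (simp add: u_def right_diff_distrib)
  have "u ^ L * (1 + real L * (Y / u - 1)) \<le> u ^ L * (1 + (Y / u - 1)) ^ L"
    using u Y by (intro mult_left_mono Bernoulli_inequality) simp_all
  also have "\<dots> = Y ^ L" using u by (simp add: power_divide)
  finally have *: "u ^ L * (1 + real L * (Y / u - 1)) \<le> Y ^ L" .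
  have "u ^ L = u ^ (L - 1) * u" using L by (intro power_minus_mult[symmetric]) simp
  then have "u ^ L * (1 + real L * (Y / u - 1)) = u ^ (L - 1) * (u * (1 + real L * (Y / u - 1)))" by simp
  also have "u * (1 + real L * (Y / u - 1)) = u + real L * Y - real L * u"
    using u by (simp add: distrib_left right_diff_distrib)
  also have "\<dots> = u + c - real L * (1 - Y)" unfolding uL by (simp add: right_diff_distrib)
  finally have **: "u ^ (L - 1) * (u + c - real L * (1 - Y)) \<le> Y ^ L" using * by simp
  have "u ^ (L - 1) * (u + c - real L * X) \<le> u ^ (L - 1) * (u + c - real L * (1 - Y))"
    using u L Y by (intro mult_left_mono diff_left_mono) simp_all
  then have "u ^ (L - 1) * (u + c) - u ^ (L - 1) * (real L * X) \<le> Y ^ L" using ** by (simp add: right_diff_distrib)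
  then show ?thesis unfolding u_def[symmetric] by (simp add: mult_ac)
qed

lemma local_riesz_commute: "local_riesz s \<delta> p q = local_riesz s \<delta> q p"
  by (simp add: local_riesz_def riesz_kernel_def norm_minus_commute)

lemma local_riesz_measurable1: "(\<lambda>q. local_riesz s \<delta> (p :: 'a::euclidean_space) q) \<in> borel_measurable (surface_measure :: 'a measure)"
  using measurable_Pair2[OF local_riesz_measurable[where 'a = 'a, of s \<delta>], of p]
  by (intro borel_measurable_surface_measure) simp

lemma inverse_fst_measurable:
  "(\<lambda>p. ennreal (c / (norm (fst p))\<^sup>2)) \<in> borel_measurable (borel :: ('a::euclidean_space \<times> real) measure)"
  by (simp add: borel_prod[symmetric])

text \<open>The kernel has the same mass M around every p and, being symmetric, around every q. Each
  of the two inverse squares therefore contributes M times the integral of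
  \<open>nn_integral_inverse_fst_sq\<close>.\<close>

lemma
  fixes c M :: real
  assumes dim: "DIM('a::euclidean_space) = 2 * d"
    and M: "M \<ge> 0" "\<And>p :: 'a \<times> real. norm p = 1 \<Longrightarrow> (\<integral>\<^sup>+q. local_riesz s \<delta> p q \<partial>surface_measure) = ennreal M"
    and c: "c \<ge> 0"
  shows nn_integral_local_riesz_const: "(\<integral>\<^sup>+p. (\<integral>\<^sup>+q. local_riesz s \<delta> p q * ennreal c \<partial>(surface_measure :: ('a \<times> real) measure)) \<partial>surface_measure)
      = ennreal (c * M * sphere_vol TYPE('a \<times> real))" (is ?const)
    and nn_integral_local_riesz_inverse_fst: "d \<ge> 2 \<Longrightarrow>
      (\<integral>\<^sup>+p. (\<integral>\<^sup>+q. local_riesz s \<delta> p q * ennreal (c * (1 / (norm (fst p))\<^sup>2 + 1 / (norm (fst q))\<^sup>2)) \<partial>(surface_measure :: ('a \<times> real) measure)) \<partial>surface_measure)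
      = ennreal (2 * c * M * sphere_vol TYPE('a \<times> real) * ((2 * real d - 1) / (2 * real d - 2)))"
proof -
  let ?\<sigma> = "surface_measure :: ('a \<times> real) measure" and ?v = "sphere_vol TYPE('a \<times> real)"
  have v: "?v > 0" by (rule sphere_vol_pos)
  interpret pair_sigma_finite ?\<sigma> ?\<sigma> ..
  have int: "(\<integral>\<^sup>+q. local_riesz s \<delta> p q * C \<partial>?\<sigma>) = ennreal M * C" if "p \<in> space ?\<sigma>" for p C
    by (subst nn_integral_multc[OF local_riesz_measurable1]) (use M(2) that in simp)
  have "(\<integral>\<^sup>+p. (\<integral>\<^sup>+q. local_riesz s \<delta> p q * ennreal c \<partial>?\<sigma>) \<partial>?\<sigma>) = (\<integral>\<^sup>+p. ennreal M * ennreal c \<partial>?\<sigma>)"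
    by (rule nn_integral_cong) (rule int)
  also have "\<dots> = ennreal M * ennreal c * ennreal ?v"
    by (simp only: nn_integral_const emeasure_surface_space)
  also have "\<dots> = ennreal (c * M * ?v)"
    using M(1) c v by (simp only: ennreal_mult mult_nonneg_nonneg less_imp_le mult.commute)
  finally show ?const .
  assume d: "d \<ge> 2"
  let ?r = "(2 * real d - 1) / (2 * real d - 2)"
  have r: "?r \<ge> 0" using d by (intro divide_nonneg_nonneg) simp_all
  let ?g = "\<lambda>p :: 'a \<times> real. ennreal (c / (norm (fst p))\<^sup>2)"
  have gm: "?g \<in> borel_measurable ?\<sigma>" by (intro borel_measurable_surface_measure inverse_fst_measurable)
  have m1: "(\<lambda>(p, q). local_riesz s \<delta> p q * ?g p) \<in> borel_measurable (borel \<Otimes>\<^sub>M (borel :: ('a \<times> real) measure))"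
    and m2: "(\<lambda>(p, q). local_riesz s \<delta> p q * ?g q) \<in> borel_measurable (borel \<Otimes>\<^sub>M (borel :: ('a \<times> real) measure))"
    using inverse_fst_measurable[where 'a = 'a, of c] by measurable
  have "(\<integral>\<^sup>+p. ?g p \<partial>?\<sigma>) = (\<integral>\<^sup>+p. ennreal c * ennreal (1 / (norm (fst p))\<^sup>2) \<partial>?\<sigma>)"
    using c by (intro nn_integral_cong) (simp flip: ennreal_mult)
  also have "\<dots> = ennreal c * ennreal (?v * ?r)"
    by (subst nn_integral_cmult[OF borel_measurable_surface_measure[OF inverse_fst_measurable]])
       (simp only: nn_integral_inverse_fst_sq[OF dim d])
  finally have g: "(\<integral>\<^sup>+p. ?g p \<partial>?\<sigma>) = ennreal (c * (?v * ?r))" using c v r by (intro trans[OF _ ennreal_mult[symmetric]] mult_nonneg_nonneg) (simp_all only: less_imp_le)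
  have I1: "(\<integral>\<^sup>+p. (\<integral>\<^sup>+q. local_riesz s \<delta> p q * ?g p \<partial>?\<sigma>) \<partial>?\<sigma>) = ennreal (M * (c * (?v * ?r)))"
  proof -
    have "(\<integral>\<^sup>+p. (\<integral>\<^sup>+q. local_riesz s \<delta> p q * ?g p \<partial>?\<sigma>) \<partial>?\<sigma>) = (\<integral>\<^sup>+p. ennreal M * ?g p \<partial>?\<sigma>)"
      by (rule nn_integral_cong) (rule int)
    also have "\<dots> = ennreal M * ennreal (c * (?v * ?r))" by (subst nn_integral_cmult[OF gm]) (simp only: g)
    also have "\<dots> = ennreal (M * (c * (?v * ?r)))" using M(1) c v r by (intro ennreal_mult[symmetric] mult_nonneg_nonneg) simp_all
    finally show ?thesis .
  qed
  have I2: "(\<integral>\<^sup>+p. (\<integral>\<^sup>+q. local_riesz s \<delta> p q * ?g q \<partial>?\<sigma>) \<partial>?\<sigma>) = ennreal (M * (c * (?v * ?r)))"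
  proof -
    have "(\<integral>\<^sup>+p. (\<integral>\<^sup>+q. local_riesz s \<delta> p q * ?g q \<partial>?\<sigma>) \<partial>?\<sigma>) = (\<integral>\<^sup>+q. (\<integral>\<^sup>+p. local_riesz s \<delta> p q * ?g q \<partial>?\<sigma>) \<partial>?\<sigma>)"
      by (rule Fubini'[symmetric, OF measurable_surface_surface[OF m2]])
    also have "\<dots> = (\<integral>\<^sup>+q. (\<integral>\<^sup>+p. local_riesz s \<delta> q p * ?g q \<partial>?\<sigma>) \<partial>?\<sigma>)"
      by (simp only: local_riesz_commute)
    finally show ?thesis unfolding I1 .
  qed
  have "(\<integral>\<^sup>+p. (\<integral>\<^sup>+q. local_riesz s \<delta> p q * ennreal (c * (1 / (norm (fst p))\<^sup>2 + 1 / (norm (fst q))\<^sup>2)) \<partial>?\<sigma>) \<partial>?\<sigma>) =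
    (\<integral>\<^sup>+p. (\<integral>\<^sup>+q. local_riesz s \<delta> p q * ?g p + local_riesz s \<delta> p q * ?g q \<partial>?\<sigma>) \<partial>?\<sigma>)"
  proof (intro nn_integral_cong)
    fix p q :: "'a \<times> real"
    have "c * (1 / (norm (fst p))\<^sup>2 + 1 / (norm (fst q))\<^sup>2) = c / (norm (fst p))\<^sup>2 + c / (norm (fst q))\<^sup>2"
      by (simp add: distrib_left)
    then have "ennreal (c * (1 / (norm (fst p))\<^sup>2 + 1 / (norm (fst q))\<^sup>2)) = ?g p + ?g q"
      using c by (simp only:) (rule ennreal_plus, simp_all)
    then show "local_riesz s \<delta> p q * ennreal (c * (1 / (norm (fst p))\<^sup>2 + 1 / (norm (fst q))\<^sup>2)) = local_riesz s \<delta> p q * ?g p + local_riesz s \<delta> p q * ?g q"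
      by (simp only: distrib_left)
  qed
  also have "\<dots> = (\<integral>\<^sup>+p. (\<integral>\<^sup>+q. local_riesz s \<delta> p q * ?g p \<partial>?\<sigma>) + (\<integral>\<^sup>+q. local_riesz s \<delta> p q * ?g q \<partial>?\<sigma>) \<partial>?\<sigma>)"
    using measurable_Pair2[OF m1] measurable_Pair2[OF m2]
    by (intro nn_integral_cong nn_integral_add borel_measurable_surface_measure) simp_all
  also have "\<dots> = (\<integral>\<^sup>+p. (\<integral>\<^sup>+q. local_riesz s \<delta> p q * ?g p \<partial>?\<sigma>) \<partial>?\<sigma>) + (\<integral>\<^sup>+p. (\<integral>\<^sup>+q. local_riesz s \<delta> p q * ?g q \<partial>?\<sigma>) \<partial>?\<sigma>)"
    by (rule nn_integral_add[OF borel_measurable_surface_measure[OF measurable_nn_integral_surface[OF m1]]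
          borel_measurable_surface_measure[OF measurable_nn_integral_surface[OF m2]]])
  also have "\<dots> = ennreal (M * (c * (?v * ?r)) + M * (c * (?v * ?r)))"
    unfolding I1 I2 using M(1) c v r by (intro ennreal_plus[symmetric] mult_nonneg_nonneg) simp_all
  also have "M * (c * (?v * ?r)) + M * (c * (?v * ?r)) = 2 * c * M * ?v * ?r" unfolding mult_2[symmetric] by (simp only: mult_ac)
  finally show "(\<integral>\<^sup>+p. (\<integral>\<^sup>+q. local_riesz s \<delta> p q * ennreal (c * (1 / (norm (fst p))\<^sup>2 + 1 / (norm (fst q))\<^sup>2)) \<partial>?\<sigma>) \<partial>?\<sigma>)
      = ennreal (2 * c * M * ?v * ?r)" .
qed

text \<open>The tangent bound with X from \<open>fubini_study_ge_chordal\<close>. Inside the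
  truncation the squared chord is at most \<open>\<delta>^2\<close>, and the product of the inverse
  distances to the axis is at most half the sum of their squares, which decouples p and q. Outside
  the truncation the left side vanishes.\<close>

lemma riesz_kernel_power_ge:
  fixes z w :: "complex ^ 'd::finite"
  defines "p \<equiv> sphere_map z" and "q \<equiv> sphere_map w"
  assumes d: "CARD('d) \<ge> 2" and z: "z \<noteq> 0" and w: "w \<noteq> 0" and c: "0 < c" "c < real L"
  shows "local_riesz s \<delta> p q * ennreal ((1 - c / real L) ^ (L - 1) * (1 - c / real L + c)) \<le>
    riesz_kernel s p q * ennreal (((cmod (1 + herm z w))\<^sup>2 / ((1 + (norm z)\<^sup>2) * (1 + (norm w)\<^sup>2))) ^ L) +
    local_riesz s \<delta> p q * ennreal (real L * (1 - c / real L) ^ (L - 1) * (\<delta>\<^sup>2 / 2) * (1 / (norm (fst p))\<^sup>2 + 1 / (norm (fst q))\<^sup>2))"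
proof (cases "norm (p - q) < \<delta>")
  case False
  then show ?thesis by (simp add: local_riesz_def)
next
  case True
  let ?Y = "(cmod (1 + herm z w))\<^sup>2 / ((1 + (norm z)\<^sup>2) * (1 + (norm w)\<^sup>2))"
  let ?X = "(norm (p - q))\<^sup>2 / (norm (fst p) * norm (fst q))"
  let ?W = "1 / (norm (fst p))\<^sup>2 + 1 / (norm (fst q))\<^sup>2"
  define a where "a = real L * (1 - c / real L) ^ (L - 1)"
  have L: "real L > 0" using c by linarith
  have a: "a \<ge> 0" using c L unfolding a_def by (intro mult_nonneg_nonneg zero_le_power) simp_all
  have Y0: "0 \<le> ?Y" by (intro divide_nonneg_nonneg mult_nonneg_nonneg add_nonneg_nonneg) simp_all
  have Y1: "1 - ?X \<le> ?Y" unfolding p_def q_def by (rule fubini_study_ge_chordal[OF d z w])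
  have "?X = (norm (p - q))\<^sup>2 * (1 / norm (fst p) * (1 / norm (fst q)))" by simp
  also have "\<dots> \<le> \<delta>\<^sup>2 * (?W / 2)"
  proof (rule mult_mono)
    show "(norm (p - q))\<^sup>2 \<le> \<delta>\<^sup>2" using True by (intro power_mono) simp_all
    have "0 \<le> (1 / norm (fst p) - 1 / norm (fst q))\<^sup>2" by simp
    then show "1 / norm (fst p) * (1 / norm (fst q)) \<le> ?W / 2"
      unfolding power2_diff power_one_over by simp
  qed simp_all
  finally have X: "?X \<le> \<delta>\<^sup>2 / 2 * ?W" by simp
  have "(1 - c / real L) ^ (L - 1) * (1 - c / real L + c) \<le> ?Y ^ L + a * ?X"
    unfolding a_def by (rule power_lower_bound[OF Y0 Y1 c])
  also have "a * ?X \<le> a * (\<delta>\<^sup>2 / 2 * ?W)" by (rule mult_left_mono[OF X a])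
  finally have "ennreal ((1 - c / real L) ^ (L - 1) * (1 - c / real L + c)) \<le> ennreal (?Y ^ L + a * (\<delta>\<^sup>2 / 2) * ?W)"
    by (intro ennreal_leI) simp
  also have "\<dots> = ennreal (?Y ^ L) + ennreal (a * (\<delta>\<^sup>2 / 2) * ?W)"
    using a by (intro ennreal_plus zero_le_power[OF Y0] mult_nonneg_nonneg add_nonneg_nonneg) simp_all
  finally have "riesz_kernel s p q * ennreal ((1 - c / real L) ^ (L - 1) * (1 - c / real L + c)) \<le>
    riesz_kernel s p q * (ennreal (?Y ^ L) + ennreal (a * (\<delta>\<^sup>2 / 2) * ?W))"
    by (rule mult_left_mono) simp
  then show ?thesis using True unfolding local_riesz_def a_def by (simp only: distrib_left if_True mult_1_right)
qed

lemma ennreal_mult_le_addD: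
  assumes "ennreal x * ennreal y \<le> ennreal k + ennreal x * ennreal z" "0 \<le> k" "0 \<le> x" "0 \<le> y" "0 \<le> z"
  shows "x * y \<le> k + x * z"
proof -
  have "ennreal (x * y) \<le> ennreal (k + x * z)" using assms by (simp add: ennreal_mult)
  then show ?thesis using assms by (subst (asm) ennreal_le_iff) simp_all
qed

text \<open>The pointwise bound is integrated against
  \<open>N^2 * fs_density z * fs_density w\<close> and transported to the sphere. The main term
  becomes \<open>N^2 * M\<close> over the area of the sphere, and the loss is multiplied by the mean
  \<open>(2 * d - 1) / (2 * d - 2)\<close> of the inverse squared distance to the axis.\<close>

lemma kernel_energy_ge:
  fixes L :: nat and c :: real and X :: "'w \<Rightarrow> (complex ^ 'd::finite) set"
  defines "N \<equiv> real ((CARD('d) + L) choose CARD('d))" and "d \<equiv> real CARD('d)" and "u \<equiv> 1 - c / real L"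
  assumes dpp: "projection_DPP P lborel (weighted_poly_space L) X" and s: "s < 2 * d"
    and d: "CARD('d) \<ge> 2" and c: "0 < c" "c < real L"
    and M: "M \<ge> 0" "\<And>p :: (complex ^ 'd) \<times> real. norm p = 1 \<Longrightarrow> (\<integral>\<^sup>+q. local_riesz s \<delta> p q \<partial>surface_measure) = ennreal M"
  shows "N\<^sup>2 * M / sphere_vol TYPE((complex ^ 'd) \<times> real) * u ^ (L - 1) * (u + c - real L * \<delta>\<^sup>2 * ((2 * d - 1) / (2 * d - 2)))
    \<le> kernel_energy s L TYPE(complex ^ 'd)"
proof -
  let ?v = "sphere_vol TYPE((complex ^ 'd) \<times> real)"
  let ?\<sigma> = "surface_measure :: ((complex ^ 'd) \<times> real) measure"
  let ?r = "(2 * d - 1) / (2 * d - 2)"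
  let ?k = "\<lambda>z w :: complex ^ 'd. riesz_kernel s (sphere_map z) (sphere_map w) * ennreal ((cmod (proj_kernel L z w))\<^sup>2)"
  define b where "b = u ^ (L - 1) * (u + c)"
  define a where "a = real L * u ^ (L - 1) * (\<delta>\<^sup>2 / 2)"
  let ?W = "\<lambda>(p :: (complex ^ 'd) \<times> real) (q :: (complex ^ 'd) \<times> real). 1 / (norm (fst p))\<^sup>2 + 1 / (norm (fst q))\<^sup>2"
  let ?f = "\<lambda>p q. local_riesz s \<delta> p q * ennreal (N\<^sup>2 * b)"
  let ?g = "\<lambda>p q. local_riesz s \<delta> p q * ennreal (N\<^sup>2 * a * ?W p q)"
  let ?F = "\<lambda>z w :: complex ^ 'd. ennreal (fs_density z * fs_density w)"
  have v: "?v > 0" by (rule sphere_vol_pos)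
  have L: "real L > 0" using c by linarith
  have u: "u > 0" using c L by (simp add: u_def)
  have b: "b \<ge> 0" using u c unfolding b_def by simp
  have a: "a \<ge> 0" using u L unfolding a_def by simp
  have r: "?r \<ge> 0" using d unfolding d_def by (intro divide_nonneg_nonneg) simp_all
  have inverse_fst_real: "(\<lambda>p. 1 / (norm (fst p))\<^sup>2) \<in> borel_measurable (borel :: ((complex ^ 'd) \<times> real) measure)"
    by (simp add: borel_prod[symmetric])
  have Wm: "(\<lambda>(p, q). ennreal (C * ?W p q)) \<in> borel_measurable (borel \<Otimes>\<^sub>M borel)" for C
    unfolding case_prod_unfold
    by (intro measurable_compose[OF measurable_fst inverse_fst_real] measurable_compose[OF measurable_snd inverse_fst_real]
        measurable_compose[OF _ measurable_ennreal] borel_measurable_times borel_measurable_add borel_measurable_const)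
  have fm: "(\<lambda>(p, q). ?f p q) \<in> borel_measurable (borel \<Otimes>\<^sub>M (borel :: ((complex ^ 'd) \<times> real) measure))" by measurable
  have gm: "(\<lambda>(p, q). ?g p q) \<in> borel_measurable (borel \<Otimes>\<^sub>M (borel :: ((complex ^ 'd) \<times> real) measure))"
    using Wm[of "N\<^sup>2 * a"] by measurable
  note [measurable] = proj_kernel_measurable borel_measurable_sphere_map fm gm
  have pw: "?f (sphere_map z) (sphere_map w) * ?F z w \<le> ?k z w + ?g (sphere_map z) (sphere_map w) * ?F z w"
    if z: "z \<noteq> 0" and w: "w \<noteq> 0" for z w :: "complex ^ 'd"
  proof -
    let ?p = "sphere_map z" and ?q = "sphere_map w"
    let ?Y = "((cmod (1 + herm z w))\<^sup>2 / ((1 + (norm z)\<^sup>2) * (1 + (norm w)\<^sup>2))) ^ L"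
    have Y: "?Y \<ge> 0" by simp
    have W: "0 \<le> ?W ?p ?q" by simp
    have ff: "0 \<le> fs_density z * fs_density w" by (intro mult_nonneg_nonneg fs_density_nonneg)
    let ?C = "ennreal (N\<^sup>2) * ?F z w"
    have "?f ?p ?q * ?F z w = local_riesz s \<delta> ?p ?q * ennreal b * ?C"
      using b by (simp only: ennreal_mult zero_le_power2 mult_ac)
    also have "\<dots> \<le> (riesz_kernel s ?p ?q * ennreal ?Y + local_riesz s \<delta> ?p ?q * ennreal (a * ?W ?p ?q)) * ?C"
      unfolding b_def a_def u_def by (rule mult_right_mono[OF riesz_kernel_power_ge[OF d z w c]]) simp
    also have "\<dots> = riesz_kernel s ?p ?q * (ennreal ?Y * ?C) + local_riesz s \<delta> ?p ?q * (ennreal (a * ?W ?p ?q) * ?C)"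
      by (simp only: distrib_right mult.assoc)
    also have "ennreal ?Y * ?C = ennreal ((cmod (proj_kernel L z w))\<^sup>2)"
      unfolding cmod_proj_kernel_sq N_def[symmetric]
      using Y ff by (simp only: ennreal_mult[symmetric] mult_nonneg_nonneg zero_le_power2) (simp only: mult_ac)
    also have "ennreal (a * ?W ?p ?q) * ?C = ennreal (N\<^sup>2 * a * ?W ?p ?q) * ?F z w"
      using a W ff by (simp only: ennreal_mult mult_nonneg_nonneg zero_le_power2 mult_ac)
    finally show ?thesis by (simp only: mult.assoc)
  qed
  have hm: "(\<lambda>(z, w). ?k z w) \<in> borel_measurable (borel \<Otimes>\<^sub>M borel)" unfolding riesz_kernel_def by measurable
  have gm2: "(\<lambda>(z, w). ?g (sphere_map z) (sphere_map w) * ?F z w) \<in> borel_measurable (borel \<Otimes>\<^sub>M borel)" 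
    using Wm[of "N\<^sup>2 * a"] by measurable
  have inner: "(\<lambda>z. \<integral>\<^sup>+w. g z w \<partial>lborel) \<in> borel_measurable lborel"
    if "(\<lambda>(z, w). g z w) \<in> borel_measurable (borel \<Otimes>\<^sub>M borel)" for g :: "complex ^ 'd \<Rightarrow> complex ^ 'd \<Rightarrow> ennreal"
    by (rule borel_measurable_nn_integral_lborel[OF that])
  have inner': "g z \<in> borel_measurable lborel"
    if "(\<lambda>(z, w). g z w) \<in> borel_measurable (borel \<Otimes>\<^sub>M borel)" for z and g :: "complex ^ 'd \<Rightarrow> complex ^ 'd \<Rightarrow> ennreal"
    using measurable_Pair2[OF that, of z] by simp
  \<comment> \<open>The comparison of distances excludes the origin, which is a null set.\<close>
  have ae: "AE z in lborel. z \<noteq> (0 :: complex ^ 'd)" by (rule AE_lborel_singleton)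
  have "(\<integral>\<^sup>+z. (\<integral>\<^sup>+w. ?f (sphere_map z) (sphere_map w) * ?F z w \<partial>lborel) \<partial>lborel) \<le>
    (\<integral>\<^sup>+z. (\<integral>\<^sup>+w. ?k z w + ?g (sphere_map z) (sphere_map w) * ?F z w \<partial>lborel) \<partial>lborel)"
    using ae
  proof (intro nn_integral_mono_AE, eventually_elim)
    fix z :: "complex ^ 'd" assume z: "z \<noteq> 0"
    show "(\<integral>\<^sup>+w. ?f (sphere_map z) (sphere_map w) * ?F z w \<partial>lborel) \<le> (\<integral>\<^sup>+w. ?k z w + ?g (sphere_map z) (sphere_map w) * ?F z w \<partial>lborel)"
      using ae by (intro nn_integral_mono_AE, eventually_elim) (rule pw[OF z])
  qed
  also have "\<dots> = (\<integral>\<^sup>+z. (\<integral>\<^sup>+w. ?k z w \<partial>lborel) + (\<integral>\<^sup>+w. ?g (sphere_map z) (sphere_map w) * ?F z w \<partial>lborel) \<partial>lborel)"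
    by (intro nn_integral_cong nn_integral_add inner'[OF hm] inner'[OF gm2])
  also have "\<dots> = (\<integral>\<^sup>+z. (\<integral>\<^sup>+w. ?k z w \<partial>lborel) \<partial>lborel) + (\<integral>\<^sup>+z. (\<integral>\<^sup>+w. ?g (sphere_map z) (sphere_map w) * ?F z w \<partial>lborel) \<partial>lborel)"
    by (rule nn_integral_add[OF inner[OF hm] inner[OF gm2]])
  finally have le: "ennreal (1 / ?v\<^sup>2) * (\<integral>\<^sup>+p. (\<integral>\<^sup>+q. ?f p q \<partial>?\<sigma>) \<partial>?\<sigma>) \<le>
    ennreal (kernel_energy s L TYPE(complex ^ 'd)) + ennreal (1 / ?v\<^sup>2) * (\<integral>\<^sup>+p. (\<integral>\<^sup>+q. ?g p q \<partial>?\<sigma>) \<partial>?\<sigma>)"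
    unfolding nn_integral_sphere_map2[OF fm] nn_integral_sphere_map2[OF gm]
      nn_integral_riesz_kernel_proj_kernel[OF dpp s[unfolded d_def]] .
  have f: "(\<integral>\<^sup>+p. (\<integral>\<^sup>+q. ?f p q \<partial>?\<sigma>) \<partial>?\<sigma>) = ennreal (N\<^sup>2 * b * M * ?v)"
    by (rule nn_integral_local_riesz_const[OF DIM_complex_vec M mult_nonneg_nonneg[OF zero_le_power2 b]])
  have g: "(\<integral>\<^sup>+p. (\<integral>\<^sup>+q. ?g p q \<partial>?\<sigma>) \<partial>?\<sigma>) = ennreal (2 * (N\<^sup>2 * a) * M * ?v * ?r)"
    unfolding d_def by (rule nn_integral_local_riesz_inverse_fst[OF DIM_complex_vec M mult_nonneg_nonneg[OF zero_le_power2 a] d])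
  have "1 / ?v\<^sup>2 * (N\<^sup>2 * b * M * ?v) \<le> kernel_energy s L TYPE(complex ^ 'd) + 1 / ?v\<^sup>2 * (2 * (N\<^sup>2 * a) * M * ?v * ?r)"
  proof (rule ennreal_mult_le_addD[OF le[unfolded f g]])
    show "0 \<le> kernel_energy s L TYPE(complex ^ 'd)" by (simp add: kernel_energy_def)
    show "0 \<le> 1 / ?v\<^sup>2" "0 \<le> N\<^sup>2 * b * M * ?v" using v b M(1) by simp_all
    show "0 \<le> 2 * (N\<^sup>2 * a) * M * ?v * ?r" using v a M(1) by (intro mult_nonneg_nonneg r) simp_all
  qed
  moreover have "1 / ?v\<^sup>2 * (N\<^sup>2 * b * M * ?v) = N\<^sup>2 * M / ?v * b"
    using v by (simp add: power2_eq_square)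
  moreover have "1 / ?v\<^sup>2 * (2 * (N\<^sup>2 * a) * M * ?v * ?r) = N\<^sup>2 * M / ?v * (2 * a * ?r)"
    using v by (simp add: power2_eq_square)
  ultimately have "N\<^sup>2 * M / ?v * (b - 2 * a * ?r) \<le> kernel_energy s L TYPE(complex ^ 'd)"
    by (simp only: right_diff_distrib)
  also have "b - 2 * a * ?r = u ^ (L - 1) * (u + c - real L * \<delta>\<^sup>2 * ?r)"
    unfolding b_def a_def by (simp add: right_diff_distrib)
  finally show ?thesis by (simp only: mult.assoc)
qed

section \<open>Asymptotics for large L and conclusion\<close>

text \<open>Induction through the absorption identity: k + 1 times the binomial coefficient of k + 1
  + L over k + 1 is k + 1 + L times that of k + L over k.\<close>

lemma binomial_over_power_tendsto:
  "(\<lambda>L. real ((k + L) choose k) / real L ^ k) \<longlonglongrightarrow> 1 / fact k"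
proof (induction k)
  case (Suc k)
  have "(\<lambda>L. (1 + real (Suc k) / real L) / real (Suc k) * (real ((k + L) choose k) / real L ^ k)) \<longlonglongrightarrow> (1 + 0) / real (Suc k) * (1 / fact k)"
    by (intro tendsto_intros Suc.IH lim_const_over_n) simp
  moreover have "eventually (\<lambda>L. (1 + real (Suc k) / real L) / real (Suc k) * (real ((k + L) choose k) / real L ^ k) =
      real ((Suc k + L) choose Suc k) / real L ^ Suc k) sequentially"
    using eventually_gt_at_top[of 0]
  proof eventually_elim
    case (elim L)
    have "real (Suc k) * real ((Suc k + L) choose Suc k) = real (Suc (k + L)) * real ((k + L) choose k)"
      using arg_cong[OF Suc_times_binomial[of k "k + L"], of real] by (simp only: of_nat_mult add_Suc)
    then have "real ((Suc k + L) choose Suc k) = (real (Suc k) + real L) / real (Suc k) * real ((k + L) choose k)"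
      by (simp add: eq_divide_eq mult.commute add_ac)
    moreover have "1 + real (Suc k) / real L = (real (Suc k) + real L) / real L" using elim by (simp add: add_divide_distrib)
    ultimately show ?case by (simp only:) simp
  qed
  ultimately show ?case by (simp add: filterlim_cong[OF refl refl] tendsto_cong)
qed simp

lemma energy_bound_tendsto:
  fixes d :: nat and x R2 K :: real
  assumes d: "d > 0" and x: "x > 0"
  shows "(\<lambda>L. (real ((d + L) choose d) / real L ^ d) powr (x / real d) * (K * (2 - R2 / (2 * real L)) ^ (d - 1) * (1 - x / real L) ^ L))
    \<longlonglongrightarrow> (1 / fact d) powr (x / real d) * (K * 2 ^ (d - 1) * exp (- x))"
proof -
  have "(\<lambda>L. R2 / 2 / real L) \<longlonglongrightarrow> 0" by (rule lim_const_over_n)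
  then have "(\<lambda>L. 2 - R2 / (2 * real L)) \<longlonglongrightarrow> 2 - 0" by (intro tendsto_intros) simp
  moreover have "(\<lambda>L. (1 + (- x) / real L) ^ L) \<longlonglongrightarrow> exp (- x)" by (rule tendsto_exp_limit_sequentially)
  ultimately show ?thesis
    by (intro tendsto_mult tendsto_powr tendsto_const binomial_over_power_tendsto tendsto_power) simp_all
qed

text \<open>Rewrites the bound as \<open>N powr (1 + s / (2 * d))\<close> times a convergent factor:
  \<open>x / d + 1 + s / (2 * d) = 2\<close>, and \<open>L powr (- x)\<close> joins
  \<open>N powr (x / d)\<close> to form a power of \<open>N / L ^ d\<close>.\<close>

lemma energy_bound_eq:
  fixes d L :: nat and s R2 v v' :: real
  defines "N \<equiv> real ((d + L) choose d)" and "x \<equiv> real d - s / 2"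
  assumes d: "d > 0" and L: "L > 0" and R2: "R2 \<ge> 0"
  shows "N\<^sup>2 * (v' * (2 powr (- s / 2) * (2 - R2 / real L / 2) ^ (d - 1) * ((R2 / real L / 2) powr x / x))) / v * (1 - x / real L) ^ L =
    (N / real L ^ d) powr (x / real d) * (v' / v * 2 powr (- s / 2) * (R2 / 2) powr x / x * (2 - R2 / (2 * real L)) ^ (d - 1) * (1 - x / real L) ^ L)
    * N powr (1 + s / (2 * real d))"
proof -
  have N: "N > 0" unfolding N_def by (simp add: zero_less_binomial_iff)
  have "(N / real L ^ d) powr (x / real d) = N powr (x / real d) / (real L ^ d) powr (x / real d)"
    using N L by (simp add: powr_divide)
  also have "(real L ^ d) powr (x / real d) = real L powr x"
    using L d by (simp add: powr_realpow[symmetric] powr_powr)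
  finally have 1: "(N / real L ^ d) powr (x / real d) = N powr (x / real d) / real L powr x" .
  have "x / real d + (1 + s / (2 * real d)) = 2" using d by (simp add: x_def field_simps)
  then have "N powr (x / real d) * N powr (1 + s / (2 * real d)) = N powr 2" by (simp only: powr_add[symmetric])
  also have "\<dots> = N\<^sup>2" using N by (simp add: powr_numeral)
  finally have 2: "N\<^sup>2 = N powr (x / real d) * N powr (1 + s / (2 * real d))" by simp
  have "(R2 / real L / 2) powr x = (R2 / 2 / real L) powr x" by (simp add: mult.commute)
  also have "\<dots> = (R2 / 2) powr x / real L powr x" by (rule powr_divide)
  finally have 3: "(R2 / real L / 2) powr x = (R2 / 2) powr x / real L powr x" .
  have 4: "R2 / real L / 2 = R2 / (2 * real L)" by simp
  show ?thesis unfolding 1 2 3 unfolding 4 by (simp add: mult_ac)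
qed

text \<open>With \<open>c = x\<close> and \<open>\<delta>^2 = R2 / L\<close> the loss
  \<open>L * \<delta>^2 * (2 * d - 1) / (2 * d - 2)\<close> equals
  \<open>x * (2 * d - 1) / (2 * d)\<close>, hence is at most x. The bracket in
  \<open>kernel_energy_ge\<close> is then at least u, which completes \<open>u ^ (L - 1)\<close> to
  \<open>u ^ L\<close>.\<close>

lemma kernel_energy_ge_power:
  fixes L :: nat and X :: "'w \<Rightarrow> (complex ^ 'd::finite) set" and s :: real
  defines "d \<equiv> real CARD('d)"
  defines "x \<equiv> d - s / 2"
  defines "R2 \<equiv> x * (1 - 1 / d)"
  assumes dpp: "projection_DPP P lborel (weighted_poly_space L) X" and s: "s < 2 * d"
    and d: "CARD('d) \<ge> 2" and L: "x < real L"
  shows "(real ((CARD('d) + L) choose CARD('d)))\<^sup>2 * (sphere_vol TYPE(complex ^ 'd) *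
      (2 powr (- s / 2) * (2 - R2 / real L / 2) ^ (CARD('d) - 1) * ((R2 / real L / 2) powr x / x))) /
      sphere_vol TYPE((complex ^ 'd) \<times> real) * (1 - x / real L) ^ L \<le> kernel_energy s L TYPE(complex ^ 'd)"
proof -
  let ?N = "real ((CARD('d) + L) choose CARD('d))" and ?v = "sphere_vol TYPE((complex ^ 'd) \<times> real)"
  let ?m = "sphere_vol TYPE(complex ^ 'd) * (2 powr (- s / 2) * (2 - R2 / real L / 2) ^ (CARD('d) - 1) * ((R2 / real L / 2) powr x / x))"
  have d2: "d \<ge> 2" using d by (simp add: d_def)
  have x: "x > 0" using s by (simp add: x_def)
  have R2: "R2 > 0" "R2 \<le> x" using x d2 by (simp_all add: R2_def mult_le_cancel_left1)
  have L0: "real L > 0" using x L by linarith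
  define \<delta> where "\<delta> = sqrt (R2 / real L)"
  have \<delta>2: "\<delta>\<^sup>2 = R2 / real L" using R2 L0 by (simp add: \<delta>_def)
  have \<delta>: "0 < \<delta>" "\<delta> \<le> 1" using R2 L L0 by (simp_all add: \<delta>_def)
  obtain M where M: "M \<ge> 0" "\<And>p :: (complex ^ 'd) \<times> real. norm p = 1 \<Longrightarrow> (\<integral>\<^sup>+q. local_riesz s \<delta> p q \<partial>surface_measure) = ennreal M"
    using ex_local_riesz_mass[where 'a = "complex ^ 'd", OF DIM_complex_vec s[unfolded d_def]] by blast
  have e: "norm ((0, 1) :: (complex ^ 'd) \<times> real) = 1" by (simp add: norm_Pair)
  have "ennreal ?m \<le> ennreal M"
    using nn_integral_local_riesz_ge[OF e DIM_complex_vec s[unfolded d_def] \<delta>]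
    unfolding M(2)[OF e] \<delta>2 x_def d_def .
  then have m: "?m \<le> M" using M(1) by (simp add: ennreal_le_iff)
  define u where "u = 1 - x / real L"
  have u: "u > 0" using L L0 by (simp add: u_def)
  have "real L * \<delta>\<^sup>2 * ((2 * d - 1) / (2 * d - 2)) = R2 * ((2 * d - 1) / (2 * d - 2))" using L0 by (simp add: \<delta>2)
  also have "\<dots> = x * ((2 * d - 1) / (2 * d))"
  proof -
    have "(1 - 1 / d) * ((2 * d - 1) / (2 * d - 2)) = (2 * d - 1) / (2 * d)" using d2 by (simp add: field_simps)
    then show ?thesis by (simp only: R2_def mult.assoc)
  qed
  also have "\<dots> \<le> x * 1" using x d2 by (intro mult_left_mono) simp_all
  finally have b: "u \<le> u + x - real L * \<delta>\<^sup>2 * ((2 * d - 1) / (2 * d - 2))" by simp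
  have "?N\<^sup>2 * ?m / ?v * u ^ L \<le> ?N\<^sup>2 * M / ?v * u ^ L"
    using m u sphere_vol_pos[where 'a = "(complex ^ 'd) \<times> real"]
    by (intro mult_right_mono divide_right_mono mult_left_mono) simp_all
  also have "\<dots> = ?N\<^sup>2 * M / ?v * (u ^ (L - 1) * u)" using L0 by (subst power_minus_mult) simp_all
  also have "?N\<^sup>2 * M / ?v * (u ^ (L - 1) * u) \<le> ?N\<^sup>2 * M / ?v * (u ^ (L - 1) * (u + x - real L * \<delta>\<^sup>2 * ((2 * d - 1) / (2 * d - 2))))"
    using b u M(1) sphere_vol_pos[where 'a = "(complex ^ 'd) \<times> real"] by (intro mult_left_mono) simp_all
  also have "\<dots> \<le> kernel_energy s L TYPE(complex ^ 'd)"
    using kernel_energy_ge[OF dpp s[unfolded d_def] d x L M] unfolding u_def d_def by (simp only: mult.assoc)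
  finally show ?thesis unfolding u_def .
qed

theorem theorem5p1:
  fixes s :: real
    and P :: "nat \<Rightarrow> 'w measure"
    and X :: "nat \<Rightarrow> 'w \<Rightarrow> (complex ^ 'd::finite) set"
  defines "d \<equiv> real CARD('d)"
    and "N \<equiv> (\<lambda>L. real ((CARD('d) + L) choose CARD('d)))"
    and "VolS2d \<equiv> sphere_vol TYPE((complex ^ 'd) \<times> real)"
    and "VolS2dm1 \<equiv> sphere_vol TYPE(complex ^ 'd)"
    and "V \<equiv> riesz_V TYPE((complex ^ 'd) \<times> real) s"
  assumes s: "0 < s" "s < 2 * d"
    and X: "\<And>L. projection_DPP (P L) lborel (weighted_poly_space L) (X L)"
  shows "\<exists>err :: nat \<Rightarrow> real. err \<in> o(\<lambda>L. N L powr (1 + s / (2 * d))) \<and>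
    (\<forall>L. integrable (P L) (\<lambda>w. riesz_energy s (sphere_config (X L w))) \<and>
      (\<integral>w. riesz_energy s (sphere_config (X L w)) \<partial>P L) \<le>
        V * (N L)\<^sup>2
        - (VolS2dm1 * ((2 * d - s) * (1 - 1 / d) / (2 * exp 1)) powr (d - s / 2))
            / ((2 * d - s) * VolS2d * (fact CARD('d)) powr (1 - s / (2 * d)))
          * (1 - exp (- 1 + 1 / (2 * d)) / (2 * sqrt (1 - 1 / (2 * d))))
          * N L powr (1 + s / (2 * d))
        + err L)"
proof -
  let ?p = "1 + s / (2 * d)"
  let ?c0 = "(VolS2dm1 * ((2 * d - s) * (1 - 1 / d) / (2 * exp 1)) powr (d - s / 2))
            / ((2 * d - s) * VolS2d * (fact CARD('d)) powr (1 - s / (2 * d)))"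
  let ?\<kappa> = "exp (- 1 + 1 / (2 * d)) / (2 * sqrt (1 - 1 / (2 * d)))"
  let ?T = "\<lambda>L. kernel_energy s L TYPE(complex ^ 'd)"
  define C where "C = ?c0 * (1 - ?\<kappa>)"
  \<comment> \<open>The least nonnegative error for which the inequality holds, so that only its
    size remains to be estimated.\<close>
  define err where "err = (\<lambda>L. max 0 (C * N L powr ?p - ?T L))"
  have v: "VolS2d > 0" "VolS2dm1 > 0" unfolding VolS2d_def VolS2dm1_def by (rule sphere_vol_pos)+
  have d1: "d \<ge> 1" unfolding d_def by (simp add: Suc_leI)
  have N: "N L > 0" for L unfolding N_def by (simp add: zero_less_binomial_iff)
  have s': "s < 2 * real CARD('d)" using s by (simp add: d_def)
  have c0: "?c0 \<ge> 0" using s v by (intro divide_nonneg_nonneg mult_nonneg_nonneg) simp_all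
  have "?\<kappa> \<ge> 0" using d1 by (intro divide_nonneg_nonneg mult_nonneg_nonneg) simp_all
  \<comment> \<open>The last factor of the constant is at most 1, so a lower bound for T with
    limiting constant \<open>?c0\<close> is enough.\<close>
  then have C: "C \<le> ?c0" unfolding C_def using c0 by (intro mult_left_le) simp_all
  have T: "0 \<le> ?T L" for L by (simp add: kernel_energy_def)
  have "(\<lambda>L. err L / N L powr ?p) \<longlonglongrightarrow> 0"
  proof (cases "CARD('d) \<ge> 2")
    case False
    \<comment> \<open>For d = 1 the factor \<open>1 - 1 / d\<close> makes the base of the power 0,
      and \<open>0 powr _ = 0\<close>; so C = 0 and nonnegativity of T suffices.\<close>
    then have "CARD('d) = 1" using zero_less_card_finite[where 'a = 'd] by linarith
    then have "d = 1" by (simp add: d_def)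
    then have "C = 0" by (simp add: C_def)
    then have "err L = 0" for L using T[of L] by (simp add: err_def)
    then show ?thesis by simp
  next
    case True
    define x where "x = d - s / 2"
    define R2 where "R2 = x * (1 - 1 / d)"
    define K where "K = VolS2dm1 / VolS2d * 2 powr (- s / 2) * (R2 / 2) powr x / x"
    \<comment> \<open>The bound of \<open>kernel_energy_ge_power\<close> divided by
      \<open>N L powr (1 + s / (2 * d))\<close>, in the form given by
      \<open>energy_bound_eq\<close>.\<close>
    define b where "b = (\<lambda>L. (N L / real L ^ CARD('d)) powr (x / d) * (K * (2 - R2 / (2 * real L)) ^ (CARD('d) - 1) * (1 - x / real L) ^ L))"
    have x: "x > 0" using s by (simp add: x_def)
    have R2: "R2 \<ge> 0" using x d1 by (simp add: R2_def)
    have dpos: "CARD('d) > 0" by simp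
    \<comment> \<open>The powers of 2 from the truncated Riesz integral combine to
      \<open>2 powr x / 2\<close> and cancel the one in \<open>(R2 / 2) powr x\<close>; the factor
      \<open>exp (- x)\<close> supplies the e in the base of the power in the theorem.\<close>
    have "(1 / fact CARD('d)) powr (x / d) * (K * 2 ^ (CARD('d) - 1) * exp (- x)) = ?c0"
    proof -
      have 1: "(2 * d - s) * (1 - 1 / d) / (2 * exp 1) = R2 / exp 1" and 2: "2 * d - s = 2 * x"
        by (simp_all add: R2_def x_def algebra_simps diff_divide_distrib add_divide_distrib)
      have 3: "1 - s / (2 * d) = x / d" using d1 by (simp add: x_def field_simps)
      have 4: "(R2 / exp 1) powr x = R2 powr x * exp (- x)"
        by (subst powr_divide) (use R2 in \<open>simp_all add: exp_powr_real exp_minus divide_inverse\<close>)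
      have 5: "(1 / fact CARD('d)) powr (x / d) = 1 / (fact CARD('d) powr (x / d) :: real)" by (simp add: powr_divide)
      have "2 ^ (CARD('d) - 1) = (2 powr (d - 1) :: real)"
        by (simp add: d_def powr_realpow[symmetric] of_nat_diff Suc_leI)
      then have "2 powr (- s / 2) * 2 ^ (CARD('d) - 1) = 2 powr (- s / 2 + (d - 1))" by (simp only: powr_add)
      also have "- s / 2 + (d - 1) = x - 1" by (simp add: x_def)
      also have "2 powr (x - 1) = (2 powr x / 2 :: real)" by (simp add: powr_diff)
      finally have 6: "2 powr (- s / 2) * 2 ^ (CARD('d) - 1) = (2 powr x / 2 :: real)" .
      have 7: "(R2 / 2) powr x = R2 powr x / 2 powr x" using R2 by (simp add: powr_divide)
      have "K * 2 ^ (CARD('d) - 1) = VolS2dm1 / VolS2d * (2 powr (- s / 2) * 2 ^ (CARD('d) - 1)) * (R2 / 2) powr x / x"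
        by (simp add: K_def)
      also have "\<dots> = VolS2dm1 / VolS2d * R2 powr x / (2 * x)" unfolding 6 7 by simp
      finally have 8: "K * 2 ^ (CARD('d) - 1) = VolS2dm1 / VolS2d * R2 powr x / (2 * x)" .
      show ?thesis unfolding 1 3 x_def[symmetric] 4 5 8 unfolding 2 by (simp add: mult_ac)
    qed
    then have lim: "b \<longlonglongrightarrow> ?c0"
      using energy_bound_tendsto[OF dpos x, of K R2] unfolding b_def N_def d_def by simp
    have "(\<lambda>L. max 0 (C - b L)) \<longlonglongrightarrow> max 0 (C - ?c0)" by (intro tendsto_intros lim)
    then have upper: "(\<lambda>L. max 0 (C - b L)) \<longlonglongrightarrow> 0" using C by simp
    have "eventually (\<lambda>L. err L / N L powr ?p \<le> max 0 (C - b L)) sequentially"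
    proof -
      have "eventually (\<lambda>L. x < real L) sequentially"
        using filterlim_real_sequentially by (simp add: filterlim_at_top_dense)
      then show ?thesis
      proof eventually_elim
        case (elim L)
        have L: "L > 0" using elim x by (cases L) simp_all
        have "b L * N L powr ?p = (N L)\<^sup>2 * (VolS2dm1 * (2 powr (- s / 2) * (2 - R2 / real L / 2) ^ (CARD('d) - 1) *
            ((R2 / real L / 2) powr x / x))) / VolS2d * (1 - x / real L) ^ L"
          unfolding b_def K_def N_def x_def d_def by (rule energy_bound_eq[OF dpos L R2, symmetric])
        also have "\<dots> \<le> ?T L"
          using kernel_energy_ge_power[OF X s' True elim[unfolded x_def d_def]]
          unfolding N_def R2_def x_def d_def VolS2d_def VolS2dm1_def .
        finally have "b L * N L powr ?p \<le> ?T L" .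
        then have "C * N L powr ?p - ?T L \<le> (C - b L) * N L powr ?p" by (simp add: left_diff_distrib)
        also have "\<dots> \<le> max 0 (C - b L) * N L powr ?p" by (intro mult_right_mono) simp_all
        finally have "err L \<le> max 0 (C - b L) * N L powr ?p" by (simp add: err_def)
        then show ?case using N[of L] by (simp add: divide_le_eq)
      qed
    qed
    from tendsto_sandwich[OF _ this tendsto_const upper] show ?thesis by (simp add: err_def)
  qed
  then have "err \<in> o(\<lambda>L. N L powr ?p)"
    by (rule smalloI_tendsto) (use N in \<open>simp add: less_imp_neq[symmetric]\<close>)
  moreover have "integrable (P L) (\<lambda>w. riesz_energy s (sphere_config (X L w)))" for L
    by (rule integrable_riesz_energy[OF X s'])
  moreover have "(\<integral>w. riesz_energy s (sphere_config (X L w)) \<partial>P L) \<le> V * (N L)\<^sup>2 - C * N L powr ?p + err L" for L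
    unfolding integral_riesz_energy[OF X s'] V_def N_def by (simp add: err_def N_def)
  ultimately show ?thesis unfolding C_def by blast
qed

end
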